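(* Let $(M=\mathbb{R}^{>0}\times S,J,g,\xi)$ be a pseudo-Kähler cone endowed with the holomorphic Killing field $Z=2J\xi$, put $\lambda=\mathrm{sgn}\,g(\xi,\xi)$, and let $\tilde\eta$, $\breve g$ and $\breve M\subset S$ be as defined in the context. The K/K correspondence assigns to these data, for each $c\in\mathbb{R}$ (corresponding to the Hamiltonian $f=\lambda r^2-c$, $r^2=|g(\xi,\xi)|$), the manifolds $M'_\pm:=I_\pm\times S^1\times\breve M$, where $$I_+:=\begin{cases}(\max\{0,-2c\},\infty)&\text{for }\lambda=1\\(\min\{-2c,0\},-c)&\text{for }\lambda=-1,\end{cases}\qquad I_-:=\begin{cases}(-c,\max\{0,-2c\})&\text{for }\lambda=1\\(-\infty,\min\{-2c,0\})&\text{for }\lambda=-1,\end{cases}$$ endowed with the metric $$g'=\frac{1}{2|\rho|}\left[\lambda(\rho+c)\breve g-\frac{1}{4\rho}\frac{\rho+2c}{\rho+c}d\rho^2-\frac{1}{4\rho}\frac{\rho+c}{\rho+2c}(d\tilde\phi-2c\,\tilde\eta|_{\breve M})^2\right].$$ Here $\tilde\phi$ is a local coordinate on the factor $S^1=\{e^{-\frac{i}{4}\tilde\phi}\mid\tilde\phi\in\mathbb{R}\}$ and $\rho\in I_\pm$. The signature of $(M'_+,g')$ is $(2k,2l+2)$ and that of $(M'_-,g')$ is $(2k+2,2l)$, where $(2k,2l)$ is the signature of $\breve g$ (on $\breve M$). For $c=0$, $$(M'_\pm,2g')=(\pm\mathbb{R}^{>0}\times S^1\times\breve M,\ \mp g_{\mathbb{C}H^1}+\breve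 g)\cong(\mathbb{R}^{>0}\times S^1\times\breve M,\ \mp g_{\mathbb{C}H^1}+\breve g),$$ where $\pm$ corresponds to $\lambda=\pm1$, respectively, and $g_{\mathbb{C}H^1}:=\frac{1}{4\rho^2}(d\rho^2+d\tilde\phi^2)$.
   Context: Conical pseudo-Kähler manifold $(M,J,g,\xi)$: a pseudo-Kähler manifold with a space-like or time-like vector field $\xi$ (Euler field) such that $D\xi=\mathrm{Id}$, $D$ the Levi-Civita connection. Pseudo-Kähler cone: additionally $M=\mathbb{R}^{>0}\times S$ is globally a metric cone $g=\lambda\, dr^2+r^2g_S$ with $\xi=r\partial_r$ over a pseudo-Sasaki manifold $S$ with Reeb field $J\xi|_S$. Set $r^2=|g(\xi,\xi)|$, $\lambda=\mathrm{sgn}\,g(\xi,\xi)$, $\tilde\eta=\frac{\lambda}{r^2}g(J\xi,\cdot)$; $S=\{r=1\}$. The tensor $\breve g$ on $M$ is defined by $g=\lambda\big(dr^2+r^2(\tilde\eta^2+\lambda\breve g)\big)$; it has kernel $\mathrm{span}\{\xi,J\xi\}$ and is invariant under $\xi$ and $J\xi$. $\breve M\subset S$ is a codimension $1$ submanifold transversal to $J\xi|_S$; it inherits a pseudo-Kähler structure with metric $\breve g|_{\breve M}$. K/K correspondence: given a pseudo-Kähler manifold $(M,g,J)$, $\omega=g(J\cdot,\cdot)$, a time-like or space-like Hamiltonian Killing field $Z$, and $f$ with $df=-\omega(Z,\cdot)$ such that $f$ and $f_1=f-\frac12g(Z,Z)$ do not vanish (restricting to the open subset where this holds if necessary), take an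 $S^1$-principal bundle $P\to M$ with connection $\eta$ with curvature $d\eta=\omega-\frac12d(g(Z,\cdot))$ (here the trivial bundle $P=M\times S^1$, $S^1=\{e^{is}\}$, with $\eta=ds-\frac14g(Z,\cdot)$), $g_P=\frac{2}{f_1}\eta^2+\pi^*g$, $\theta^P_0=-\frac12df$, $\theta^P_1=\eta+\frac12g(Z,\cdot)$, $\tilde g_P=g_P-\frac2f\big((\theta_0^P)^2+(\theta_1^P)^2\big)$, $Z^P=\tilde Z+f_1X_P$ ($\tilde Z$ horizontal lift, $X_P$ fundamental vector field). The correspondence assigns to $(M,g,J,Z,f)$ the pseudo-Kähler metric $g'=\frac{1}{2|f|}\tilde g_P|_{M'}$ on a codimension $1$ submanifold $M'\subset P$ transversal to $Z^P$. Here $M'$ is (an open part of) $\mathbb{R}^{>0}\times\breve M\times S^1\subset P$, with coordinates $\rho=f=\lambda r^2-c$ and $\tilde\phi=-4s$. An interval with coinciding endpoints is empty. *)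

theory Defs
  imports "HOL-Analysis.Analysis" "HOL-Library.Function_Algebras"
begin

section \<open>Smooth manifolds\<close>

text \<open>Pointwise real vector space structure on functions; tangent vectors below are functions.\<close>

instantiation "fun" :: (type, real_vector) real_vector
begin

definition scaleR_fun :: "real \<Rightarrow> ('a \<Rightarrow> 'b) \<Rightarrow> 'a \<Rightarrow> 'b"
  where "scaleR_fun a f = (\<lambda>x. a *\<^sub>R f x)"

instance
  by standard (auto simp: scaleR_fun_def fun_eq_iff algebra_simps)

end

primrec ck_on :: "nat \<Rightarrow> 'a set \<Rightarrow> ('a::real_normed_vector \<Rightarrow> 'b::real_normed_vector) \<Rightarrow> bool" where
  "ck_on 0 U f \<longleftrightarrow> continuous_on U f"
| "ck_on (Suc k) U f \<longleftrightarrow> (\<forall>x\<in>U. f differentiable (at x)) \<and>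
     (\<forall>v. ck_on k U (\<lambda>x. frechet_derivative f (at x) v))"

text \<open>Only used for open sets \<open>U\<close> in finite-dimensional spaces.\<close>

definition smooth_on :: "'a set \<Rightarrow> ('a::real_normed_vector \<Rightarrow> 'b::real_normed_vector) \<Rightarrow> bool"
  where "smooth_on U f \<longleftrightarrow> (\<forall>k. ck_on k U f)"

text \<open>
  A smooth manifold is given by an atlas; a chart is a pair of a domain and a map into the
  model space.  The model space is a finite-dimensional \<^class>\<open>real_inner\<close> type rather than a
  \<^class>\<open>euclidean_space\<close>, because the latter class excludes dimension \<open>0\<close>.
\<close>

type_synonym ('p, 'e) atlas = "('p set \<times> ('p \<Rightarrow> 'e)) set"

definition points :: "('p, 'e) atlas \<Rightarrow> 'p set"
  where "points A = (\<Union>(U, \<phi>)\<in>A. U)"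

definition open_in :: "('p::topological_space, 'e) atlas \<Rightarrow> 'p set \<Rightarrow> bool"
  where "open_in A W \<longleftrightarrow> openin (top_of_set (points A)) W"

definition manifold :: "('p::topological_space, 'e::real_inner) atlas \<Rightarrow> bool" where
  "manifold A \<longleftrightarrow>
     (\<exists>B::'e set. finite B \<and> span B = UNIV) \<and>
     Hausdorff_space (top_of_set (points A)) \<and> second_countable (top_of_set (points A)) \<and>
     (\<forall>(U, \<phi>)\<in>A. open_in A U \<and> open (\<phi> ` U) \<and> homeomorphism U (\<phi> ` U) \<phi> (inv_into U \<phi>)) \<and>
     (\<forall>(U, \<phi>)\<in>A. \<forall>(V, \<psi>)\<in>A. smooth_on (\<phi> ` (U \<inter> V)) (\<psi> \<circ> inv_into U \<phi>))"

definition open_atlas :: "'e set \<Rightarrow> ('e, 'e) atlas"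
  where "open_atlas I = {(I, \<lambda>x. x)}"

definition prod_atlas :: "('p, 'e) atlas \<Rightarrow> ('q, 'f) atlas \<Rightarrow> ('p \<times> 'q, 'e \<times> 'f) atlas"
  where "prod_atlas A B = (\<lambda>((U, \<phi>), (V, \<psi>)). (U \<times> V, map_prod \<phi> \<psi>)) ` (A \<times> B)"

definition restrict_atlas :: "('p, 'e) atlas \<Rightarrow> 'p set \<Rightarrow> ('p, 'e) atlas"
  where "restrict_atlas A W = (\<lambda>(U, \<phi>). (U \<inter> W, \<phi>)) ` A"

text \<open>The circle, with the charts \<open>z\<^sub>0 e\<^sup>i\<^sup>s \<mapsto> s \<in> (-\<pi>, \<pi>)\<close>.\<close>

definition circle_atlas :: "(complex, real) atlas"
  where "circle_atlas = (\<lambda>z0. (sphere 0 1 - {- z0}, \<lambda>u. Arg (u / z0))) ` sphere 0 1"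

definition smooth_fn :: "('p::topological_space, 'e::real_inner) atlas \<Rightarrow> 'p set \<Rightarrow> ('p \<Rightarrow> real) \<Rightarrow> bool" where
  "smooth_fn A W f \<longleftrightarrow> open_in A W \<and> (\<forall>(U, \<phi>)\<in>A. smooth_on (\<phi> ` (U \<inter> W)) (f \<circ> inv_into U \<phi>))"

definition smooth_at :: "('p::topological_space, 'e::real_inner) atlas \<Rightarrow> 'p \<Rightarrow> ('p \<Rightarrow> real) \<Rightarrow> bool" where
  "smooth_at A p f \<longleftrightarrow> (\<exists>W. p \<in> W \<and> smooth_fn A W f)"

definition smooth_map :: "('p::topological_space, 'e::real_inner) atlas \<Rightarrow>
    ('q::topological_space, 'f::real_inner) atlas \<Rightarrow> ('p \<Rightarrow> 'q) \<Rightarrow> bool" where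
  "smooth_map A B F \<longleftrightarrow> F ` points A \<subseteq> points B \<and> continuous_on (points A) F \<and>
     (\<forall>(U, \<phi>)\<in>A. \<forall>(V, \<psi>)\<in>B. smooth_on (\<phi> ` {x \<in> U. F x \<in> V}) (\<psi> \<circ> F \<circ> inv_into U \<phi>))"

definition diffeomorphism :: "('p::topological_space, 'e::real_inner) atlas \<Rightarrow>
    ('q::topological_space, 'f::real_inner) atlas \<Rightarrow> ('p \<Rightarrow> 'q) \<Rightarrow> bool" where
  "diffeomorphism A B F \<longleftrightarrow> manifold A \<and> manifold B \<and> bij_betw F (points A) (points B) \<and>
     smooth_map A B F \<and> smooth_map B A (inv_into (points A) F)"


section \<open>Tangent vectors and vector fields\<close>

text \<open>
  A tangent vector at \<open>p\<close> is the operator \<open>f \<mapsto> (f \<circ> \<gamma>)'(0)\<close> given by a smooth curve \<open>\<gamma>\<close> through \<open>p\<close>,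
  acting on functions that are smooth near \<open>p\<close>.  On all other functions it is set to \<open>0\<close>, so that
  two tangent vectors are equal as functions iff they agree on all functions smooth near \<open>p\<close>.
\<close>

type_synonym 'p tvec = "('p \<Rightarrow> real) \<Rightarrow> real"

definition velocity :: "('p::topological_space, 'e::real_inner) atlas \<Rightarrow> (real \<Rightarrow> 'p) \<Rightarrow> 'p tvec" where
  "velocity A \<gamma> = (\<lambda>f. if smooth_at A (\<gamma> 0) f then deriv (f \<circ> \<gamma>) 0 else 0)"

definition tangent_space :: "('p::topological_space, 'e::real_inner) atlas \<Rightarrow> 'p \<Rightarrow> 'p tvec set" where
  "tangent_space A p =
     {velocity A \<gamma> |\<gamma> \<epsilon>. \<epsilon> > 0 \<and> smooth_map (open_atlas {-\<epsilon><..<\<epsilon>}) A \<gamma> \<and> \<gamma> 0 = p}"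

text \<open>The differential at \<open>p\<close> of a map \<open>F\<close> into the manifold \<open>B\<close>.\<close>

definition pushforward :: "('q::topological_space, 'f::real_inner) atlas \<Rightarrow> ('p \<Rightarrow> 'q) \<Rightarrow> 'p \<Rightarrow> 'p tvec \<Rightarrow> 'q tvec" where
  "pushforward B F p v = (\<lambda>h. if smooth_at B (F p) h then v (h \<circ> F) else 0)"

definition vector_field :: "('p::topological_space, 'e::real_inner) atlas \<Rightarrow> 'p set \<Rightarrow> ('p \<Rightarrow> 'p tvec) \<Rightarrow> bool" where
  "vector_field A W X \<longleftrightarrow> open_in A W \<and> (\<forall>p\<in>W. X p \<in> tangent_space A p) \<and>
     (\<forall>V f. V \<subseteq> W \<longrightarrow> smooth_fn A V f \<longrightarrow> smooth_fn A V (\<lambda>p. X p f))"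

definition lie_bracket :: "('p::topological_space, 'e::real_inner) atlas \<Rightarrow>
    ('p \<Rightarrow> 'p tvec) \<Rightarrow> ('p \<Rightarrow> 'p tvec) \<Rightarrow> 'p \<Rightarrow> 'p tvec" where
  "lie_bracket A X Y p = (\<lambda>f. if smooth_at A p f then X p (\<lambda>q. Y q f) - Y p (\<lambda>q. X q f) else 0)"


section \<open>Tensor fields\<close>

definition linear_on :: "'v set \<Rightarrow> ('v::real_vector \<Rightarrow> 'w::real_vector) \<Rightarrow> bool" where
  "linear_on V L \<longleftrightarrow> (\<forall>v\<in>V. \<forall>w\<in>V. \<forall>a b. L (a *\<^sub>R v + b *\<^sub>R w) = a *\<^sub>R L v + b *\<^sub>R L w)"

definition bilinear_on :: "'v set \<Rightarrow> ('v::real_vector \<Rightarrow> 'v \<Rightarrow> real) \<Rightarrow> bool" where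
  "bilinear_on V b \<longleftrightarrow> (\<forall>v\<in>V. linear_on V (b v) \<and> linear_on V (\<lambda>w. b w v))"

type_synonym 'p form1 = "'p \<Rightarrow> 'p tvec \<Rightarrow> real"
type_synonym 'p tensor2 = "'p \<Rightarrow> 'p tvec \<Rightarrow> 'p tvec \<Rightarrow> real"
type_synonym 'p endo = "'p \<Rightarrow> 'p tvec \<Rightarrow> 'p tvec"

definition one_form :: "('p::topological_space, 'e::real_inner) atlas \<Rightarrow> 'p form1 \<Rightarrow> bool" where
  "one_form A \<alpha> \<longleftrightarrow> (\<forall>p\<in>points A. linear_on (tangent_space A p) (\<alpha> p)) \<and>
     (\<forall>W X. vector_field A W X \<longrightarrow> smooth_fn A W (\<lambda>p. \<alpha> p (X p)))"

definition smooth_tensor2 :: "('p::topological_space, 'e::real_inner) atlas \<Rightarrow> 'p tensor2 \<Rightarrow> bool" where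
  "smooth_tensor2 A b \<longleftrightarrow> (\<forall>p\<in>points A. bilinear_on (tangent_space A p) (b p)) \<and>
     (\<forall>W X Y. vector_field A W X \<longrightarrow> vector_field A W Y \<longrightarrow> smooth_fn A W (\<lambda>p. b p (X p) (Y p)))"

definition pullback1 :: "('q::topological_space, 'f::real_inner) atlas \<Rightarrow> ('p \<Rightarrow> 'q) \<Rightarrow> 'q form1 \<Rightarrow> 'p form1" where
  "pullback1 B F \<alpha> = (\<lambda>p v. \<alpha> (F p) (pushforward B F p v))"

definition pullback2 :: "('q::topological_space, 'f::real_inner) atlas \<Rightarrow> ('p \<Rightarrow> 'q) \<Rightarrow> 'q tensor2 \<Rightarrow> 'p tensor2" where
  "pullback2 B F b = (\<lambda>p v w. b (F p) (pushforward B F p v) (pushforward B F p w))"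

definition pseudo_riemannian :: "('p::topological_space, 'e::real_inner) atlas \<Rightarrow> 'p tensor2 \<Rightarrow> bool" where
  "pseudo_riemannian A g \<longleftrightarrow> manifold A \<and> smooth_tensor2 A g \<and>
     (\<forall>p\<in>points A. \<forall>v\<in>tangent_space A p.
        (\<forall>w\<in>tangent_space A p. g p v w = g p w v) \<and>
        ((\<forall>w\<in>tangent_space A p. g p v w = 0) \<longrightarrow> v = 0))"

text \<open>Signature \<open>(m, n)\<close>: a diagonalizing basis has \<open>m\<close> positive and \<open>n\<close> negative vectors.\<close>

definition has_signature :: "'v::real_vector set \<Rightarrow> ('v \<Rightarrow> 'v \<Rightarrow> real) \<Rightarrow> nat \<Rightarrow> nat \<Rightarrow> bool" where
  "has_signature V b m n \<longleftrightarrow> bilinear_on V b \<and> (\<forall>v\<in>V. \<forall>w\<in>V. b v w = b w v) \<and>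
     (\<exists>Pos Neg. finite Pos \<and> finite Neg \<and> Pos \<inter> Neg = {} \<and> card Pos = m \<and> card Neg = n \<and>
        independent (Pos \<union> Neg) \<and> span (Pos \<union> Neg) = V \<and>
        (\<forall>v\<in>Pos \<union> Neg. \<forall>w\<in>Pos \<union> Neg. v \<noteq> w \<longrightarrow> b v w = 0) \<and>
        (\<forall>v\<in>Pos. b v v > 0) \<and> (\<forall>v\<in>Neg. b v v < 0))"

definition metric_signature :: "('p::topological_space, 'e::real_inner) atlas \<Rightarrow> 'p tensor2 \<Rightarrow> nat \<Rightarrow> nat \<Rightarrow> bool" where
  "metric_signature A g m n \<longleftrightarrow> (\<forall>p\<in>points A. has_signature (tangent_space A p) (g p) m n)"

text \<open>\<open>\<beta> = d\<alpha>\<close>, with the convention \<open>d\<alpha>(X, Y) = X(\<alpha>(Y)) - Y(\<alpha>(X)) - \<alpha>([X, Y])\<close>.\<close>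

definition is_ext_deriv :: "('p::topological_space, 'e::real_inner) atlas \<Rightarrow> 'p form1 \<Rightarrow> 'p tensor2 \<Rightarrow> bool" where
  "is_ext_deriv A \<alpha> \<beta> \<longleftrightarrow> smooth_tensor2 A \<beta> \<and>
     (\<forall>W X Y. vector_field A W X \<longrightarrow> vector_field A W Y \<longrightarrow>
        (\<forall>p\<in>W. \<beta> p (X p) (Y p) =
           X p (\<lambda>q. \<alpha> q (Y q)) - Y p (\<lambda>q. \<alpha> q (X q)) - \<alpha> p (lie_bracket A X Y p)))"


section \<open>Pseudo-Kaehler manifolds\<close>

text \<open>\<open>D p v Y\<close> is the covariant derivative at \<open>p\<close> of the (local) vector field \<open>Y\<close> along \<open>v\<close>.\<close>

type_synonym 'p connection = "'p \<Rightarrow> 'p tvec \<Rightarrow> ('p \<Rightarrow> 'p tvec) \<Rightarrow> 'p tvec"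

definition affine_connection :: "('p::topological_space, 'e::real_inner) atlas \<Rightarrow> 'p connection \<Rightarrow> bool" where
  "affine_connection A D \<longleftrightarrow>
     (\<forall>W X Y. vector_field A W X \<longrightarrow> vector_field A W Y \<longrightarrow>
        vector_field A W (\<lambda>p. D p (X p) Y) \<and>
        (\<forall>p\<in>W. linear_on (tangent_space A p) (\<lambda>v. D p v Y)) \<and>
        (\<forall>p\<in>W. \<forall>v\<in>tangent_space A p.
           D p v (\<lambda>q. X q + Y q) = D p v X + D p v Y \<and>
           (\<forall>h. smooth_fn A W h \<longrightarrow> D p v (\<lambda>q. h q *\<^sub>R Y q) = v h *\<^sub>R Y p + h p *\<^sub>R D p v Y) \<and>
           ((\<forall>q\<in>W. X q = Y q) \<longrightarrow> D p v X = D p v Y)))"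

definition levi_civita :: "('p::topological_space, 'e::real_inner) atlas \<Rightarrow> 'p tensor2 \<Rightarrow> 'p connection \<Rightarrow> bool" where
  "levi_civita A g D \<longleftrightarrow> affine_connection A D \<and>
     (\<forall>W X Y. vector_field A W X \<longrightarrow> vector_field A W Y \<longrightarrow>
        (\<forall>p\<in>W. D p (X p) Y - D p (Y p) X = lie_bracket A X Y p \<and>
           (\<forall>v\<in>tangent_space A p.
              v (\<lambda>q. g q (X q) (Y q)) = g p (D p v X) (Y p) + g p (X p) (D p v Y))))"

text \<open>A pseudo-Kaehler structure: a skew-symmetric parallel almost complex structure.\<close>

definition pseudo_kaehler :: "('p::topological_space, 'e::real_inner) atlas \<Rightarrow>
    'p endo \<Rightarrow> 'p tensor2 \<Rightarrow> 'p connection \<Rightarrow> bool" where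
  "pseudo_kaehler M J g D \<longleftrightarrow> pseudo_riemannian M g \<and> levi_civita M g D \<and>
     (\<forall>p\<in>points M. linear_on (tangent_space M p) (J p) \<and>
        (\<forall>v\<in>tangent_space M p. J p v \<in> tangent_space M p \<and> J p (J p v) = - v \<and>
           (\<forall>w\<in>tangent_space M p. g p (J p v) w = - g p v (J p w)))) \<and>
     (\<forall>W X. vector_field M W X \<longrightarrow> vector_field M W (\<lambda>p. J p (X p)) \<and>
        (\<forall>p\<in>W. \<forall>v\<in>tangent_space M p. D p v (\<lambda>q. J q (X q)) = J p (D p v X)))"

definition killing_field :: "('p::topological_space, 'e::real_inner) atlas \<Rightarrow> 'p tensor2 \<Rightarrow> ('p \<Rightarrow> 'p tvec) \<Rightarrow> bool" where
  "killing_field M g Z \<longleftrightarrow> vector_field M (points M) Z \<and>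
     (\<forall>W X Y. vector_field M W X \<longrightarrow> vector_field M W Y \<longrightarrow>
        (\<forall>p\<in>W. Z p (\<lambda>q. g q (X q) (Y q)) =
           g p (lie_bracket M Z X p) (Y p) + g p (X p) (lie_bracket M Z Y p)))"

definition holomorphic_field :: "('p::topological_space, 'e::real_inner) atlas \<Rightarrow> 'p endo \<Rightarrow> ('p \<Rightarrow> 'p tvec) \<Rightarrow> bool" where
  "holomorphic_field M J Z \<longleftrightarrow> vector_field M (points M) Z \<and>
     (\<forall>W X. vector_field M W X \<longrightarrow>
        (\<forall>p\<in>W. lie_bracket M Z (\<lambda>q. J q (X q)) p = J p (lie_bracket M Z X p)))"

definition kaehler_form :: "'p endo \<Rightarrow> 'p tensor2 \<Rightarrow> 'p tensor2"
  where "kaehler_form J g = (\<lambda>p v w. g p (J p v) w)"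


section \<open>Conical pseudo-Kaehler manifolds and pseudo-Kaehler cones\<close>

text \<open>\<open>lam\<close> is \<open>1\<close> for a space-like and \<open>-1\<close> for a time-like Euler field \<open>\<xi>\<close>.\<close>

definition conical_pseudo_kaehler :: "real \<Rightarrow> ('p::topological_space, 'e::real_inner) atlas \<Rightarrow>
    'p endo \<Rightarrow> 'p tensor2 \<Rightarrow> 'p connection \<Rightarrow> ('p \<Rightarrow> 'p tvec) \<Rightarrow> bool" where
  "conical_pseudo_kaehler lam M J g D \<xi> \<longleftrightarrow> lam \<in> {1, -1} \<and> pseudo_kaehler M J g D \<and>
     vector_field M (points M) \<xi> \<and> (\<forall>p\<in>points M. sgn (g p (\<xi> p) (\<xi> p)) = lam) \<and>
     (\<forall>p\<in>points M. \<forall>v\<in>tangent_space M p. D p v \<xi> = v)"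

definition cone_radius :: "'p tensor2 \<Rightarrow> ('p \<Rightarrow> 'p tvec) \<Rightarrow> 'p \<Rightarrow> real"
  where "cone_radius g \<xi> p = sqrt \<bar>g p (\<xi> p) (\<xi> p)\<bar>"

definition contact_form :: "real \<Rightarrow> 'p endo \<Rightarrow> 'p tensor2 \<Rightarrow> ('p \<Rightarrow> 'p tvec) \<Rightarrow> 'p form1"
  where "contact_form lam J g \<xi> = (\<lambda>p v. lam / (cone_radius g \<xi> p)\<^sup>2 * g p (J p (\<xi> p)) v)"

text \<open>
  The tensor determined by \<open>g = lam (dr\<^sup>2 + r\<^sup>2 (contact_form\<^sup>2 + lam transverse_metric))\<close>;
  see \<open>transverse_metric_decomposition\<close> below.
\<close>

definition transverse_metric :: "real \<Rightarrow> 'p endo \<Rightarrow> 'p tensor2 \<Rightarrow> ('p \<Rightarrow> 'p tvec) \<Rightarrow> 'p tensor2" where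
  "transverse_metric lam J g \<xi> = (\<lambda>p v w. lam *
     ((lam * g p v w - v (cone_radius g \<xi>) * w (cone_radius g \<xi>)) / (cone_radius g \<xi> p)\<^sup>2
       - contact_form lam J g \<xi> p v * contact_form lam J g \<xi> p w))"

lemma transverse_metric_decomposition:
  assumes "conical_pseudo_kaehler lam M J g D \<xi>" and "p \<in> points M"
  shows "g p v w = lam * (v (cone_radius g \<xi>) * w (cone_radius g \<xi>) + (cone_radius g \<xi> p)\<^sup>2 *
     (contact_form lam J g \<xi> p v * contact_form lam J g \<xi> p w + lam * transverse_metric lam J g \<xi> p v w))"
proof -
  have lam: "lam * lam = 1" and "sgn (g p (\<xi> p) (\<xi> p)) = lam"
    using assms by (auto simp: conical_pseudo_kaehler_def)
  then have r: "(cone_radius g \<xi> p)\<^sup>2 \<noteq> 0"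
    by (auto simp: cone_radius_def sgn_if split: if_splits)
  have *: "lam * transverse_metric lam J g \<xi> p v w =
      (lam * g p v w - v (cone_radius g \<xi>) * w (cone_radius g \<xi>)) / (cone_radius g \<xi> p)\<^sup>2
       - contact_form lam J g \<xi> p v * contact_form lam J g \<xi> p w"
    using lam by (simp add: transverse_metric_def flip: mult.assoc)
  have "(cone_radius g \<xi> p)\<^sup>2 *
      (contact_form lam J g \<xi> p v * contact_form lam J g \<xi> p w + lam * transverse_metric lam J g \<xi> p v w)
      = lam * g p v w - v (cone_radius g \<xi>) * w (cone_radius g \<xi>)"
    using r unfolding * by (simp add: mult.commute)
  then show ?thesis
    using lam by (simp flip: mult.assoc)
qed

definition cone_atlas :: "('p, 'e) atlas \<Rightarrow> (real \<times> 'p, real \<times> 'e) atlas"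
  where "cone_atlas S = prod_atlas (open_atlas {0<..}) S"

text \<open>\<open>lam dr\<^sup>2 + r\<^sup>2 gS\<close>, where \<open>r\<close> is the first coordinate, and the Euler field \<open>r \<partial>\<^sub>r\<close>.\<close>

definition cone_metric :: "real \<Rightarrow> ('p::topological_space, 'e::real_inner) atlas \<Rightarrow> 'p tensor2 \<Rightarrow> (real \<times> 'p) tensor2" where
  "cone_metric lam S gS = (\<lambda>x v w. lam * (v fst * w fst) + (fst x)\<^sup>2 * pullback2 S snd gS x v w)"

definition euler :: "('p::topological_space, 'e::real_inner) atlas \<Rightarrow> real \<times> 'p \<Rightarrow> (real \<times> 'p) tvec" where
  "euler S x = fst x *\<^sub>R velocity (cone_atlas S) (\<lambda>t. (fst x + t, snd x))"

text \<open>
  The base \<open>(S, gS)\<close> of such a cone is a pseudo-Sasaki manifold by definition, with Reeb field the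
  restriction of \<open>J \<xi>\<close> to \<open>{1} \<times> S\<close>, to which \<open>J \<xi>\<close> is tangent.
\<close>

definition pseudo_kaehler_cone :: "real \<Rightarrow> ('p::topological_space, 'e::real_inner) atlas \<Rightarrow> 'p tensor2 \<Rightarrow>
    (real \<times> 'p) endo \<Rightarrow> (real \<times> 'p) connection \<Rightarrow> bool" where
  "pseudo_kaehler_cone lam S gS J D \<longleftrightarrow> pseudo_riemannian S gS \<and>
     conical_pseudo_kaehler lam (cone_atlas S) J (cone_metric lam S gS) D (euler S)"

definition reeb_field :: "('p::topological_space, 'e::real_inner) atlas \<Rightarrow> (real \<times> 'p) endo \<Rightarrow> 'p \<Rightarrow> 'p tvec" where
  "reeb_field S J q = pushforward S snd (1, q) (J (1, q) (euler S (1, q)))"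


section \<open>Hypersurfaces\<close>

text \<open>Embedded submanifolds: the charts of \<open>N\<close> are homeomorphisms for the subspace topology.\<close>

definition hypersurface :: "('p::topological_space, 'b::real_inner) atlas \<Rightarrow> ('p, 'e::real_inner) atlas \<Rightarrow> bool" where
  "hypersurface N M \<longleftrightarrow> manifold N \<and> smooth_map N M (\<lambda>p. p) \<and>
     (\<forall>p\<in>points N. inj_on (pushforward M (\<lambda>p. p) p) (tangent_space N p) \<and>
        dim (tangent_space M p) = dim (tangent_space N p) + 1)"

definition transversal :: "('p::topological_space, 'b::real_inner) atlas \<Rightarrow> ('p, 'e::real_inner) atlas \<Rightarrow>
    ('p \<Rightarrow> 'p tvec) \<Rightarrow> bool" where
  "transversal N M X \<longleftrightarrow> (\<forall>p\<in>points N. X p \<notin> pushforward M (\<lambda>p. p) p ` tangent_space N p)"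


section \<open>The K/K correspondence for the trivial circle bundle\<close>

definition kk_f1 :: "'p tensor2 \<Rightarrow> ('p \<Rightarrow> 'p tvec) \<Rightarrow> ('p \<Rightarrow> real) \<Rightarrow> 'p \<Rightarrow> real"
  where "kk_f1 g Z f p = f p - g p (Z p) (Z p) / 2"

definition kk_data :: "('p::topological_space, 'e::real_inner) atlas \<Rightarrow> 'p endo \<Rightarrow> 'p tensor2 \<Rightarrow> 'p connection \<Rightarrow>
    ('p \<Rightarrow> 'p tvec) \<Rightarrow> ('p \<Rightarrow> real) \<Rightarrow> bool" where
  "kk_data M J g D Z f \<longleftrightarrow> pseudo_kaehler M J g D \<and> killing_field M g Z \<and>
     ((\<forall>p\<in>points M. g p (Z p) (Z p) > 0) \<or> (\<forall>p\<in>points M. g p (Z p) (Z p) < 0)) \<and>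
     smooth_fn M (points M) f \<and>
     (\<forall>p\<in>points M. \<forall>v\<in>tangent_space M p. v f = - kaehler_form J g p (Z p) v)"

definition circle_bundle :: "('p, 'e) atlas \<Rightarrow> ('p \<times> complex, 'e \<times> real) atlas"
  where "circle_bundle M = prod_atlas M circle_atlas"

definition fundamental_field :: "('p::topological_space, 'e::real_inner) atlas \<Rightarrow> 'p \<times> complex \<Rightarrow> ('p \<times> complex) tvec" where
  "fundamental_field M y = velocity (circle_bundle M) (\<lambda>t. (fst y, snd y * cis t))"

text \<open>\<open>ds\<close>, where \<open>e\<^sup>i\<^sup>s\<close> is the circle coordinate: near \<open>y\<close>, \<open>s\<close> is \<open>Arg (snd x / snd y)\<close> up to a constant.\<close>

definition ds :: "('p \<times> complex) form1"
  where "ds = (\<lambda>y v. v (\<lambda>x. Arg (snd x / snd y)))"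

definition kk_eta :: "('p::topological_space, 'e::real_inner) atlas \<Rightarrow> 'p tensor2 \<Rightarrow> ('p \<Rightarrow> 'p tvec) \<Rightarrow> ('p \<times> complex) form1" where
  "kk_eta M g Z = (\<lambda>y v. ds y v - pullback1 M fst (\<lambda>p. g p (Z p)) y v / 4)"

text \<open>A principal connection with curvature \<open>\<omega> - d(g(Z, \<cdot>)) / 2\<close>.\<close>

definition kk_connection :: "('p::topological_space, 'e::real_inner) atlas \<Rightarrow> 'p endo \<Rightarrow> 'p tensor2 \<Rightarrow>
    ('p \<Rightarrow> 'p tvec) \<Rightarrow> ('p \<times> complex) form1 \<Rightarrow> bool" where
  "kk_connection M J g Z \<eta> \<longleftrightarrow> one_form (circle_bundle M) \<eta> \<and>
     (\<forall>y\<in>points (circle_bundle M). \<eta> y (fundamental_field M y) = 1 \<and>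
        (\<forall>u\<in>sphere 0 1. \<forall>v\<in>tangent_space (circle_bundle M) y.
           pullback1 (circle_bundle M) (\<lambda>(p, z). (p, z * u)) \<eta> y v = \<eta> y v)) \<and>
     (\<exists>\<beta>. is_ext_deriv M (\<lambda>p. g p (Z p)) \<beta> \<and>
        is_ext_deriv (circle_bundle M) \<eta>
          (pullback2 M fst (\<lambda>p v w. kaehler_form J g p v w - \<beta> p v w / 2)))"

definition horizontal_lift :: "('p::topological_space, 'e::real_inner) atlas \<Rightarrow> ('p \<times> complex) form1 \<Rightarrow>
    ('p \<Rightarrow> 'p tvec) \<Rightarrow> 'p \<times> complex \<Rightarrow> ('p \<times> complex) tvec" where
  "horizontal_lift M \<eta> Z y =
     (let v = pushforward (circle_bundle M) (\<lambda>p. (p, snd y)) (fst y) (Z (fst y))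
      in v - \<eta> y v *\<^sub>R fundamental_field M y)"

definition kk_ZP :: "('p::topological_space, 'e::real_inner) atlas \<Rightarrow> 'p tensor2 \<Rightarrow> ('p \<Rightarrow> 'p tvec) \<Rightarrow> ('p \<Rightarrow> real) \<Rightarrow>
    ('p \<times> complex) form1 \<Rightarrow> 'p \<times> complex \<Rightarrow> ('p \<times> complex) tvec" where
  "kk_ZP M g Z f \<eta> y = horizontal_lift M \<eta> Z y + kk_f1 g Z f (fst y) *\<^sub>R fundamental_field M y"

definition kk_gP :: "('p::topological_space, 'e::real_inner) atlas \<Rightarrow> 'p tensor2 \<Rightarrow> ('p \<Rightarrow> 'p tvec) \<Rightarrow> ('p \<Rightarrow> real) \<Rightarrow>
    ('p \<times> complex) form1 \<Rightarrow> ('p \<times> complex) tensor2" where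
  "kk_gP M g Z f \<eta> = (\<lambda>y v w. 2 / kk_f1 g Z f (fst y) * (\<eta> y v * \<eta> y w) + pullback2 M fst g y v w)"

definition kk_theta0 :: "('p::topological_space, 'e::real_inner) atlas \<Rightarrow> ('p \<Rightarrow> real) \<Rightarrow> ('p \<times> complex) form1" where
  "kk_theta0 M f = (\<lambda>y v. - pullback1 M fst (\<lambda>p u. u f) y v / 2)"

definition kk_theta1 :: "('p::topological_space, 'e::real_inner) atlas \<Rightarrow> 'p tensor2 \<Rightarrow> ('p \<Rightarrow> 'p tvec) \<Rightarrow>
    ('p \<times> complex) form1 \<Rightarrow> ('p \<times> complex) form1" where
  "kk_theta1 M g Z \<eta> = (\<lambda>y v. \<eta> y v + pullback1 M fst (\<lambda>p. g p (Z p)) y v / 2)"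

definition kk_gP_tilde :: "('p::topological_space, 'e::real_inner) atlas \<Rightarrow> 'p tensor2 \<Rightarrow> ('p \<Rightarrow> 'p tvec) \<Rightarrow> ('p \<Rightarrow> real) \<Rightarrow>
    ('p \<times> complex) form1 \<Rightarrow> ('p \<times> complex) tensor2" where
  "kk_gP_tilde M g Z f \<eta> = (\<lambda>y v w. kk_gP M g Z f \<eta> y v w - 2 / f (fst y) *
     (kk_theta0 M f y v * kk_theta0 M f y w + kk_theta1 M g Z \<eta> y v * kk_theta1 M g Z \<eta> y w))"

text \<open>
  The tensor on the total space whose restriction to a hypersurface transversal to \<open>kk_ZP\<close> is the
  metric assigned by the correspondence; meaningful where \<open>f\<close> and \<open>kk_f1 g Z f\<close> do not vanish.
\<close>

definition kk_tensor :: "('p::topological_space, 'e::real_inner) atlas \<Rightarrow> 'p tensor2 \<Rightarrow> ('p \<Rightarrow> 'p tvec) \<Rightarrow> ('p \<Rightarrow> real) \<Rightarrow>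
    ('p \<times> complex) form1 \<Rightarrow> ('p \<times> complex) tensor2" where
  "kk_tensor M g Z f \<eta> = (\<lambda>y v w. 1 / (2 * \<bar>f (fst y)\<bar>) * kk_gP_tilde M g Z f \<eta> y v w)"


section \<open>The explicit description over a cone\<close>

definition Iplus :: "real \<Rightarrow> real \<Rightarrow> real set"
  where "Iplus lam c = (if lam = 1 then {max 0 (- 2 * c)<..} else {min (- 2 * c) 0<..<- c})"

definition Iminus :: "real \<Rightarrow> real \<Rightarrow> real set"
  where "Iminus lam c = (if lam = 1 then {- c<..<max 0 (- 2 * c)} else {..<min (- 2 * c) 0})"

definition KKM :: "real set \<Rightarrow> ('p, 'b) atlas \<Rightarrow> (real \<times> complex \<times> 'p, real \<times> real \<times> 'b) atlas"
  where "KKM I N = prod_atlas (open_atlas I) (prod_atlas circle_atlas N)"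

text \<open>
  The identification of \<open>I \<times> S\<^sup>1 \<times> N\<close> with a subset of \<open>(\<real>\<^sup>>\<^sup>0 \<times> N) \<times> S\<^sup>1\<close> given by \<open>\<rho> = lam r\<^sup>2 - c\<close>.
\<close>

definition kk_embed :: "real \<Rightarrow> real \<Rightarrow> real \<times> complex \<times> 'p \<Rightarrow> (real \<times> 'p) \<times> complex"
  where "kk_embed lam c = (\<lambda>(\<rho>, z, q). ((sqrt (lam * (\<rho> + c)), q), z))"

definition drho :: "(real \<times> complex \<times> 'p) form1"
  where "drho = (\<lambda>x v. v fst)"

text \<open>The differential of \<open>\<phi>\<close>, where the circle coordinate is \<open>exp (- \<i> \<phi> / 4)\<close>.\<close>

definition dphi :: "(real \<times> complex \<times> 'p) form1"
  where "dphi = (\<lambda>x v. v (\<lambda>y. - 4 * Arg (fst (snd y) / fst (snd x))))"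

definition base_proj :: "real \<times> complex \<times> 'p \<Rightarrow> 'p"
  where "base_proj x = snd (snd x)"

definition explicit_metric :: "real \<Rightarrow> real \<Rightarrow> ('p::topological_space, 'b::real_inner) atlas \<Rightarrow> 'p form1 \<Rightarrow> 'p tensor2 \<Rightarrow>
    (real \<times> complex \<times> 'p) tensor2" where
  "explicit_metric lam c N \<eta>N gN = (\<lambda>x v w.
     let \<rho> = fst x; \<alpha> = (\<lambda>u. dphi x u - 2 * c * pullback1 N base_proj \<eta>N x u)
     in 1 / (2 * \<bar>\<rho>\<bar>) *
        (lam * (\<rho> + c) * pullback2 N base_proj gN x v w
         - 1 / (4 * \<rho>) * ((\<rho> + 2 * c) / (\<rho> + c)) * (drho x v * drho x w)
         - 1 / (4 * \<rho>) * ((\<rho> + c) / (\<rho> + 2 * c)) * (\<alpha> v * \<alpha> w)))"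

text \<open>The metric of the complex hyperbolic line, pulled back to the product.\<close>

definition g_CH1 :: "(real \<times> complex \<times> 'p) tensor2" where
  "g_CH1 = (\<lambda>x v w. 1 / (4 * (fst x)\<^sup>2) * (drho x v * drho x w + dphi x v * dphi x w))"

end

theory Submission
  imports Defs
begin

text \<open>
  On a cone the correspondence can be computed in closed form, because the Euler field determines
  everything that enters it.  Since \<open>J\<close> is parallel and \<open>D \<xi> = Id\<close>, the field \<open>Z = 2 J \<xi>\<close> satisfies
  \<open>D\<^sub>v Z = 2 J v\<close> (\<open>D_Z\<close>).  This endomorphism is skew and commutes with \<open>J\<close>, so \<open>Z\<close> is Killing and
  holomorphic (\<open>killing_Z\<close>, \<open>holomorphic_Z\<close>), and skewness also gives \<open>d(g(Z, \<cdot>)) = 4 \<omega>\<close>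
  (\<open>ext_deriv_gZ\<close>).  Hence the curvature required of the connection is \<open>\<omega> - 2 \<omega> = - \<omega>\<close>, which is the
  curvature of \<open>ds - g(Z, \<cdot>) / 4\<close>, the form \<open>ds\<close> being closed.  In the radial coordinate,
  \<open>g(\<xi>, \<xi>) = lam r\<^sup>2\<close>, so that \<open>f = lam r\<^sup>2 - c\<close> is a Hamiltonian and \<open>f\<^sub>1 = - (lam r\<^sup>2 + c)\<close>.

  Since \<open>[\<xi>, J \<xi>] = 0\<close>, the projection of \<open>J \<xi>\<close> to \<open>S\<close> does not depend on \<open>r\<close> (\<open>J_euler_base\<close>).
  Therefore the contact form and the transverse metric are pulled back from \<open>S\<close>, and \<open>Z\<^sup>P\<close> projects to
  twice the Reeb field; this is why the preimage of \<open>N\<close> in the circle bundle is again transversal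
  (\<open>transversal_N'\<close>).

  With \<open>\<rho> = f\<close> and \<open>\<phi> = - 4 s\<close>, the formula for \<open>g'\<close> is the identity of rational functions
  \<open>explicit_metric_algebra\<close>: the part that involves \<open>ds\<close> and the contact form is degenerate and
  completes to the square of \<open>d\<phi> - 2 c \<eta>\<close>.  For the signature, the lift \<open>u + 2 c \<eta>(u) \<partial>\<^sub>\<phi>\<close> of a vector
  \<open>u\<close> of \<open>N\<close> is orthogonal to \<open>\<partial>\<^sub>\<rho>\<close> and \<open>\<partial>\<^sub>\<phi>\<close>; so \<open>g'\<close> is the orthogonal sum of a positive multiple
  of the transverse metric and a plane that is definite, with the sign opposite to that of
  \<open>(\<rho> + 2 c) / (\<rho> (\<rho> + c))\<close> (\<open>signature_g'\<close>).

  The rest is differential geometry from first principles.  Tangent vectors are the derivations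
  given by curves.  A chart identifies the tangent space with the model space (\<open>tangent_space_eq_range\<close>),
  and \<open>tangent_expand\<close> writes a vector in terms of its values on the coordinate functions.  Forms and
  tensors are thereby sums of products of smooth functions near every point, from which follow
  the smoothness of pullbacks and the naturality of the exterior derivative (\<open>ext_deriv_pullback\<close>);
  the latter needs that brackets of vector fields are tangent vectors, which rests on the symmetry
  of second derivatives (\<open>frechet_derivative_commute\<close>).
\<close>

section \<open>Smooth maps between finite-dimensional inner product spaces\<close>

lemma ck_on_SucI:
  assumes "open U" and "\<And>x. x \<in> U \<Longrightarrow> (f has_derivative f' x) (at x)"
    and "\<And>v. ck_on k U (\<lambda>x. f' x v)"
  shows "ck_on (Suc k) U f"
proof -
  have cong: "ck_on k U g \<Longrightarrow> (\<And>x. x \<in> U \<Longrightarrow> h x = g x) \<Longrightarrow> ck_on k U h"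
    for g h :: "'a \<Rightarrow> 'c::real_normed_vector"
  proof (induction k arbitrary: g h)
    case 0
    then show ?case
      by (metis ck_on.simps(1) continuous_on_cong)
  next
    case (Suc k)
    have d: "(h has_derivative D) (at x) \<longleftrightarrow> (g has_derivative D) (at x)" if "x \<in> U" for x D
      using has_derivative_transform_within_open[OF _ \<open>open U\<close> that] Suc.prems(2) by metis
    have "frechet_derivative h (at x) v = frechet_derivative g (at x) v" if "x \<in> U" for x v
      unfolding frechet_derivative_def d[OF that] ..
    moreover have "h differentiable (at x)" if "x \<in> U" for x
      using Suc.prems(1) d[OF that] that by (metis ck_on.simps(2) differentiable_def)
    ultimately show ?case
      using Suc.prems(1) Suc.IH by (metis (no_types, lifting) ck_on.simps(2))
  qed
  have "frechet_derivative f (at x) v = f' x v" if "x \<in> U" for x v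
    using frechet_derivative_at[OF assms(2)[OF that]] by simp
  then show ?thesis
    using assms cong[OF assms(3)] by (auto simp: differentiable_def)
qed

lemma ck_on_cong:
  assumes "open U" "ck_on k U g" "\<And>x. x \<in> U \<Longrightarrow> h x = g x"
  shows "ck_on k U h"
proof (cases k)
  case 0
  then show ?thesis using assms by (metis ck_on.simps(1) continuous_on_cong)
next
  case (Suc j)
  show ?thesis
    unfolding Suc
  proof (rule ck_on_SucI[OF assms(1), where f' = "\<lambda>x. frechet_derivative g (at x)"])
    fix x assume "x \<in> U"
    then have "(g has_derivative frechet_derivative g (at x)) (at x)"
      using assms(2) by (simp add: Suc frechet_derivative_works)
    then show "(h has_derivative frechet_derivative g (at x)) (at x)"
      using has_derivative_transform_within_open[OF _ assms(1) \<open>x \<in> U\<close>] assms(3) by metis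
  qed (use assms(2) Suc in simp)
qed

lemma ck_on_subset: "ck_on k U f \<Longrightarrow> V \<subseteq> U \<Longrightarrow> ck_on k V f"
  by (induction k arbitrary: f) (auto intro: continuous_on_subset)

lemma ck_on_SucD: "ck_on (Suc k) U f \<Longrightarrow> ck_on k U f"
proof (induction k arbitrary: f)
  case 0
  then show ?case
    by (auto intro!: continuous_at_imp_continuous_on differentiable_imp_continuous_within)
qed simp

lemma ck_on_local:
  assumes "\<And>x. x \<in> U \<Longrightarrow> \<exists>V. open V \<and> x \<in> V \<and> ck_on k V f"
  shows "ck_on k U f"
  using assms
proof (induction k arbitrary: f)
  case 0
  then show ?case
    by (metis ck_on.simps(1) continuous_on_eq_continuous_at continuous_at_imp_continuous_on)
next
  case (Suc k)
  have "ck_on k U (\<lambda>x. frechet_derivative f (at x) v)" for v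
    by (rule Suc.IH) (metis Suc.prems ck_on.simps(2))
  then show ?case
    using Suc.prems by (metis ck_on.simps(2))
qed

lemma ck_on_has_derivative:
  "ck_on (Suc k) U f \<Longrightarrow> x \<in> U \<Longrightarrow> (f has_derivative frechet_derivative f (at x)) (at x)"
  by (simp add: frechet_derivative_works)

lemma ck_on_const: "open U \<Longrightarrow> ck_on k U (\<lambda>x. a)"
proof (induction k arbitrary: a)
  case (Suc k)
  show ?case
    by (rule ck_on_SucI[where f' = "\<lambda>x v. 0"]) (use Suc in auto)
qed simp

lemma ck_on_bounded_linear:
  assumes "bounded_linear L" "open U"
  shows "ck_on k U f \<Longrightarrow> ck_on k U (\<lambda>x. L (f x))"
proof (induction k arbitrary: f)
  case 0
  then show ?case
    using bounded_linear.continuous_on[OF assms(1)] by simp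
next
  case (Suc k)
  show ?case
  proof (rule ck_on_SucI[OF assms(2), where f' = "\<lambda>x v. L (frechet_derivative f (at x) v)"])
    show "((\<lambda>x. L (f x)) has_derivative (\<lambda>v. L (frechet_derivative f (at x) v))) (at x)"
      if "x \<in> U" for x
      using bounded_linear.has_derivative[OF assms(1) ck_on_has_derivative[OF Suc.prems that]] .
  qed (use Suc in simp)
qed

lemma ck_on_add:
  assumes "open U"
  shows "ck_on k U f \<Longrightarrow> ck_on k U g \<Longrightarrow> ck_on k U (\<lambda>x. f x + g x)"
proof (induction k arbitrary: f g)
  case 0
  then show ?case by (simp add: continuous_on_add)
next
  case (Suc k)
  show ?case
  proof (rule ck_on_SucI[OF assms,
        where f' = "\<lambda>x v. frechet_derivative f (at x) v + frechet_derivative g (at x) v"])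
    show "((\<lambda>x. f x + g x) has_derivative
        (\<lambda>v. frechet_derivative f (at x) v + frechet_derivative g (at x) v)) (at x)"
      if "x \<in> U" for x
      using has_derivative_add[OF ck_on_has_derivative[OF Suc.prems(1) that]
          ck_on_has_derivative[OF Suc.prems(2) that]] .
  qed (use Suc in simp)
qed

lemma ck_on_bounded_bilinear:
  assumes "bounded_bilinear m" "open U"
  shows "ck_on k U f \<Longrightarrow> ck_on k U g \<Longrightarrow> ck_on k U (\<lambda>x. m (f x) (g x))"
proof (induction k arbitrary: f g)
  case 0
  then show ?case by (simp add: bounded_bilinear.continuous_on[OF assms(1)])
next
  case (Suc k)
  show ?case
  proof (rule ck_on_SucI[OF assms(2), where f' = "\<lambda>x v. m (f x) (frechet_derivative g (at x) v) +
      m (frechet_derivative f (at x) v) (g x)"])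
    show "((\<lambda>x. m (f x) (g x)) has_derivative (\<lambda>v. m (f x) (frechet_derivative g (at x) v) +
      m (frechet_derivative f (at x) v) (g x))) (at x)" if "x \<in> U" for x
      using bounded_bilinear.FDERIV[OF assms(1) ck_on_has_derivative[OF Suc.prems(1) that]
          ck_on_has_derivative[OF Suc.prems(2) that]] .
    show "ck_on k U (\<lambda>x. m (f x) (frechet_derivative g (at x) v) +
      m (frechet_derivative f (at x) v) (g x))" for v
      using Suc.IH[of f "\<lambda>x. frechet_derivative g (at x) v"]
        Suc.IH[of "\<lambda>x. frechet_derivative f (at x) v" g] ck_on_SucD[OF Suc.prems(1)]
        ck_on_SucD[OF Suc.prems(2)] Suc.prems by (intro ck_on_add[OF assms(2)]) auto
  qed
qed

lemma ck_on_sum: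
  assumes "open U" "\<And>i. i \<in> I \<Longrightarrow> ck_on k U (f i)"
  shows "ck_on k U (\<lambda>x. \<Sum>i\<in>I. f i x)"
  using assms(2)
  by (induction I rule: infinite_finite_induct) (auto intro: ck_on_add ck_on_const assms(1))

text \<open>
  Orthonormal bases replace the type class of Euclidean spaces, which excludes dimension \<open>0\<close>; the empty
  set is an orthonormal basis of a zero-dimensional space.
\<close>

definition onb :: "'e::real_inner set \<Rightarrow> bool" where
  "onb B \<longleftrightarrow> finite B \<and> span B = UNIV \<and> (\<forall>a\<in>B. \<forall>b\<in>B. a \<bullet> b = (if a = b then 1 else 0))"

lemma onb_expand:
  assumes "onb B" shows "x = (\<Sum>b\<in>B. (x \<bullet> b) *\<^sub>R b)"
proof -
  have fin: "finite B" and "x \<in> span B" using assms by (auto simp: onb_def)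
  from this(2) show ?thesis
  proof (induction rule: span_induct_alt)
    case (step c a y)
    have "(\<Sum>b\<in>B. (a \<bullet> b) *\<^sub>R b) = (\<Sum>b\<in>B. if b = a then b else 0)"
      using assms step(1) by (intro sum.cong) (auto simp: onb_def)
    then have "(\<Sum>b\<in>B. (a \<bullet> b) *\<^sub>R b) = a"
      using fin step(1) by (simp add: sum.delta)
    then show ?case
      using step(2) fin by (simp add: inner_add_left scaleR_add_left sum.distrib
          flip: scaleR_scaleR scaleR_right.sum)
  qed simp
qed

lemma onb_exists:
  assumes "finite B" "span B = (UNIV::'e::real_inner set)"
  shows "\<exists>C::'e set. onb C"
proof -
  obtain C where C: "finite C" "span C = span B" "pairwise orthogonal C"
    using basis_orthogonal[OF assms(1)] by metis
  define E where "E = (\<lambda>x. x /\<^sub>R norm x) ` (C - {0})"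
  have "span E = span (C - {0})"
    unfolding E_def using C(1)
    by (subst span_image_scale[where c = "\<lambda>x. inverse (norm x)", simplified]) auto
  moreover have "span (C - {0}) = span C"
    using span_delete_0 by blast
  moreover have "a \<bullet> b = (if a = b then 1 else 0)" if "a \<in> E" "b \<in> E" for a b
  proof -
    obtain x y where xy: "a = x /\<^sub>R norm x" "b = y /\<^sub>R norm y" "x \<in> C" "y \<in> C" "x \<noteq> 0" "y \<noteq> 0"
      using \<open>a \<in> E\<close> \<open>b \<in> E\<close> by (auto simp: E_def)
    have *: "a \<bullet> a = 1"
      using xy by (simp add: dot_square_norm power2_eq_square)
    moreover have "a \<bullet> b = 0" if "a \<noteq> b"
      using that C(3) xy unfolding pairwise_def orthogonal_def by force
    ultimately show ?thesis by auto
  qed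
  ultimately show ?thesis
    using C assms by (intro exI[of _ E]) (auto simp: onb_def E_def)
qed

lemma onb_real: "onb {1::real}"
  by (auto simp: onb_def span_singleton)

lemma onb_Times:
  assumes "onb A" "onb B" shows "onb ((\<lambda>a. (a, 0)) ` A \<union> (\<lambda>b. (0, b)) ` B)"
proof -
  let ?C = "(\<lambda>a. (a, 0)) ` A \<union> (\<lambda>b. (0, b)) ` B"
  have "(x, y) \<in> span ?C" for x y
  proof -
    have "(x, y) = (\<Sum>a\<in>A. (x \<bullet> a) *\<^sub>R (a, 0)) + (\<Sum>b\<in>B. (y \<bullet> b) *\<^sub>R (0, b))"
      using onb_expand[OF assms(1), of x] onb_expand[OF assms(2), of y]
      by (simp add: prod_eq_iff fst_sum snd_sum)
    also have "\<dots> \<in> span ?C"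
      by (intro span_add span_sum span_scale span_base) auto
    finally show ?thesis .
  qed
  then have "span ?C = UNIV" by auto
  moreover have "0 \<notin> A" "0 \<notin> B"
    using assms unfolding onb_def by (metis inner_zero_left zero_neq_one)+
  moreover have "\<forall>a\<in>?C. \<forall>b\<in>?C. a \<bullet> b = (if a = b then 1 else 0)"
  proof -
    have "x \<bullet> y = (if x = y then 1 else 0)" if "x \<in> A \<and> y \<in> A" for x y
      using assms that by (simp add: onb_def)
    moreover have "x \<bullet> y = (if x = y then 1 else 0)" if "x \<in> B \<and> y \<in> B" for x y
      using assms that by (simp add: onb_def)
    ultimately show ?thesis
      using \<open>0 \<notin> A\<close> \<open>0 \<notin> B\<close> by (auto simp: inner_Pair; metis zero_neq_one)
  qed
  ultimately show ?thesis
    using assms by (simp add: onb_def)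
qed

lemma onb_independent:
  assumes "onb B" shows "independent B"
proof -
  have "pairwise orthogonal B" "0 \<notin> B"
    using assms unfolding onb_def pairwise_def orthogonal_def
    by (auto, metis inner_zero_left zero_neq_one)
  then show ?thesis by (rule pairwise_orthogonal_independent)
qed

text \<open>
  Expanding \<open>f'(x) v\<close> in an orthonormal basis turns the chain rule into a sum of products of components
  of \<open>f'\<close> with directional derivatives of \<open>g\<close> along fixed basis vectors, composed with \<open>f\<close>.  To the latter
  the induction hypothesis applies.
\<close>

lemma ck_on_compose:
  fixes f :: "'a::real_normed_vector \<Rightarrow> 'b::real_inner" and g :: "'b \<Rightarrow> 'c::real_normed_vector"
  assumes "onb (B::'b set)" "open U" "open V" "f ` U \<subseteq> V"
  shows "ck_on k U f \<Longrightarrow> ck_on k V g \<Longrightarrow> ck_on k U (\<lambda>x. g (f x))"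
proof (induction k arbitrary: g)
  case 0
  then show ?case
    using assms(4) continuous_on_compose2 by auto
next
  case (Suc k)
  let ?f' = "\<lambda>x v. frechet_derivative f (at x) v" and ?g' = "\<lambda>y w. frechet_derivative g (at y) w"
  show ?case
  proof (rule ck_on_SucI[OF assms(2), where f' = "\<lambda>x v. \<Sum>b\<in>B. (?f' x v \<bullet> b) *\<^sub>R ?g' (f x) b"])
    fix x assume x: "x \<in> U"
    then have g': "(g has_derivative ?g' (f x)) (at (f x))"
      using ck_on_has_derivative[OF Suc.prems(2)] assms(4) by blast
    have "((\<lambda>x. g (f x)) has_derivative (\<lambda>v. ?g' (f x) (?f' x v))) (at x)"
      using diff_chain_at[OF ck_on_has_derivative[OF Suc.prems(1) x] g'] by (simp add: comp_def)
    moreover have "?g' (f x) (?f' x v) = (\<Sum>b\<in>B. (?f' x v \<bullet> b) *\<^sub>R ?g' (f x) b)" for v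
    proof -
      have lin: "linear (?g' (f x))"
        using g' has_derivative_linear by blast
      show ?thesis
        by (subst onb_expand[OF assms(1), of "?f' x v"])
          (simp add: linear_sum[OF lin] linear_scale[OF lin])
    qed
    ultimately show "((\<lambda>x. g (f x)) has_derivative (\<lambda>v. \<Sum>b\<in>B. (?f' x v \<bullet> b) *\<^sub>R ?g' (f x) b)) (at x)"
      by simp
  next
    fix v
    have "ck_on k U (\<lambda>x. ?g' (f x) b)" for b
      using Suc.IH[of "\<lambda>y. ?g' y b"] Suc.prems ck_on_SucD[OF Suc.prems(1)] by simp
    moreover have "ck_on k U (\<lambda>x. ?f' x v \<bullet> b)" for b
    proof -
      have "ck_on k U (\<lambda>x. ?f' x v)" using Suc.prems(1) by simp
      then show ?thesis by (rule ck_on_bounded_linear[OF bounded_linear_inner_left assms(2)])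
    qed
    ultimately show "ck_on k U (\<lambda>x. \<Sum>b\<in>B. (?f' x v \<bullet> b) *\<^sub>R ?g' (f x) b)"
      by (intro ck_on_sum ck_on_bounded_bilinear[OF bounded_bilinear_scaleR] assms(2))
  qed
qed

lemma smooth_on_cong:
  "open U \<Longrightarrow> smooth_on U g \<Longrightarrow> (\<And>x. x \<in> U \<Longrightarrow> h x = g x) \<Longrightarrow> smooth_on U h"
  unfolding smooth_on_def using ck_on_cong by blast

lemma smooth_on_subset: "smooth_on U f \<Longrightarrow> V \<subseteq> U \<Longrightarrow> smooth_on V f"
  unfolding smooth_on_def using ck_on_subset by blast

lemma smooth_on_local:
  "(\<And>x. x \<in> U \<Longrightarrow> \<exists>V. open V \<and> x \<in> V \<and> smooth_on V f) \<Longrightarrow> smooth_on U f"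
  unfolding smooth_on_def by (intro allI ck_on_local) metis

lemma smooth_on_continuous_on: "smooth_on U f \<Longrightarrow> continuous_on U f"
  unfolding smooth_on_def by (metis ck_on.simps(1))

lemma smooth_on_has_derivative:
  "smooth_on U f \<Longrightarrow> x \<in> U \<Longrightarrow> (f has_derivative frechet_derivative f (at x)) (at x)"
  unfolding smooth_on_def using ck_on_has_derivative by blast

lemma smooth_on_frechet_derivative:
  "smooth_on U f \<Longrightarrow> smooth_on U (\<lambda>x. frechet_derivative f (at x) v)"
  unfolding smooth_on_def by (metis ck_on.simps(2))

lemma smooth_on_const: "open U \<Longrightarrow> smooth_on U (\<lambda>x. a)"
  by (simp add: smooth_on_def ck_on_const)

lemma smooth_on_constant_derivative:
  assumes "open U" "\<And>x. x \<in> U \<Longrightarrow> (f has_derivative L) (at x)"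
  shows "smooth_on U f"
  unfolding smooth_on_def
proof
  fix k
  have "ck_on (Suc k) U f"
    using assms by (intro ck_on_SucI[where f' = "\<lambda>x. L"] ck_on_const)
  then show "ck_on k U f" by (rule ck_on_SucD)
qed

lemma smooth_on_linear: "bounded_linear L \<Longrightarrow> open U \<Longrightarrow> smooth_on U L"
  by (rule smooth_on_constant_derivative[where L = L])
    (auto intro: bounded_linear_imp_has_derivative)

lemma smooth_on_id: "open U \<Longrightarrow> smooth_on U (\<lambda>x. x)"
  by (rule smooth_on_linear[OF bounded_linear_ident])

lemma smooth_on_bounded_linear:
  "bounded_linear L \<Longrightarrow> open U \<Longrightarrow> smooth_on U f \<Longrightarrow> smooth_on U (\<lambda>x. L (f x))"
  by (simp add: smooth_on_def ck_on_bounded_linear)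

lemma smooth_on_add:
  "open U \<Longrightarrow> smooth_on U f \<Longrightarrow> smooth_on U g \<Longrightarrow> smooth_on U (\<lambda>x. f x + g x)"
  by (simp add: smooth_on_def ck_on_add)

lemma smooth_on_mult:
  fixes f g :: "'a::real_normed_vector \<Rightarrow> real"
  shows "open U \<Longrightarrow> smooth_on U f \<Longrightarrow> smooth_on U g \<Longrightarrow> smooth_on U (\<lambda>x. f x * g x)"
  by (simp add: smooth_on_def ck_on_bounded_bilinear[OF bounded_bilinear_mult])

lemma smooth_on_Pair:
  assumes "open U" "smooth_on U f" "smooth_on U g"
  shows "smooth_on U (\<lambda>x. (f x, g x))"
proof -
  have "smooth_on U (\<lambda>x. (f x, 0) + (0, g x))"
    by (intro smooth_on_add assms
        smooth_on_bounded_linear[OF bounded_linear_Pair[OF bounded_linear_ident bounded_linear_zero]]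
        smooth_on_bounded_linear[OF bounded_linear_Pair[OF bounded_linear_zero bounded_linear_ident]])
  then show ?thesis by simp
qed

lemma smooth_on_compose:
  fixes f :: "'a::real_normed_vector \<Rightarrow> 'b::real_inner" and g :: "'b \<Rightarrow> 'c::real_normed_vector"
  assumes "onb (B::'b set)" "open U" "open V" "f ` U \<subseteq> V" "smooth_on U f" "smooth_on V g"
  shows "smooth_on U (\<lambda>x. g (f x))"
  using assms by (simp add: smooth_on_def ck_on_compose[OF assms(1-4)])

text \<open>
  The derivatives of \<open>inverse\<close> and \<open>sqrt\<close> are polynomials in the functions themselves and in \<open>inverse \<circ> sqrt\<close>,
  so that each order of differentiability yields the next one.
\<close>

lemma smooth_on_inverse: "smooth_on (- {0::real}) inverse"
  unfolding smooth_on_def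
proof
  fix k
  show "ck_on k (- {0::real}) inverse"
  proof (induction k)
    case 0
    show ?case by (auto intro!: continuous_intros)
  next
    case (Suc k)
    show ?case
    proof (rule ck_on_SucI[where f' = "\<lambda>x v. - (inverse x * v * inverse x)"])
      show "(inverse has_derivative (\<lambda>v. - (inverse x * v * inverse x))) (at x)"
        if "x \<in> - {0}" for x :: real
        using has_derivative_inverse'[of x] that by simp
      show "ck_on k (- {0::real}) (\<lambda>x. - (inverse x * v * inverse x))" for v
        by (intro ck_on_bounded_linear[OF bounded_linear_minus[OF bounded_linear_ident]]
            ck_on_bounded_bilinear[OF bounded_bilinear_mult] ck_on_const Suc) auto
    qed auto
  qed
qed

lemma smooth_on_sqrt: "smooth_on {0::real<..} sqrt"
  unfolding smooth_on_def
proof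
  fix k
  show "ck_on k {0::real<..} sqrt"
  proof (induction k)
    case 0
    show ?case by (auto intro!: continuous_intros)
  next
    case (Suc k)
    show ?case
    proof (rule ck_on_SucI[where f' = "\<lambda>x v. inverse (sqrt x) * (v / 2)"])
      show "(sqrt has_derivative (\<lambda>v. inverse (sqrt x) * (v / 2))) (at x)" if "x \<in> {0<..}" for x :: real
      proof -
        have "(*) (inverse (sqrt x) / 2) = (\<lambda>v. inverse (sqrt x) * (v / 2))" by auto
        then show ?thesis
          using DERIV_real_sqrt[of x] that by (simp add: has_field_derivative_def)
      qed
      have "ck_on k {0<..} (\<lambda>x. inverse (sqrt x))"
        by (rule ck_on_compose[OF onb_real, where V = "- {0}" and f = sqrt and g = inverse])
          (use smooth_on_inverse Suc in \<open>auto simp: smooth_on_def\<close>)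
      then show "ck_on k {0::real<..} (\<lambda>x. inverse (sqrt x) * (v / 2))" for v
        by (intro ck_on_bounded_bilinear[OF bounded_bilinear_mult] ck_on_const) auto
    qed auto
  qed
qed

text \<open>
  The mean value theorem is applied twice: along \<open>a\<close> to the increment of \<open>f\<close> in the direction \<open>t b\<close>, and
  then along \<open>b\<close> to the derivative that arises.
\<close>

lemma second_difference_mean_value:
  fixes f :: "'a::real_normed_vector \<Rightarrow> real"
  assumes U: "\<And>s u. 0 \<le> s \<Longrightarrow> s \<le> t \<Longrightarrow> 0 \<le> u \<Longrightarrow> u \<le> t \<Longrightarrow> x + s *\<^sub>R a + u *\<^sub>R b \<in> U"
    and "smooth_on U f" "t > 0"
  shows "\<exists>s u. 0 < s \<and> s < t \<and> 0 < u \<and> u < t \<and>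
    f (x + t *\<^sub>R a + t *\<^sub>R b) - f (x + t *\<^sub>R a) - (f (x + t *\<^sub>R b) - f x) =
    t * t * frechet_derivative (\<lambda>y. frechet_derivative f (at y) a) (at (x + s *\<^sub>R a + u *\<^sub>R b)) b"
proof -
  have line: "((\<lambda>s. h (y + s *\<^sub>R c)) has_real_derivative frechet_derivative h (at (y + s *\<^sub>R c)) c) (at s)"
    if "smooth_on U h" "y + s *\<^sub>R c \<in> U" for h :: "'a \<Rightarrow> real" and y c s
  proof -
    have h: "(h has_derivative frechet_derivative h (at (y + s *\<^sub>R c))) (at (y + s *\<^sub>R c))"
      using smooth_on_has_derivative that by blast
    have "((\<lambda>s. y + s *\<^sub>R c) has_derivative (\<lambda>r. r *\<^sub>R c)) (at s)"
      by (auto intro!: derivative_eq_intros)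
    from diff_chain_at[OF this h] show ?thesis
      using has_derivative_linear[OF h]
      by (simp add: has_field_derivative_def comp_def linear_scale mult_commute_abs)
  qed
  let ?g = "\<lambda>s. f (x + t *\<^sub>R b + s *\<^sub>R a) - f (x + s *\<^sub>R a)"
  let ?h = "\<lambda>y. frechet_derivative f (at y) a"
  have in1: "x + t *\<^sub>R b + s *\<^sub>R a \<in> U" "x + s *\<^sub>R a \<in> U" if "0 \<le> s" "s \<le> t" for s
    using U[of s t] U[of s 0] that \<open>t > 0\<close> by (auto simp: algebra_simps)
  have "\<exists>s. 0 < s \<and> s < t \<and> ?g t - ?g 0 = (t - 0) * (?h (x + t *\<^sub>R b + s *\<^sub>R a) - ?h (x + s *\<^sub>R a))"
    by (rule MVT2[OF \<open>t > 0\<close>]) (intro DERIV_diff line assms in1; simp)+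
  then obtain s where s: "0 < s" "s < t"
    "?g t - ?g 0 = t * (?h (x + t *\<^sub>R b + s *\<^sub>R a) - ?h (x + s *\<^sub>R a))" by auto
  let ?k = "\<lambda>u. ?h (x + s *\<^sub>R a + u *\<^sub>R b)"
  have "\<exists>u. 0 < u \<and> u < t \<and> ?k t - ?k 0 = (t - 0) * frechet_derivative ?h (at (x + s *\<^sub>R a + u *\<^sub>R b)) b"
    using s by (intro MVT2[OF \<open>t > 0\<close>] line smooth_on_frechet_derivative assms U) auto
  then obtain u where "0 < u" "u < t"
    "?k t - ?k 0 = t * frechet_derivative ?h (at (x + s *\<^sub>R a + u *\<^sub>R b)) b" by auto
  then show ?thesis
    using s by (intro exI[of _ s] exI[of _ u]) (simp add: algebra_simps)
qed

text \<open>
  The difference quotient is symmetric in \<open>a\<close> and \<open>b\<close>.  By the preceding lemma it is a value of either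
  iterated derivative at a point that tends to \<open>x\<close> with \<open>t\<close>, and both derivatives are continuous.
\<close>

lemma frechet_derivative_commute:
  fixes f :: "'a::real_normed_vector \<Rightarrow> real"
  assumes "open U" "smooth_on U f" "x \<in> U"
  shows "frechet_derivative (\<lambda>y. frechet_derivative f (at y) a) (at x) b =
    frechet_derivative (\<lambda>y. frechet_derivative f (at y) b) (at x) a"
proof -
  define h1 h2 where "h1 = (\<lambda>z. frechet_derivative (\<lambda>y. frechet_derivative f (at y) a) (at z) b)"
    and "h2 = (\<lambda>z. frechet_derivative (\<lambda>y. frechet_derivative f (at y) b) (at z) a)"
  have "isCont h1 x" "isCont h2 x"
    using smooth_on_frechet_derivative[OF smooth_on_frechet_derivative[OF assms(2)], THEN smooth_on_continuous_on]
      continuous_on_eq_continuous_at[OF assms(1)] assms(3) by (auto simp: h1_def h2_def)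
  have close: "\<bar>h1 x - h2 x\<bar> < 2 * e" if "e > 0" for e
  proof -
    obtain d0 d1 d2 where d012: "d0 > 0" "\<And>z. dist z x < d0 \<Longrightarrow> z \<in> U"
      "d1 > 0" "\<And>z. dist z x < d1 \<Longrightarrow> \<bar>h1 z - h1 x\<bar> < e"
      "d2 > 0" "\<And>z. dist z x < d2 \<Longrightarrow> \<bar>h2 z - h2 x\<bar> < e"
      using \<open>isCont h1 x\<close> \<open>isCont h2 x\<close> \<open>e > 0\<close> assms(1,3)
      unfolding continuous_at_eps_delta open_dist dist_real_def by metis
    define d where "d = min d0 (min d1 d2)"
    have d: "d > 0" "\<And>z. dist z x < d \<Longrightarrow> z \<in> U \<and> \<bar>h1 z - h1 x\<bar> < e \<and> \<bar>h2 z - h2 x\<bar> < e"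
      using d012 by (auto simp: d_def)
    \<comment> \<open>small enough for the parallelogram spanned by \<open>t a\<close> and \<open>t b\<close> to lie in the ball of radius \<open>d\<close>\<close>
    define t where "t = d / (2 * (norm a + norm b + 1))"
    have t: "t > 0" "t * (norm a + norm b) < d"
    proof -
      have pos: "norm a + norm b + 1 > 0" by (smt (verit) norm_ge_zero)
      then show "t > 0" using d(1) by (simp add: t_def)
      then have "t * (norm a + norm b) < t * (2 * (norm a + norm b + 1))"
        by (intro mult_strict_left_mono) (smt (verit) norm_ge_zero)+
      also have "\<dots> = d" using pos by (simp add: t_def)
      finally show "t * (norm a + norm b) < d" .
    qed
    have near: "dist (x + s *\<^sub>R a + u *\<^sub>R b) x < d" if "0 \<le> s" "s \<le> t" "0 \<le> u" "u \<le> t" for s u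
    proof -
      have "norm (s *\<^sub>R a + u *\<^sub>R b) \<le> s * norm a + u * norm b"
        using norm_triangle_ineq[of "s *\<^sub>R a" "u *\<^sub>R b"] that by simp
      also have "\<dots> \<le> t * norm a + t * norm b"
        using that by (intro add_mono mult_right_mono) auto
      finally show ?thesis using t(2) by (simp add: dist_norm algebra_simps)
    qed
    obtain s u where su: "0 < s" "s < t" "0 < u" "u < t"
      "f (x + t *\<^sub>R a + t *\<^sub>R b) - f (x + t *\<^sub>R a) - (f (x + t *\<^sub>R b) - f x) = t * t * h1 (x + s *\<^sub>R a + u *\<^sub>R b)"
      using second_difference_mean_value[OF _ assms(2) t(1), of x a b] near d(2) unfolding h1_def by blast
    have "\<exists>s u. 0 < s \<and> s < t \<and> 0 < u \<and> u < t \<and>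
      f (x + t *\<^sub>R b + t *\<^sub>R a) - f (x + t *\<^sub>R b) - (f (x + t *\<^sub>R a) - f x) = t * t * h2 (x + s *\<^sub>R b + u *\<^sub>R a)"
      unfolding h2_def using near d(2)
      by (intro second_difference_mean_value[OF _ assms(2) t(1)]) (metis add.commute add.left_commute)
    then obtain s' u' where su': "0 < s'" "s' < t" "0 < u'" "u' < t"
      "f (x + t *\<^sub>R b + t *\<^sub>R a) - f (x + t *\<^sub>R b) - (f (x + t *\<^sub>R a) - f x) = t * t * h2 (x + s' *\<^sub>R b + u' *\<^sub>R a)"
      by blast
    have "t * t * h1 (x + s *\<^sub>R a + u *\<^sub>R b) = t * t * h2 (x + s' *\<^sub>R b + u' *\<^sub>R a)"
      unfolding su(5)[symmetric] su'(5)[symmetric] by (simp add: algebra_simps)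
    then have "h1 (x + s *\<^sub>R a + u *\<^sub>R b) = h2 (x + u' *\<^sub>R a + s' *\<^sub>R b)"
      using t(1) by (simp add: add.commute add.left_commute)
    moreover have "\<bar>h1 (x + s *\<^sub>R a + u *\<^sub>R b) - h1 x\<bar> < e" "\<bar>h2 (x + u' *\<^sub>R a + s' *\<^sub>R b) - h2 x\<bar> < e"
      using d(2)[OF near] su su' by auto
    ultimately show ?thesis by linarith
  qed
  have "h1 x = h2 x"
    using close[of "\<bar>h1 x - h2 x\<bar> / 2"] by fastforce
  then show ?thesis by (simp add: h1_def h2_def)
qed

section \<open>Manifolds and smooth maps\<close>

lemma open_in_subset: "open_in A W \<Longrightarrow> W \<subseteq> points A"
  unfolding open_in_def using openin_imp_subset by blast

lemma open_in_Int: "open_in A V \<Longrightarrow> open_in A W \<Longrightarrow> open_in A (V \<inter> W)"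
  by (simp add: open_in_def openin_Int)

lemma open_in_points [simp]: "open_in A (points A)"
  by (simp add: open_in_def)

lemma open_in_local:
  assumes "\<And>p. p \<in> W \<Longrightarrow> \<exists>V. p \<in> V \<and> V \<subseteq> W \<and> open_in A V"
  shows "open_in A W"
  unfolding open_in_def using assms by (subst openin_subopen) (metis open_in_def)

lemma chart_subset: "(U, \<phi>) \<in> A \<Longrightarrow> U \<subseteq> points A"
  by (auto simp: points_def)

lemma points_chartE:
  assumes "p \<in> points A" obtains U \<phi> where "(U, \<phi>) \<in> A" "p \<in> U"
  using assms by (auto simp: points_def)

lemma manifold_onb: "manifold (A :: ('p::topological_space, 'e::real_inner) atlas) \<Longrightarrow> \<exists>B::'e set. onb B"
  unfolding manifold_def using onb_exists by blast

lemma manifoldI: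
  fixes A :: "('p::topological_space, 'e::real_inner) atlas"
  assumes "\<exists>B::'e set. finite B \<and> span B = UNIV"
    and "Hausdorff_space (top_of_set (points A))" "second_countable (top_of_set (points A))"
    and "\<And>U \<phi>. (U, \<phi>) \<in> A \<Longrightarrow> open_in A U" "\<And>U \<phi>. (U, \<phi>) \<in> A \<Longrightarrow> open (\<phi> ` U)"
    and "\<And>U \<phi>. (U, \<phi>) \<in> A \<Longrightarrow> homeomorphism U (\<phi> ` U) \<phi> (inv_into U \<phi>)"
    and "\<And>U \<phi> V \<psi>. (U, \<phi>) \<in> A \<Longrightarrow> (V, \<psi>) \<in> A \<Longrightarrow> smooth_on (\<phi> ` (U \<inter> V)) (\<psi> \<circ> inv_into U \<phi>)"
  shows "manifold A"
  unfolding manifold_def using assms by blast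

context
  fixes A :: "('p::topological_space, 'e::real_inner) atlas" and U \<phi>
  assumes A: "manifold A" and chart: "(U, \<phi>) \<in> A"
begin

lemma chart_open_in: "open_in A U"
  using A chart by (auto simp: manifold_def)

lemma chart_homeomorphism: "homeomorphism U (\<phi> ` U) \<phi> (inv_into U \<phi>)"
  using A chart by (auto simp: manifold_def)

lemma chart_inv [simp]: "x \<in> U \<Longrightarrow> inv_into U \<phi> (\<phi> x) = x"
  using chart_homeomorphism by (auto simp: homeomorphism_def)

lemma chart_inj: "inj_on \<phi> U"
  by (metis chart_inv inj_onI)

lemma chart_image_open:
  assumes "open_in A W" "W \<subseteq> U" shows "open (\<phi> ` W)"
proof -
  have "openin (top_of_set U) W"
    using assms chart_subset[OF chart] by (metis open_in_def openin_subset_trans)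
  then have "openin (top_of_set (\<phi> ` U)) (\<phi> ` W)"
    by (rule homeomorphism_imp_open_map[OF chart_homeomorphism])
  moreover have "open (\<phi> ` U)"
    using A chart by (auto simp: manifold_def)
  ultimately show ?thesis
    by (simp add: openin_open_eq)
qed

lemma chart_open: "open (\<phi> ` U)"
  by (rule chart_image_open[OF chart_open_in]) simp

lemma chart_preimage_open:
  assumes "open V" shows "open_in A {x \<in> U. \<phi> x \<in> V}"
proof -
  have "continuous_on U \<phi>"
    using chart_homeomorphism by (simp add: homeomorphism_def)
  then have "openin (top_of_set U) (U \<inter> \<phi> -` V)"
    using assms continuous_openin_preimage_eq by blast
  moreover have "U \<inter> \<phi> -` V = {x \<in> U. \<phi> x \<in> V}" by auto
  ultimately show ?thesis
    using chart_open_in openin_trans unfolding open_in_def by fastforce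
qed

lemma chart_transition:
  assumes "(V, \<psi>) \<in> A" shows "smooth_on (\<psi> ` (V \<inter> U)) (\<phi> \<circ> inv_into V \<psi>)"
  using A chart assms by (fastforce simp: manifold_def)

lemma chart_image_inv: "x \<in> \<phi> ` W \<Longrightarrow> W \<subseteq> U \<Longrightarrow> inv_into U \<phi> x \<in> W \<and> \<phi> (inv_into U \<phi> x) = x"
  by auto

end

lemma smooth_fn_open: "smooth_fn A W f \<Longrightarrow> open_in A W"
  by (simp add: smooth_fn_def)

lemma smooth_fn_chart:
  "smooth_fn A W f \<Longrightarrow> (U, \<phi>) \<in> A \<Longrightarrow> smooth_on (\<phi> ` (U \<inter> W)) (f \<circ> inv_into U \<phi>)"
  by (auto simp: smooth_fn_def)

text \<open>
  Any other chart differs by a smooth transition map, so one chart that contains the domain decides.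
\<close>

lemma smooth_fn_in_chart:
  fixes A :: "('p::topological_space, 'e::real_inner) atlas"
  assumes A: "manifold A" "(U, \<phi>) \<in> A" and W: "open_in A W" "W \<subseteq> U"
    and f: "smooth_on (\<phi> ` W) (f \<circ> inv_into U \<phi>)"
  shows "smooth_fn A W f"
proof -
  obtain B :: "'e set" where B: "onb B" using manifold_onb[OF A(1)] by blast
  have "smooth_on (\<psi> ` (V \<inter> W)) (f \<circ> inv_into V \<psi>)" if V: "(V, \<psi>) \<in> A" for V \<psi>
  proof -
    have o: "open (\<psi> ` (V \<inter> W))"
      using chart_image_open[OF A(1) V] open_in_Int[OF chart_open_in[OF A(1) V] W(1)] by simp
    have "smooth_on (\<psi> ` (V \<inter> W)) (\<lambda>y. (f \<circ> inv_into U \<phi>) ((\<phi> \<circ> inv_into V \<psi>) y))"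
    proof (rule smooth_on_compose[OF B o chart_image_open[OF A W] _ _ f])
      show "(\<phi> \<circ> inv_into V \<psi>) ` \<psi> ` (V \<inter> W) \<subseteq> \<phi> ` W"
        using chart_inv[OF A(1) V] by auto
      show "smooth_on (\<psi> ` (V \<inter> W)) (\<phi> \<circ> inv_into V \<psi>)"
        by (rule smooth_on_subset[OF chart_transition[OF A V]]) (use W in auto)
    qed
    then show ?thesis
      by (rule smooth_on_cong[OF o])
        (use W chart_inv[OF A(1) V] chart_inv[OF A] in auto)
  qed
  then show ?thesis using W by (auto simp: smooth_fn_def)
qed

lemma chart_set_open:
  "manifold A \<Longrightarrow> open_in A W \<Longrightarrow> (U, \<phi>) \<in> A \<Longrightarrow> open (\<phi> ` (U \<inter> W))"
  by (metis chart_image_open chart_open_in inf.cobounded1 open_in_Int)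

lemma smooth_fn_subset: "smooth_fn A W f \<Longrightarrow> open_in A V \<Longrightarrow> V \<subseteq> W \<Longrightarrow> smooth_fn A V f"
  unfolding smooth_fn_def by (blast intro: smooth_on_subset)

lemma smooth_fn_local:
  assumes A: "manifold A" "\<And>p. p \<in> W \<Longrightarrow> \<exists>V. p \<in> V \<and> V \<subseteq> W \<and> smooth_fn A V f"
  shows "smooth_fn A W f"
proof -
  have W: "open_in A W"
    using A(2) by (intro open_in_local) (metis smooth_fn_open)
  have "smooth_on (\<phi> ` (U \<inter> W)) (f \<circ> inv_into U \<phi>)" if U: "(U, \<phi>) \<in> A" for U \<phi>
  proof (rule smooth_on_local)
    fix y assume "y \<in> \<phi> ` (U \<inter> W)"
    then obtain p where p: "p \<in> U" "p \<in> W" "y = \<phi> p" by auto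
    obtain V where V: "p \<in> V" "smooth_fn A V f" using A(2)[OF p(2)] by blast
    show "\<exists>V. open V \<and> y \<in> V \<and> smooth_on V (f \<circ> inv_into U \<phi>)"
      using smooth_fn_chart[OF V(2) U] chart_set_open[OF A(1) smooth_fn_open[OF V(2)] U] V(1) p by blast
  qed
  then show ?thesis using W by (auto simp: smooth_fn_def)
qed

lemma smooth_fn_cong:
  assumes "manifold A" "smooth_fn A W g" "\<And>x. x \<in> W \<Longrightarrow> f x = g x"
  shows "smooth_fn A W f"
proof -
  have "smooth_on (\<phi> ` (U \<inter> W)) (f \<circ> inv_into U \<phi>)" if U: "(U, \<phi>) \<in> A" for U \<phi>
    by (rule smooth_on_cong[OF chart_set_open[OF assms(1) smooth_fn_open[OF assms(2)] U]
          smooth_fn_chart[OF assms(2) U]])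
      (use assms(3) chart_inv[OF assms(1) U] in auto)
  then show ?thesis using assms(2) by (auto simp: smooth_fn_def)
qed

lemma smooth_fn_add:
  assumes "manifold A" "smooth_fn A W f" "smooth_fn A W g"
  shows "smooth_fn A W (\<lambda>x. f x + g x)"
  using assms chart_set_open[OF assms(1) smooth_fn_open[OF assms(2)]]
  by (fastforce simp: smooth_fn_def comp_def intro!: smooth_on_add)

lemma smooth_fn_mult:
  assumes "manifold A" "smooth_fn A W f" "smooth_fn A W g"
  shows "smooth_fn A W (\<lambda>x. f x * g x)"
  using assms chart_set_open[OF assms(1) smooth_fn_open[OF assms(2)]]
  by (fastforce simp: smooth_fn_def comp_def intro!: smooth_on_mult)

lemma smooth_fn_const: "manifold A \<Longrightarrow> open_in A W \<Longrightarrow> smooth_fn A W (\<lambda>x. a)"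
  by (auto simp: smooth_fn_def comp_def intro!: smooth_on_const chart_set_open)

lemma smooth_fn_sum:
  assumes "manifold A" "open_in A W" "\<And>i. i \<in> I \<Longrightarrow> smooth_fn A W (f i)"
  shows "smooth_fn A W (\<lambda>x. \<Sum>i\<in>I. f i x)"
  using assms(3)
  by (induction I rule: infinite_finite_induct) (auto intro: smooth_fn_add smooth_fn_const assms(1,2))

lemma smooth_fn_real_compose:
  assumes A: "manifold A" "smooth_fn A W f" and "open I" "f ` W \<subseteq> I" "smooth_on I h"
  shows "smooth_fn A W (\<lambda>x. h (f x))"
proof -
  have "smooth_on (\<phi> ` (U \<inter> W)) (\<lambda>y. h ((f \<circ> inv_into U \<phi>) y))" if U: "(U, \<phi>) \<in> A" for U \<phi>
    by (rule smooth_on_compose[OF onb_real chart_set_open[OF A(1) smooth_fn_open[OF A(2)] U]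
          \<open>open I\<close> _ smooth_fn_chart[OF A(2) U] assms(5)])
      (use assms(4) chart_inv[OF A(1) U] in auto)
  then show ?thesis
    using assms(2) by (auto simp: smooth_fn_def comp_def)
qed

lemma smooth_fn_inverse:
  assumes "manifold A" "smooth_fn A W f" "\<And>x. x \<in> W \<Longrightarrow> f x \<noteq> 0"
  shows "smooth_fn A W (\<lambda>x. inverse (f x))"
  by (rule smooth_fn_real_compose[OF assms(1,2) _ _ smooth_on_inverse]) (use assms(3) in auto)

lemma smooth_fn_divide:
  assumes "manifold A" "smooth_fn A W f" "smooth_fn A W g" "\<And>x. x \<in> W \<Longrightarrow> g x \<noteq> 0"
  shows "smooth_fn A W (\<lambda>x. f x / g x)"
  unfolding divide_inverse by (intro smooth_fn_mult smooth_fn_inverse assms)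

text \<open>
  Smoothness only speaks of functions on open sets of the model space; continuity on the manifold itself
  is recovered through the charts, which are homeomorphisms.
\<close>

lemma smooth_fn_continuous_on:
  assumes A: "manifold A" "smooth_fn A W f"
  shows "continuous_on W f"
  unfolding continuous_openin_preimage_eq
proof (intro allI impI)
  fix T :: "real set" assume "open T"
  have W: "open_in A W" using A(2) by (rule smooth_fn_open)
  have "open_in A (W \<inter> f -` T)"
  proof (rule open_in_local)
    fix p assume p: "p \<in> W \<inter> f -` T"
    then obtain U \<phi> where U: "(U, \<phi>) \<in> A" "p \<in> U"
      using open_in_subset[OF W] by (meson IntD1 points_chartE subsetD)
    let ?O = "{y \<in> \<phi> ` (U \<inter> W). (f \<circ> inv_into U \<phi>) y \<in> T}"
    have "open ?O"
      using continuous_open_preimage[OF smooth_on_continuous_on[OF smooth_fn_chart[OF A(2) U(1)]]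
          chart_set_open[OF A(1) W U(1)] \<open>open T\<close>]
      by (simp add: vimage_def Int_def conj_commute)
    then have "open_in A {x \<in> U. \<phi> x \<in> ?O}"
      by (rule chart_preimage_open[OF A(1) U(1)])
    moreover have "{x \<in> U. \<phi> x \<in> ?O} \<subseteq> W \<inter> f -` T"
    proof
      fix x assume x: "x \<in> {x \<in> U. \<phi> x \<in> ?O}"
      then have "x \<in> U" "\<phi> x \<in> \<phi> ` (U \<inter> W)" "(f \<circ> inv_into U \<phi>) (\<phi> x) \<in> T" by blast+
      then show "x \<in> W \<inter> f -` T"
        using chart_inv[OF A(1) U(1)] inj_on_image_mem_iff[OF chart_inj[OF A(1) U(1)], of x "U \<inter> W"] by auto
    qed
    moreover have "p \<in> {x \<in> U. \<phi> x \<in> ?O}"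
      using p U(2) chart_inv[OF A(1) U(1)] by auto
    ultimately show "\<exists>V. p \<in> V \<and> V \<subseteq> W \<inter> f -` T \<and> open_in A V"
      by (intro exI[of _ "{x \<in> U. \<phi> x \<in> ?O}"] conjI)
  qed
  then show "openin (top_of_set W) (W \<inter> f -` T)"
    using open_in_subset[OF W] by (meson inf.cobounded1 open_in_def openin_subset_trans)
qed

lemma smooth_map_preimage:
  assumes "smooth_map A B F" "open_in B V" shows "open_in A {x \<in> points A. F x \<in> V}"
proof -
  have "openin (top_of_set (points A)) (points A \<inter> F -` V)"
    using assms by (intro continuous_openin_preimage[where T = "points B"])
      (auto simp: smooth_map_def open_in_def)
  moreover have "points A \<inter> F -` V = {x \<in> points A. F x \<in> V}" by auto
  ultimately show ?thesis by (simp add: open_in_def)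
qed

lemma smooth_map_points: "smooth_map A B F \<Longrightarrow> p \<in> points A \<Longrightarrow> F p \<in> points B"
  by (auto simp: smooth_map_def)

lemma smooth_map_chart:
  "smooth_map A B F \<Longrightarrow> (U, \<phi>) \<in> A \<Longrightarrow> (V, \<psi>) \<in> B \<Longrightarrow>
    smooth_on (\<phi> ` {x \<in> U. F x \<in> V}) (\<psi> \<circ> F \<circ> inv_into U \<phi>)"
  by (fastforce simp: smooth_map_def)

text \<open>
  Around each point the composition factors through a chart of the middle manifold.
\<close>

lemma smooth_map_compose:
  fixes A :: "('p::topological_space, 'e::real_inner) atlas"
    and B :: "('q::topological_space, 'f::real_inner) atlas"
    and C :: "('r::topological_space, 'g::real_inner) atlas"
  assumes A: "manifold A" and B: "manifold B" and C: "manifold C"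
    and F: "smooth_map A B F" and G: "smooth_map B C G"
  shows "smooth_map A C (\<lambda>x. G (F x))"
proof -
  obtain E :: "'f set" where E: "onb E" using manifold_onb[OF B] by blast
  have cont: "continuous_on (points A) (\<lambda>x. G (F x))"
    using F G by (auto simp: smooth_map_def intro: continuous_on_compose2)
  have "smooth_on (\<phi> ` {x \<in> U. G (F x) \<in> W}) (\<kappa> \<circ> (\<lambda>x. G (F x)) \<circ> inv_into U \<phi>)"
    if U: "(U, \<phi>) \<in> A" and W: "(W, \<kappa>) \<in> C" for U \<phi> W \<kappa>
  proof (rule smooth_on_local)
    fix y assume "y \<in> \<phi> ` {x \<in> U. G (F x) \<in> W}"
    then obtain p where p: "p \<in> U" "G (F p) \<in> W" "y = \<phi> p" by auto
    have "F p \<in> points B"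
      using smooth_map_points[OF F] chart_subset[OF U] p(1) by auto
    then obtain V \<psi> where V: "(V, \<psi>) \<in> B" "F p \<in> V" by (rule points_chartE)
    define Q where "Q = {z \<in> V. G z \<in> W}"
    have "V \<inter> {z \<in> points B. G z \<in> W} = Q"
      using chart_subset[OF V(1)] by (auto simp: Q_def)
    then have Q: "open_in B Q"
      using open_in_Int[OF chart_open_in[OF B V(1)] smooth_map_preimage[OF G chart_open_in[OF C W]]] by simp
    define O' where "O' = {x \<in> U. F x \<in> Q}"
    have "U \<inter> {x \<in> points A. F x \<in> Q} = O'"
      using chart_subset[OF U] by (auto simp: O'_def)
    then have O': "open_in A O'"
      using open_in_Int[OF chart_open_in[OF A U] smooth_map_preimage[OF F Q]] by simp
    have o: "open (\<phi> ` O')" "open (\<psi> ` Q)"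
      using chart_image_open[OF A U O'] chart_image_open[OF B V(1) Q] by (auto simp: O'_def Q_def)
    have "smooth_on (\<phi> ` O') (\<lambda>y. (\<kappa> \<circ> G \<circ> inv_into V \<psi>) ((\<psi> \<circ> F \<circ> inv_into U \<phi>) y))"
    proof (rule smooth_on_compose[OF E o])
      show "(\<psi> \<circ> F \<circ> inv_into U \<phi>) ` \<phi> ` O' \<subseteq> \<psi> ` Q"
        using chart_inv[OF A U] by (auto simp: O'_def)
      show "smooth_on (\<phi> ` O') (\<psi> \<circ> F \<circ> inv_into U \<phi>)"
        by (rule smooth_on_subset[OF smooth_map_chart[OF F U V(1)]]) (auto simp: O'_def Q_def)
      show "smooth_on (\<psi> ` Q) (\<kappa> \<circ> G \<circ> inv_into V \<psi>)"
        unfolding Q_def by (rule smooth_map_chart[OF G V(1) W])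
    qed
    then have "smooth_on (\<phi> ` O') (\<kappa> \<circ> (\<lambda>x. G (F x)) \<circ> inv_into U \<phi>)"
      by (rule smooth_on_cong[OF o(1)])
        (use chart_inv[OF A U] chart_inv[OF B V(1)] in \<open>auto simp: O'_def Q_def\<close>)
    moreover have "y \<in> \<phi> ` O'"
      using p V(2) by (auto simp: O'_def Q_def)
    ultimately show "\<exists>V. open V \<and> y \<in> V \<and> smooth_on V (\<kappa> \<circ> (\<lambda>x. G (F x)) \<circ> inv_into U \<phi>)"
      using o(1) by blast
  qed
  then show ?thesis
    using cont smooth_map_points[OF F] smooth_map_points[OF G] by (auto simp: smooth_map_def)
qed

lemma smooth_map_cong:
  assumes "manifold A" "manifold B" "smooth_map A B G" "\<And>x. x \<in> points A \<Longrightarrow> F x = G x"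
  shows "smooth_map A B F"
proof -
  have "smooth_on (\<phi> ` {x \<in> U. F x \<in> V}) (\<psi> \<circ> F \<circ> inv_into U \<phi>)"
    if U: "(U, \<phi>) \<in> A" and V: "(V, \<psi>) \<in> B" for U \<phi> V \<psi>
  proof -
    have eq: "{x \<in> U. F x \<in> V} = U \<inter> {x \<in> points A. G x \<in> V}"
      using assms(4) chart_subset[OF U] by auto
    then have o: "open (\<phi> ` {x \<in> U. F x \<in> V})"
      using chart_set_open[OF assms(1) smooth_map_preimage[OF assms(3) chart_open_in[OF assms(2) V]] U] by simp
    have "smooth_on (\<phi> ` {x \<in> U. F x \<in> V}) (\<psi> \<circ> G \<circ> inv_into U \<phi>)"
      by (rule smooth_on_subset[OF smooth_map_chart[OF assms(3) U V]]) (use eq in auto)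
    then show ?thesis
      by (rule smooth_on_cong[OF o]) (use assms(1,4) U chart_inv[OF assms(1) U] chart_subset[OF U] in auto)
  qed
  moreover have "continuous_on (points A) G"
    using assms(3) by (simp add: smooth_map_def)
  then have "continuous_on (points A) F"
    by (rule continuous_on_eq) (simp add: assms(4))
  moreover have "F ` points A \<subseteq> points B"
    using smooth_map_points[OF assms(3)] assms(4) by auto
  ultimately show ?thesis
    unfolding smooth_map_def by blast
qed

lemma smooth_map_ident: "manifold A \<Longrightarrow> smooth_map A A (\<lambda>x. x)"
  unfolding smooth_map_def using chart_transition by (fastforce simp: Int_def comp_def)

subsection \<open>Restriction to open subsets\<close>

lemma restrict_atlas_iff:
  "(U, \<phi>) \<in> restrict_atlas A W \<longleftrightarrow> (\<exists>U0. (U0, \<phi>) \<in> A \<and> U = U0 \<inter> W)"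
  by (force simp: restrict_atlas_def)

lemma points_restrict: "points (restrict_atlas A W) = points A \<inter> W"
  by (auto simp: points_def restrict_atlas_def)

lemma inv_into_restrict:
  "inj_on f U \<Longrightarrow> y \<in> f ` (U \<inter> W) \<Longrightarrow> inv_into (U \<inter> W) f y = inv_into U f y"
  using inj_on_subset[of f U "U \<inter> W"] by (auto simp: inv_into_f_f)

lemma open_in_restrict:
  "open_in A W \<Longrightarrow> open_in (restrict_atlas A W) V \<longleftrightarrow> open_in A V \<and> V \<subseteq> W"
  unfolding open_in_def points_restrict
  by (metis Int_absorb1 inf_commute openin_imp_subset openin_subset_trans openin_trans inf_le2 openin_Int_open)

lemma manifold_restrict:
  assumes A: "manifold A" and W: "open_in A W"
  shows "manifold (restrict_atlas A W)"
proof (rule manifoldI)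
  show "Hausdorff_space (top_of_set (points (restrict_atlas A W)))"
    "second_countable (top_of_set (points (restrict_atlas A W)))"
    using A Hausdorff_space_subtopology second_countable_subtopology
    unfolding points_restrict manifold_def by (metis subtopology_subtopology)+
  show "\<exists>B::'b set. finite B \<and> span B = UNIV"
    using A by (simp add: manifold_def)
next
  fix U \<phi> assume "(U, \<phi>) \<in> restrict_atlas A W"
  then obtain U0 where U0: "(U0, \<phi>) \<in> A" "U = U0 \<inter> W" unfolding restrict_atlas_iff by blast
  have U: "open_in A U"
    using U0 open_in_Int chart_open_in[OF A] W by metis
  show "open_in (restrict_atlas A W) U"
    using open_in_restrict[OF W] U U0(2) by simp
  show "open (\<phi> ` U)"
    using chart_set_open[OF A W U0(1)] U0(2) by simp
  have "homeomorphism U (\<phi> ` U) \<phi> (inv_into U0 \<phi>)"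
    by (rule homeomorphism_of_subsets[OF chart_homeomorphism[OF A U0(1)]]) (use U0 in auto)
  then show "homeomorphism U (\<phi> ` U) \<phi> (inv_into U \<phi>)"
    by (rule homeomorphism_cong) (use inv_into_restrict[OF chart_inj[OF A U0(1)]] U0(2) in auto)
  fix V \<psi> assume "(V, \<psi>) \<in> restrict_atlas A W"
  then obtain V0 where V0: "(V0, \<psi>) \<in> A" "V = V0 \<inter> W" unfolding restrict_atlas_iff by blast
  have V: "open_in A V"
    using V0 open_in_Int chart_open_in[OF A] W by metis
  have eq: "U \<inter> V = U0 \<inter> (U \<inter> V)" using U0 by auto
  have o: "open (\<phi> ` (U \<inter> V))"
    using chart_set_open[OF A open_in_Int[OF U V] U0(1)] eq by simp
  have "smooth_on (\<phi> ` (U \<inter> V)) (\<psi> \<circ> inv_into U0 \<phi>)"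
    by (rule smooth_on_subset[OF chart_transition[OF A V0(1) U0(1)]]) (use U0 V0 in auto)
  then show "smooth_on (\<phi> ` (U \<inter> V)) (\<psi> \<circ> inv_into U \<phi>)"
    by (rule smooth_on_cong[OF o])
      (use inv_into_restrict[OF chart_inj[OF A U0(1)], of _ W] U0(2) in auto)
qed

lemma smooth_map_from_restrict:
  assumes A: "manifold A" "open_in A W" "smooth_map A B F" and B: "manifold B"
  shows "smooth_map (restrict_atlas A W) B F"
proof -
  have "smooth_on (\<phi> ` {x \<in> U. F x \<in> V}) (\<psi> \<circ> F \<circ> inv_into U \<phi>)"
    if U': "(U, \<phi>) \<in> restrict_atlas A W" and V: "(V, \<psi>) \<in> B" for U \<phi> V \<psi>
  proof -
    obtain U0 where U0: "(U0, \<phi>) \<in> A" "U = U0 \<inter> W" using U' unfolding restrict_atlas_iff by blast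
    have eq: "{x \<in> U. F x \<in> V} = U0 \<inter> (W \<inter> {x \<in> points A. F x \<in> V})"
      using U0 chart_subset by auto
    have o: "open (\<phi> ` {x \<in> U. F x \<in> V})"
      unfolding eq using chart_set_open[OF A(1) open_in_Int[OF A(2)
          smooth_map_preimage[OF A(3) chart_open_in[OF B V]]] U0(1)] .
    have "smooth_on (\<phi> ` {x \<in> U. F x \<in> V}) (\<psi> \<circ> F \<circ> inv_into U0 \<phi>)"
      by (rule smooth_on_subset[OF smooth_map_chart[OF A(3) U0(1) V]]) (use eq in auto)
    then show ?thesis
      by (rule smooth_on_cong[OF o])
        (use inv_into_restrict[OF chart_inj[OF A(1) U0(1)], of _ W] U0(2) in auto)
  qed
  then show ?thesis
    using A(3) by (auto simp: smooth_map_def points_restrict intro: continuous_on_subset)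
qed

lemma smooth_map_into_restrict:
  assumes "smooth_map A B F" "F ` points A \<subseteq> W"
  shows "smooth_map A (restrict_atlas B W) F"
proof -
  have "smooth_on (\<phi> ` {x \<in> U. F x \<in> V}) (\<psi> \<circ> F \<circ> inv_into U \<phi>)"
    if U: "(U, \<phi>) \<in> A" and V': "(V, \<psi>) \<in> restrict_atlas B W" for U \<phi> V \<psi>
  proof -
    obtain V0 where V0: "(V0, \<psi>) \<in> B" "V = V0 \<inter> W" using V' unfolding restrict_atlas_iff by blast
    show ?thesis
      by (rule smooth_on_subset[OF smooth_map_chart[OF assms(1) U V0(1)]]) (use V0 in auto)
  qed
  then show ?thesis
    using assms by (auto simp: smooth_map_def points_restrict)
qed

subsection \<open>Open intervals and smooth functions as maps\<close>

lemma points_open [simp]: "points (open_atlas I) = I"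
  by (simp add: points_def open_atlas_def)

lemma open_in_open_atlas: "open I \<Longrightarrow> open_in (open_atlas I) W \<longleftrightarrow> open W \<and> W \<subseteq> I"
  by (simp add: open_in_def openin_open_eq)

lemma second_countable_euclidean: "second_countable (euclidean :: 'a::second_countable_topology topology)"
proof -
  obtain B :: "'a set set" where B: "countable B" "topological_basis B"
    using ex_countable_basis by blast
  then show ?thesis
    unfolding second_countable_def by (metis open_openin topological_basisE topological_basis_open)
qed

lemma manifold_open:
  assumes "open (I :: real set)" shows "manifold (open_atlas I)"
proof -
  have "homeomorphism I I (\<lambda>x. x) (inv_into I (\<lambda>x. x))"
    by (rule homeomorphism_cong[OF homeomorphism_ident]) auto
  moreover have "smooth_on I (inv_into I (\<lambda>x. x))"
    by (rule smooth_on_cong[OF assms smooth_on_id[OF assms]]) auto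
  moreover have "\<exists>B::real set. finite B \<and> span B = UNIV"
    using onb_real by (auto simp: onb_def)
  moreover have "Hausdorff_space (top_of_set I)"
    by (simp add: Hausdorff_space_subtopology)
  ultimately show ?thesis
    using assms second_countable_subtopology[OF second_countable_euclidean]
    by (auto simp: manifold_def open_atlas_def open_in_def points_def comp_def)
qed

text \<open>
  A function on an open subset is a map from the restricted manifold to the line; this transfers the
  composition lemma from maps to locally defined functions.
\<close>

lemma smooth_fn_map_iff:
  assumes A: "manifold A" "open_in A W"
  shows "smooth_fn A W f \<longleftrightarrow> smooth_map (restrict_atlas A W) (open_atlas (UNIV::real set)) f"
proof -
  have "smooth_on (\<phi> ` (U \<inter> W)) (f \<circ> inv_into U \<phi>) \<longleftrightarrow>
      smooth_on (\<phi> ` (U \<inter> W)) (f \<circ> inv_into (U \<inter> W) \<phi>)" if U: "(U, \<phi>) \<in> A" for U \<phi>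
    using smooth_on_cong[OF chart_set_open[OF A U]] inv_into_restrict[OF chart_inj[OF A(1) U], of _ W]
    by (metis comp_apply)
  then have "(\<forall>(U, \<phi>)\<in>A. smooth_on (\<phi> ` (U \<inter> W)) (f \<circ> inv_into U \<phi>)) \<longleftrightarrow>
      (\<forall>(U, \<phi>)\<in>restrict_atlas A W. smooth_on (\<phi> ` U) (f \<circ> inv_into U \<phi>))"
    unfolding restrict_atlas_def by fastforce
  moreover have "smooth_map (restrict_atlas A W) (open_atlas (UNIV::real set)) f \<longleftrightarrow>
      continuous_on W f \<and> (\<forall>(U, \<phi>)\<in>restrict_atlas A W. smooth_on (\<phi> ` U) (f \<circ> inv_into U \<phi>))"
    unfolding smooth_map_def points_restrict points_open
    using open_in_subset[OF A(2)] by (simp add: open_atlas_def comp_def Int_absorb1)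
  ultimately show ?thesis
    using A smooth_fn_continuous_on[OF A(1)] by (auto simp: smooth_fn_def)
qed

lemma smooth_fn_pullback:
  assumes A: "manifold A" and B: "manifold B" and F: "smooth_map A B F" and h: "smooth_fn B V h"
  shows "smooth_fn A {x \<in> points A. F x \<in> V} (\<lambda>x. h (F x))"
proof -
  let ?W = "{x \<in> points A. F x \<in> V}"
  have V: "open_in B V" using h by (rule smooth_fn_open)
  have W: "open_in A ?W" by (rule smooth_map_preimage[OF F V])
  have "smooth_map (restrict_atlas A ?W) (restrict_atlas B V) F"
    by (rule smooth_map_into_restrict[OF smooth_map_from_restrict[OF A W F B]]) (auto simp: points_restrict)
  then show ?thesis
    using h smooth_map_compose[OF manifold_restrict[OF A W] manifold_restrict[OF B V] manifold_open[OF open_UNIV]]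
    unfolding smooth_fn_map_iff[OF A W] smooth_fn_map_iff[OF B V] by blast
qed

lemma smooth_map_open_iff:
  assumes A: "manifold A" and "open I"
  shows "smooth_map A (open_atlas (I::real set)) f \<longleftrightarrow> smooth_fn A (points A) f \<and> f ` points A \<subseteq> I"
    (is "?l \<longleftrightarrow> ?r")
proof
  assume ?l
  have "smooth_fn (open_atlas I) I (\<lambda>x. x)"
    using assms(2) by (auto simp: smooth_fn_def open_atlas_def open_in_def points_def comp_def
        intro!: smooth_on_cong[OF _ smooth_on_id])
  then have "smooth_fn A {x \<in> points A. f x \<in> I} f"
    by (rule smooth_fn_pullback[OF A manifold_open[OF assms(2)] \<open>?l\<close>])
  moreover have "{x \<in> points A. f x \<in> I} = points A"
    using smooth_map_points[OF \<open>?l\<close>] by auto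
  ultimately show ?r using \<open>?l\<close> by (auto simp: smooth_map_def)
next
  assume r: ?r
  have "smooth_on (\<phi> ` {x \<in> U. f x \<in> I}) (f \<circ> inv_into U \<phi>)" if "(U, \<phi>) \<in> A" for U \<phi>
    using smooth_fn_chart[OF conjunct1[OF r] that] chart_subset[OF that] smooth_on_subset
    by (metis (no_types, lifting) Int_absorb2 image_mono mem_Collect_eq subsetI)
  then show ?l
    using r smooth_fn_continuous_on[OF A] by (auto simp: smooth_map_def open_atlas_def comp_def points_open[unfolded open_atlas_def])
qed

lemma smooth_fn_open_atlas:
  "open (I::real set) \<Longrightarrow> smooth_on I f \<Longrightarrow> smooth_fn (open_atlas I) I f"
  by (auto simp: smooth_fn_def open_atlas_def open_in_def points_def comp_def
        intro!: smooth_on_cong[of I f])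

subsection \<open>Products\<close>

lemma points_prod: "points (prod_atlas A B) = points A \<times> points B"
  by (force simp: points_def prod_atlas_def)

lemma prod_atlas_iff:
  "(U, \<phi>) \<in> prod_atlas A B \<longleftrightarrow> (\<exists>V \<psi> W \<kappa>. (V, \<psi>) \<in> A \<and> (W, \<kappa>) \<in> B \<and> U = V \<times> W \<and> \<phi> = map_prod \<psi> \<kappa>)"
  by (force simp: prod_atlas_def)

lemma open_in_Times: "open_in A V \<Longrightarrow> open_in B W \<Longrightarrow> open_in (prod_atlas A B) (V \<times> W)"
  unfolding open_in_def points_prod prod_topology_subtopology_eu[symmetric] openin_prod_Times_iff by simp

lemma inv_into_map_prod:
  assumes "inj_on f U" "inj_on g V" "y \<in> f ` U" "z \<in> g ` V"
  shows "inv_into (U \<times> V) (map_prod f g) (y, z) = (inv_into U f y, inv_into V g z)"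
  by (rule inv_into_f_eq[OF map_prod_inj_on[OF assms(1,2)]])
    (use assms in \<open>auto simp: f_inv_into_f inv_into_into\<close>)

lemma second_countable_prod_topology:
  assumes "second_countable X" "second_countable Y"
  shows "second_countable (prod_topology X Y)"
proof -
  obtain B where B: "countable B" "\<forall>V\<in>B. openin X V" "\<And>U x. openin X U \<Longrightarrow> x \<in> U \<Longrightarrow> \<exists>V\<in>B. x \<in> V \<and> V \<subseteq> U"
    using assms(1) by (auto simp: second_countable_def)
  obtain C where C: "countable C" "\<forall>V\<in>C. openin Y V" "\<And>U x. openin Y U \<Longrightarrow> x \<in> U \<Longrightarrow> \<exists>V\<in>C. x \<in> V \<and> V \<subseteq> U"
    using assms(2) by (auto simp: second_countable_def)
  show ?thesis
    unfolding second_countable_def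
  proof (intro exI[of _ "(\<lambda>(U, V). U \<times> V) ` (B \<times> C)"] conjI allI impI)
    show "countable ((\<lambda>(U, V). U \<times> V) ` (B \<times> C))" using B(1) C(1) by auto
    show "\<forall>V\<in>(\<lambda>(U, V). U \<times> V) ` (B \<times> C). openin (prod_topology X Y) V"
      using B(2) C(2) by (auto simp: openin_prod_Times_iff)
    fix U x assume "openin (prod_topology X Y) U \<and> x \<in> U"
    then obtain U1 U2 where U: "openin X U1" "openin Y U2" "fst x \<in> U1" "snd x \<in> U2" "U1 \<times> U2 \<subseteq> U"
      unfolding openin_prod_topology_alt by (metis prod.collapse)
    then obtain V W where "V \<in> B" "fst x \<in> V" "V \<subseteq> U1" "W \<in> C" "snd x \<in> W" "W \<subseteq> U2"
      using B(3) C(3) by metis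
    then show "\<exists>V\<in>(\<lambda>(U, V). U \<times> V) ` (B \<times> C). x \<in> V \<and> V \<subseteq> U"
      using U(5) by (intro bexI[of _ "V \<times> W"]) (auto simp: mem_Times_iff)
  qed
qed

lemma manifold_prod:
  fixes A :: "('p::topological_space, 'e::real_inner) atlas"
    and B :: "('q::topological_space, 'f::real_inner) atlas"
  assumes A: "manifold A" and B: "manifold B"
  shows "manifold (prod_atlas A B)"
proof (rule manifoldI)
  obtain E :: "'e set" and E' :: "'f set" where "onb E" "onb E'"
    using manifold_onb[OF A] manifold_onb[OF B] by blast
  from onb_Times[OF this] show "\<exists>B::('e \<times> 'f) set. finite B \<and> span B = UNIV"
    by (auto simp: onb_def)
  show "Hausdorff_space (top_of_set (points (prod_atlas A B)))"
    using A B unfolding points_prod prod_topology_subtopology_eu[symmetric] Hausdorff_space_prod_topology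
    by (simp add: manifold_def)
  show "second_countable (top_of_set (points (prod_atlas A B)))"
    using A B unfolding points_prod prod_topology_subtopology_eu[symmetric]
    by (intro second_countable_prod_topology) (simp_all add: manifold_def)
next
  fix U \<phi> assume "(U, \<phi>) \<in> prod_atlas A B"
  then obtain U1 \<phi>1 U2 \<phi>2 where U: "(U1, \<phi>1) \<in> A" "(U2, \<phi>2) \<in> B" "U = U1 \<times> U2" "\<phi> = map_prod \<phi>1 \<phi>2"
    unfolding prod_atlas_iff by blast
  have im: "\<phi> ` U = \<phi>1 ` U1 \<times> \<phi>2 ` U2"
    using U by (auto simp: map_prod_surj_on)
  note inj = chart_inj[OF A U(1)] chart_inj[OF B U(2)]
  note inv = inv_into_map_prod[OF inj]
  show "open_in (prod_atlas A B) U"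
    using U open_in_Times chart_open_in A B by metis
  show "open (\<phi> ` U)"
    unfolding im by (intro open_Times chart_open[OF A U(1)] chart_open[OF B U(2)])
  note h = chart_homeomorphism[OF A U(1)] chart_homeomorphism[OF B U(2)]
  have "continuous_on U \<phi>"
    unfolding U(3,4) map_prod_def case_prod_unfold using h
    by (intro continuous_on_Pair) (auto simp: homeomorphism_def intro!: continuous_on_compose2[OF _ continuous_on_fst]
        continuous_on_compose2[OF _ continuous_on_snd] continuous_on_id)
  moreover have "continuous_on (\<phi> ` U) (\<lambda>y. (inv_into U1 \<phi>1 (fst y), inv_into U2 \<phi>2 (snd y)))"
    unfolding im using h
    by (intro continuous_on_Pair) (auto simp: homeomorphism_def intro!: continuous_on_compose2[OF _ continuous_on_fst]
        continuous_on_compose2[OF _ continuous_on_snd] continuous_on_id)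
  then have "continuous_on (\<phi> ` U) (inv_into U \<phi>)"
    by (rule continuous_on_eq) (auto simp: U im inv)
  ultimately show "homeomorphism U (\<phi> ` U) \<phi> (inv_into U \<phi>)"
    using map_prod_inj_on[OF inj] U(3,4) by (auto simp: homeomorphism_def)
  fix V \<psi> assume "(V, \<psi>) \<in> prod_atlas A B"
  then obtain V1 \<psi>1 V2 \<psi>2 where V: "(V1, \<psi>1) \<in> A" "(V2, \<psi>2) \<in> B" "V = V1 \<times> V2" "\<psi> = map_prod \<psi>1 \<psi>2"
    unfolding prod_atlas_iff by blast
  have eq: "\<phi> ` (U \<inter> V) = \<phi>1 ` (U1 \<inter> V1) \<times> \<phi>2 ` (U2 \<inter> V2)"
    using U V by (simp add: Times_Int_Times map_prod_surj_on)
  have o: "open (\<phi>1 ` (U1 \<inter> V1))" "open (\<phi>2 ` (U2 \<inter> V2))"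
    using chart_set_open[OF A chart_open_in[OF A V(1)] U(1)] chart_set_open[OF B chart_open_in[OF B V(2)] U(2)] .
  obtain E :: "'e set" and E' :: "'f set" where E: "onb E" "onb E'"
    using manifold_onb[OF A] manifold_onb[OF B] by blast
  have "smooth_on (\<phi> ` (U \<inter> V)) (\<lambda>y. ((\<psi>1 \<circ> inv_into U1 \<phi>1) (fst y), (\<psi>2 \<circ> inv_into U2 \<phi>2) (snd y)))"
    unfolding eq
    by (intro smooth_on_Pair open_Times o smooth_on_compose[OF E(1) _ o(1) _ _ chart_transition[OF A V(1) U(1)]]
        smooth_on_compose[OF E(2) _ o(2) _ _ chart_transition[OF B V(2) U(2)]]
        smooth_on_linear bounded_linear_fst bounded_linear_snd) auto
  moreover have "open (\<phi> ` (U \<inter> V))"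
    unfolding eq by (intro open_Times o)
  moreover have "(\<psi> \<circ> inv_into U \<phi>) y = ((\<psi>1 \<circ> inv_into U1 \<phi>1) (fst y), (\<psi>2 \<circ> inv_into U2 \<phi>2) (snd y))"
    if "y \<in> \<phi> ` (U \<inter> V)" for y
    using that unfolding eq by (auto simp: U V inv)
  ultimately show "smooth_on (\<phi> ` (U \<inter> V)) (\<psi> \<circ> inv_into U \<phi>)"
    by (metis (no_types, lifting) smooth_on_cong)
qed

lemma smooth_map_Pair:
  assumes A: "manifold A" and B: "manifold B" and C: "manifold C"
    and F: "smooth_map A B F" and G: "smooth_map A C G"
  shows "smooth_map A (prod_atlas B C) (\<lambda>x. (F x, G x))"
proof -
  have "smooth_on (\<phi> ` {x \<in> U. (F x, G x) \<in> V}) (\<psi> \<circ> (\<lambda>x. (F x, G x)) \<circ> inv_into U \<phi>)"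
    if U: "(U, \<phi>) \<in> A" and V': "(V, \<psi>) \<in> prod_atlas B C" for U \<phi> V \<psi>
  proof -
    obtain V1 \<psi>1 V2 \<psi>2 where V: "(V1, \<psi>1) \<in> B" "(V2, \<psi>2) \<in> C" "V = V1 \<times> V2" "\<psi> = map_prod \<psi>1 \<psi>2"
      using V' unfolding prod_atlas_iff by blast
    have eq: "{x \<in> U. (F x, G x) \<in> V} = U \<inter> ({x \<in> points A. F x \<in> V1} \<inter> {x \<in> points A. G x \<in> V2})"
      using V chart_subset[OF U] by auto
    have o: "open (\<phi> ` {x \<in> U. (F x, G x) \<in> V})"
      unfolding eq using chart_set_open[OF A open_in_Int[OF smooth_map_preimage[OF F chart_open_in[OF B V(1)]]
            smooth_map_preimage[OF G chart_open_in[OF C V(2)]]] U] .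
    have "smooth_on (\<phi> ` {x \<in> U. (F x, G x) \<in> V})
        (\<lambda>y. ((\<psi>1 \<circ> F \<circ> inv_into U \<phi>) y, (\<psi>2 \<circ> G \<circ> inv_into U \<phi>) y))"
      by (intro smooth_on_Pair o smooth_on_subset[OF smooth_map_chart[OF F U V(1)]]
          smooth_on_subset[OF smooth_map_chart[OF G U V(2)]]) (use V in auto)
    then show ?thesis
      by (rule smooth_on_cong[OF o]) (auto simp: V)
  qed
  then show ?thesis
    using F G by (auto simp: smooth_map_def points_prod intro: continuous_on_Pair)
qed

lemma smooth_map_fst:
  fixes A :: "('p::topological_space, 'e::real_inner) atlas"
    and B :: "('q::topological_space, 'f::real_inner) atlas"
  assumes A: "manifold A" and B: "manifold B"
  shows "smooth_map (prod_atlas A B) A fst"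
proof -
  obtain E :: "'e set" where E: "onb E" using manifold_onb[OF A] by blast
  have "smooth_on (\<phi> ` {x \<in> U. fst x \<in> V}) (\<psi> \<circ> fst \<circ> inv_into U \<phi>)"
    if U': "(U, \<phi>) \<in> prod_atlas A B" and V: "(V, \<psi>) \<in> A" for U \<phi> V \<psi>
  proof -
    obtain U1 \<phi>1 U2 \<phi>2 where U: "(U1, \<phi>1) \<in> A" "(U2, \<phi>2) \<in> B" "U = U1 \<times> U2" "\<phi> = map_prod \<phi>1 \<phi>2"
      using U' unfolding prod_atlas_iff by blast
    have eq: "\<phi> ` {x \<in> U. fst x \<in> V} = \<phi>1 ` (U1 \<inter> V) \<times> \<phi>2 ` U2"
    proof -
      have "{x \<in> U. fst x \<in> V} = (U1 \<inter> V) \<times> U2" using U by auto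
      then show ?thesis using U by (simp add: map_prod_surj_on)
    qed
    note o = chart_set_open[OF A chart_open_in[OF A V] U(1)] chart_open[OF B U(2)]
    have "smooth_on (\<phi>1 ` (U1 \<inter> V) \<times> \<phi>2 ` U2) (\<lambda>y. (\<psi> \<circ> inv_into U1 \<phi>1) (fst y))"
      by (intro smooth_on_compose[OF E _ o(1) _ _ chart_transition[OF A V U(1)]] open_Times o
          smooth_on_linear bounded_linear_fst) auto
    then show ?thesis
      unfolding eq by (rule smooth_on_cong[rotated])
        (auto simp: U open_Times o inv_into_map_prod[OF chart_inj[OF A U(1)] chart_inj[OF B U(2)]])
  qed
  then show ?thesis
    by (auto simp: smooth_map_def points_prod intro!: continuous_intros)
qed

lemma smooth_map_snd:
  fixes A :: "('p::topological_space, 'e::real_inner) atlas"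
    and B :: "('q::topological_space, 'f::real_inner) atlas"
  assumes A: "manifold A" and B: "manifold B"
  shows "smooth_map (prod_atlas A B) B snd"
proof -
  obtain E :: "'f set" where E: "onb E" using manifold_onb[OF B] by blast
  have "smooth_on (\<phi> ` {x \<in> U. snd x \<in> V}) (\<psi> \<circ> snd \<circ> inv_into U \<phi>)"
    if U': "(U, \<phi>) \<in> prod_atlas A B" and V: "(V, \<psi>) \<in> B" for U \<phi> V \<psi>
  proof -
    obtain U1 \<phi>1 U2 \<phi>2 where U: "(U1, \<phi>1) \<in> A" "(U2, \<phi>2) \<in> B" "U = U1 \<times> U2" "\<phi> = map_prod \<phi>1 \<phi>2"
      using U' unfolding prod_atlas_iff by blast
    have eq: "\<phi> ` {x \<in> U. snd x \<in> V} = \<phi>1 ` U1 \<times> \<phi>2 ` (U2 \<inter> V)"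
    proof -
      have "{x \<in> U. snd x \<in> V} = U1 \<times> (U2 \<inter> V)" using U by auto
      then show ?thesis using U by (simp add: map_prod_surj_on)
    qed
    note o = chart_open[OF A U(1)] chart_set_open[OF B chart_open_in[OF B V] U(2)]
    have "smooth_on (\<phi>1 ` U1 \<times> \<phi>2 ` (U2 \<inter> V)) (\<lambda>y. (\<psi> \<circ> inv_into U2 \<phi>2) (snd y))"
      by (intro smooth_on_compose[OF E _ o(2) _ _ chart_transition[OF B V U(2)]] open_Times o
          smooth_on_linear bounded_linear_snd) auto
    then show ?thesis
      unfolding eq by (rule smooth_on_cong[rotated])
        (auto simp: U open_Times o inv_into_map_prod[OF chart_inj[OF A U(1)] chart_inj[OF B U(2)]])
  qed
  then show ?thesis
    by (auto simp: smooth_map_def points_prod intro!: continuous_intros)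
qed

lemma smooth_map_const:
  assumes "manifold A" "q \<in> points B" shows "smooth_map A B (\<lambda>x. q)"
proof -
  have "smooth_on (\<phi> ` {x \<in> U. q \<in> V}) (\<psi> \<circ> (\<lambda>x. q) \<circ> inv_into U \<phi>)" if "(U, \<phi>) \<in> A" for U \<phi> V and \<psi> :: "'c \<Rightarrow> 'd"
    using chart_open[OF assms(1) that] by (cases "q \<in> V") (auto simp: comp_def intro: smooth_on_const)
  then show ?thesis using assms(2) by (auto simp: smooth_map_def)
qed

subsection \<open>The circle\<close>

lemma Arg_mult_cis:
  assumes "norm w = 1" "-pi < Arg w + t" "Arg w + t \<le> pi"
  shows "Arg (w * cis t) = Arg w + t"
proof -
  have "w = cis (Arg w)"
    using assms(1) rcis_cmod_Arg[of w] by (simp add: rcis_def)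
  then have "w * cis t = cis (Arg w + t)"
    by (metis cis_mult)
  then show ?thesis using assms by (simp add: Arg_cis)
qed

lemma Arg_less_pi: "norm w = 1 \<Longrightarrow> w \<noteq> -1 \<Longrightarrow> Arg w < pi"
  by (metis Arg_bounded cis_pi less_eq_real_def mult_1 of_real_1 rcis_cmod_Arg rcis_def)

text \<open>
  As long as the point \<open>-1\<close> is not crossed, \<open>Arg\<close> differs from the angle by a constant.
\<close>

lemma has_derivative_Arg_cis:
  assumes "norm w = 1" "w * cis s \<noteq> -1"
  shows "((\<lambda>s. Arg (w * cis s)) has_derivative (\<lambda>t. t)) (at s)"
proof -
  let ?a = "Arg (w * cis s)"
  have n: "norm (w * cis s) = 1" using assms(1) by (simp add: norm_mult)
  define d where "d = min (pi - ?a) (?a + pi)"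
  have d: "d > 0"
    using Arg_less_pi[OF n assms(2)] Arg_bounded[of "w * cis s"] by (simp add: d_def)
  have "((\<lambda>t. ?a + (t - s)) has_derivative (\<lambda>t. t)) (at s)"
    by (auto intro!: derivative_eq_intros)
  then show ?thesis
  proof (rule has_derivative_transform_within_open[of _ _ _ _ "ball s d"])
    fix t assume "t \<in> ball s d"
    then have "-pi < ?a + (t - s)" "?a + (t - s) \<le> pi"
      by (auto simp: d_def dist_real_def)
    from Arg_mult_cis[OF n this] show "?a + (t - s) = Arg (w * cis t)"
      by (simp add: cis_mult mult.assoc)
  qed (use d in auto)
qed

lemma smooth_on_Arg_cis:
  assumes "open U" "norm w = 1" "\<And>s. s \<in> U \<Longrightarrow> w * cis s \<noteq> -1"
  shows "smooth_on U (\<lambda>s. Arg (w * cis s))"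
  using has_derivative_Arg_cis assms by (intro smooth_on_constant_derivative[where L = "\<lambda>t. t"]) auto

lemma circle_atlas_iff:
  "(U, \<phi>) \<in> circle_atlas \<longleftrightarrow> (\<exists>z0. norm z0 = 1 \<and> U = sphere 0 1 - {- z0} \<and> \<phi> = (\<lambda>u. Arg (u / z0)))"
  by (auto simp: circle_atlas_def)

lemma points_circle [simp]: "points circle_atlas = sphere 0 1"
proof
  show "sphere 0 1 \<subseteq> points circle_atlas"
  proof
    fix z :: complex assume z: "z \<in> sphere 0 1"
    have "(sphere 0 1 - {- z}, \<lambda>u. Arg (u / z)) \<in> circle_atlas"
      unfolding circle_atlas_iff using z by auto
    moreover have "z \<in> sphere 0 1 - {- z}" using z by auto
    ultimately show "z \<in> points circle_atlas"
      unfolding points_def by blast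
  qed
qed (auto simp: points_def circle_atlas_def)

lemma circle_chart:
  assumes "norm z0 = 1"
    and U_def: "U = sphere 0 1 - {- z0}" and \<phi>_def: "\<phi> = (\<lambda>u. Arg (u / z0))"
  shows "\<phi> ` U = {-pi<..<pi}" and "u \<in> U \<Longrightarrow> z0 * cis (\<phi> u) = u"
    and "s \<in> {-pi<..<pi} \<Longrightarrow> z0 * cis s \<in> U" and "s \<in> {-pi<..<pi} \<Longrightarrow> \<phi> (z0 * cis s) = s"
    and "s \<in> {-pi<..<pi} \<Longrightarrow> inv_into U \<phi> s = z0 * cis s"
proof -
  have z0: "z0 \<noteq> 0" using assms by auto
  show *: "z0 * cis (\<phi> u) = u" if "u \<in> U" for u
  proof -
    have "norm (u / z0) = 1" using that assms by (auto simp: norm_divide)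
    then have "cis (\<phi> u) = u / z0"
      using rcis_cmod_Arg[of "u / z0"] by (simp add: rcis_def \<phi>_def)
    then show ?thesis using z0 by simp
  qed
  have range: "\<phi> u \<in> {-pi<..<pi}" if "u \<in> U" for u
  proof -
    have "norm (u / z0) = 1" "u / z0 \<noteq> -1"
      using that assms z0 by (auto simp: norm_divide divide_eq_eq)
    then show ?thesis using Arg_less_pi Arg_bounded unfolding \<phi>_def by auto
  qed
  show phi: "\<phi> (z0 * cis s) = s" if "s \<in> {-pi<..<pi}" for s
    using that z0 by (simp add: \<phi>_def Arg_cis)
  show inU: "z0 * cis s \<in> U" if "s \<in> {-pi<..<pi}" for s
  proof -
    have "cis s \<noteq> -1"
    proof
      assume "cis s = -1"
      then have "Arg (cis s) = pi" by (simp add: Arg_eq_pi)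
      then show False using that by (simp add: Arg_cis)
    qed
    then have "z0 * cis s \<noteq> - z0" using z0
      by (metis mult_cancel_left mult_minus_right mult.right_neutral)
    then show ?thesis using assms by (auto simp: U_def norm_mult)
  qed
  show "\<phi> ` U = {-pi<..<pi}"
    using range phi inU by (auto, metis (no_types, lifting) greaterThanLessThan_iff imageI)
  have "inj_on \<phi> U" using * by (metis inj_onI)
  then show "inv_into U \<phi> s = z0 * cis s" if "s \<in> {-pi<..<pi}" for s
    using inv_into_f_eq inU[OF that] phi[OF that] by metis
qed

lemma manifold_circle: "manifold circle_atlas"
proof (rule manifoldI)
  show "\<exists>B::real set. finite B \<and> span B = UNIV"
    using onb_real by (auto simp: onb_def)
  show "Hausdorff_space (top_of_set (points circle_atlas))"
    "second_countable (top_of_set (points circle_atlas))"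
    by (auto intro: Hausdorff_space_subtopology second_countable_subtopology second_countable_euclidean)
next
  fix U \<phi> assume "(U, \<phi>) \<in> circle_atlas"
  then obtain z0 where z0: "norm z0 = 1" "U = sphere 0 1 - {- z0}" "\<phi> = (\<lambda>u. Arg (u / z0))"
    unfolding circle_atlas_iff by blast
  note c = circle_chart[OF z0]
  show "open_in circle_atlas U"
    unfolding open_in_def points_circle z0(2) openin_open by (rule exI[of _ "- {- z0}"]) auto
  show "open (\<phi> ` U)" unfolding c(1) by simp
  have "u / z0 \<notin> \<real>\<^sub>\<le>\<^sub>0" if "u \<in> U" for u
  proof
    assume r: "u / z0 \<in> \<real>\<^sub>\<le>\<^sub>0"
    have "norm (u / z0) = 1" "u / z0 \<noteq> -1"
      using that z0 by (auto simp: norm_divide divide_eq_eq)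
    with r show False
      by (auto simp: complex_nonpos_Reals_iff complex_eq_iff cmod_def)
  qed
  then have "continuous_on U \<phi>"
    unfolding z0(3) using z0(1) by (intro continuous_on_Arg' continuous_intros) auto
  moreover have "continuous_on {-pi<..<pi} (inv_into U \<phi>)"
    by (rule continuous_on_eq[of _ "\<lambda>s. z0 * cis s"]) (auto intro!: continuous_intros simp: c(5))
  moreover have ci: "inv_into U \<phi> (\<phi> x) = x" if "x \<in> U" for x
    using c(2)[OF that] c(5)[of "\<phi> x"] imageI[OF that, of \<phi>] unfolding c(1) by simp
  moreover have "inv_into U \<phi> ` {-pi<..<pi} = U"
    using inv_into_image_cancel[of \<phi> U U] calculation(3) c(1) by (metis inj_onI order_refl)
  ultimately show "homeomorphism U (\<phi> ` U) \<phi> (inv_into U \<phi>)"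
    unfolding homeomorphism_def c(1) using c(4,5) by auto
  fix V \<psi> assume "(V, \<psi>) \<in> circle_atlas"
  then obtain z1 where z1: "norm z1 = 1" "V = sphere 0 1 - {- z1}" "\<psi> = (\<lambda>u. Arg (u / z1))"
    unfolding circle_atlas_iff by blast
  have o: "open (\<phi> ` (U \<inter> V))"
  proof -
    have "\<phi> ` (U \<inter> V) = {s \<in> {-pi<..<pi}. z0 * cis s \<in> - {- z1}}"
      using c z0(2) z1(2) by (auto, metis IntI Diff_iff greaterThanLessThan_iff imageI insert_iff empty_iff)
    also have "\<dots> = {-pi<..<pi} \<inter> (\<lambda>s. z0 * cis s) -` (- {- z1})" by auto
    finally show ?thesis
      by simp (intro continuous_open_preimage continuous_intros; simp)
  qed
  have "smooth_on (\<phi> ` (U \<inter> V)) (\<lambda>s. Arg ((z0 / z1) * cis s))"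
  proof (rule smooth_on_Arg_cis[OF o])
    show "norm (z0 / z1) = 1" using z0 z1 by (simp add: norm_divide)
    fix s assume "s \<in> \<phi> ` (U \<inter> V)"
    then have "z0 * cis s \<noteq> - z1" using c(2) z1(2) by auto
    then show "z0 / z1 * cis s \<noteq> -1"
      using z1(1) by (auto simp: divide_eq_eq)
  qed
  then show "smooth_on (\<phi> ` (U \<inter> V)) (\<psi> \<circ> inv_into U \<phi>)"
    by (rule smooth_on_cong[OF o]) (use ci c(2) z1(3) in auto)
qed

lemma smooth_fn_Arg:
  assumes "norm z0 = 1" shows "smooth_fn circle_atlas (sphere 0 1 - {- z0}) (\<lambda>u. Arg (u / z0))"
proof (rule smooth_fn_in_chart[OF manifold_circle])
  show c: "(sphere 0 1 - {- z0}, \<lambda>u. Arg (u / z0)) \<in> circle_atlas"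
    unfolding circle_atlas_iff using assms by blast
  then show "open_in circle_atlas (sphere 0 1 - {- z0})" by (rule chart_open_in[OF manifold_circle])
  show "smooth_on ((\<lambda>u. Arg (u / z0)) ` (sphere 0 1 - {- z0}))
     ((\<lambda>u. Arg (u / z0)) \<circ> inv_into (sphere 0 1 - {- z0}) (\<lambda>u. Arg (u / z0)))"
    by (rule smooth_on_cong[OF chart_open[OF manifold_circle c] smooth_on_id[OF chart_open[OF manifold_circle c]]])
      (use circle_chart[OF assms refl refl] in auto)
qed auto

lemma smooth_map_rotation:
  assumes u: "norm u = 1" shows "smooth_map circle_atlas circle_atlas (\<lambda>z. z * u)"
proof -
  have "smooth_on (\<phi> ` {x \<in> U. x * u \<in> V}) (\<psi> \<circ> (\<lambda>z. z * u) \<circ> inv_into U \<phi>)"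
    if U: "(U, \<phi>) \<in> circle_atlas" and V: "(V, \<psi>) \<in> circle_atlas" for U \<phi> V \<psi>
  proof -
    obtain z0 where z0: "norm z0 = 1" "U = sphere 0 1 - {- z0}" "\<phi> = (\<lambda>u. Arg (u / z0))"
      using U unfolding circle_atlas_iff by blast
    obtain z1 where z1: "norm z1 = 1" "V = sphere 0 1 - {- z1}" "\<psi> = (\<lambda>u. Arg (u / z1))"
      using V unfolding circle_atlas_iff by blast
    note c = circle_chart[OF z0]
    have eq: "\<phi> ` {x \<in> U. x * u \<in> V} = {-pi<..<pi} \<inter> (\<lambda>s. z0 * cis s * u) -` (- {- z1})"
    proof -
      have "x * u \<in> V \<longleftrightarrow> x * u \<noteq> - z1" if "x \<in> U" for x
        using that u z0(2) z1(2) by (auto simp: norm_mult)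
      then show ?thesis
        using c by (auto simp: image_iff) (metis c(4) greaterThanLessThan_iff)
    qed
    have o: "open (\<phi> ` {x \<in> U. x * u \<in> V})"
      unfolding eq by (intro continuous_open_preimage continuous_intros; simp)
    have "smooth_on (\<phi> ` {x \<in> U. x * u \<in> V}) (\<lambda>s. Arg ((z0 * u / z1) * cis s))"
    proof (rule smooth_on_Arg_cis[OF o])
      show "norm (z0 * u / z1) = 1" using z0 z1 u by (simp add: norm_divide norm_mult)
      fix s assume "s \<in> \<phi> ` {x \<in> U. x * u \<in> V}"
      then have "z0 * cis s * u \<noteq> - z1" using c(2) z1(2) by auto
      then show "z0 * u / z1 * cis s \<noteq> -1"
        using z1(1) by (auto simp: divide_eq_eq mult.commute mult.left_commute)
    qed
    then show ?thesis
      by (rule smooth_on_cong[OF o]) (use c z1(3) eq in \<open>auto simp: ac_simps\<close>)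
  qed
  then show ?thesis
    using u by (auto simp: smooth_map_def norm_mult intro!: continuous_intros)
qed

section \<open>Tangent vectors as derivations\<close>

lemma smooth_atI: "smooth_fn A W f \<Longrightarrow> p \<in> W \<Longrightarrow> smooth_at A p f"
  by (auto simp: smooth_at_def)

lemma smooth_at_within:
  assumes "smooth_at A p f" "open_in A W" "p \<in> W"
  obtains V where "p \<in> V" "V \<subseteq> W" "smooth_fn A V f"
proof -
  obtain V where V: "p \<in> V" "smooth_fn A V f" using assms(1) by (auto simp: smooth_at_def)
  have "smooth_fn A (V \<inter> W) f"
    by (rule smooth_fn_subset[OF V(2) open_in_Int[OF smooth_fn_open[OF V(2)] assms(2)]]) simp
  then show thesis using that[of "V \<inter> W"] V(1) assms(3) by blast
qed

lemma smooth_at_two: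
  assumes "smooth_at A p f" "smooth_at A p g"
  obtains V where "p \<in> V" "smooth_fn A V f" "smooth_fn A V g"
proof -
  obtain V where V: "p \<in> V" "smooth_fn A V f" using assms(1) by (auto simp: smooth_at_def)
  obtain W where W: "p \<in> W" "W \<subseteq> V" "smooth_fn A W g"
    by (rule smooth_at_within[OF assms(2) smooth_fn_open[OF V(2)] V(1)])
  show thesis
    using that[OF W(1) smooth_fn_subset[OF V(2) smooth_fn_open[OF W(3)] W(2)] W(3)] .
qed

lemma smooth_at_cong:
  assumes "manifold A" "open_in A W" "p \<in> W" "\<And>x. x \<in> W \<Longrightarrow> f x = g x" "smooth_at A p g"
  shows "smooth_at A p f"
proof -
  obtain V where "p \<in> V" "V \<subseteq> W" "smooth_fn A V g"
    by (rule smooth_at_within[OF assms(5,2,3)])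
  then show ?thesis
    using smooth_fn_cong[OF assms(1), of V g f] assms(4) smooth_atI by blast
qed

lemma smooth_at_add: "manifold A \<Longrightarrow> smooth_at A p f \<Longrightarrow> smooth_at A p g \<Longrightarrow> smooth_at A p (\<lambda>x. f x + g x)"
  by (metis smooth_at_two smooth_fn_add smooth_atI)

lemma smooth_at_mult: "manifold A \<Longrightarrow> smooth_at A p f \<Longrightarrow> smooth_at A p g \<Longrightarrow> smooth_at A p (\<lambda>x. f x * g x)"
  by (metis smooth_at_two smooth_fn_mult smooth_atI)

lemma smooth_at_const: "manifold A \<Longrightarrow> p \<in> points A \<Longrightarrow> smooth_at A p (\<lambda>x. a)"
  by (metis open_in_points smooth_fn_const smooth_atI)

lemma smooth_at_compose:
  assumes "manifold A" "manifold B" "smooth_map A B F" "p \<in> points A" "smooth_at B (F p) h"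
  shows "smooth_at A p (\<lambda>x. h (F x))"
proof -
  obtain V where "F p \<in> V" "smooth_fn B V h" using assms(5) by (auto simp: smooth_at_def)
  then show ?thesis
    using smooth_fn_pullback[OF assms(1-3), of V h] assms(4) by (auto intro: smooth_atI)
qed

lemma smooth_fn_open_atlas_D:
  assumes "open (I::real set)" "smooth_fn (open_atlas I) W h"
  shows "open W" "W \<subseteq> I" "smooth_on W h"
proof -
  show W: "open W" "W \<subseteq> I"
    using smooth_fn_open[OF assms(2)] open_in_open_atlas[OF assms(1)] by auto
  have "smooth_on ((\<lambda>x. x) ` (I \<inter> W)) (h \<circ> inv_into I (\<lambda>x. x))"
    by (rule smooth_fn_chart[OF assms(2)]) (simp add: open_atlas_def)
  then have "smooth_on W (h \<circ> inv_into I (\<lambda>x. x))"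
    using W by (simp add: Int_absorb1)
  then show "smooth_on W h"
    by (rule smooth_on_cong[OF W(1)]) (use W in \<open>auto simp: inv_into_f_f[of "\<lambda>x. x", simplified]\<close>)
qed

lemma smooth_on_real_deriv:
  fixes h :: "real \<Rightarrow> real"
  assumes "smooth_on W h" "t \<in> W" shows "(h has_real_derivative deriv h t) (at t)"
  using smooth_on_has_derivative[OF assms] DERIV_deriv_iff_real_differentiable
  unfolding differentiable_def by blast

lemma curve_smooth_fn:
  assumes A: "manifold A" and \<gamma>: "smooth_map (open_atlas {-e<..<e::real}) A \<gamma>" "e > 0"
    and f: "smooth_at A (\<gamma> 0) f"
  shows "((\<lambda>t. f (\<gamma> t)) has_real_derivative deriv (\<lambda>t. f (\<gamma> t)) 0) (at 0)"
proof -
  obtain V where V: "\<gamma> 0 \<in> V" "smooth_fn A V f" using f by (auto simp: smooth_at_def)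
  have "smooth_fn (open_atlas {-e<..<e}) {x \<in> points (open_atlas {-e<..<e}). \<gamma> x \<in> V} (\<lambda>t. f (\<gamma> t))"
    by (rule smooth_fn_pullback[OF manifold_open A \<gamma>(1) V(2)]) simp
  from smooth_fn_open_atlas_D(3)[OF _ this] show ?thesis
    by (intro smooth_on_real_deriv) (use V(1) \<gamma>(2) in auto)
qed

lemma tangentE:
  assumes "v \<in> tangent_space A p"
  obtains \<gamma> e where "e > 0" "smooth_map (open_atlas {-e<..<e::real}) A \<gamma>" "\<gamma> 0 = p" "v = velocity A \<gamma>"
  using assms unfolding tangent_space_def by blast

lemma tangent_points: "v \<in> tangent_space A p \<Longrightarrow> p \<in> points A"
  by (elim tangentE) (auto dest: smooth_map_points[of _ _ _ 0])

lemma tangent_nonsmooth: "v \<in> tangent_space A p \<Longrightarrow> \<not> smooth_at A p f \<Longrightarrow> v f = 0"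
  by (elim tangentE) (simp add: velocity_def)

lemma tangent_derivative:
  assumes A: "manifold A" and v: "v \<in> tangent_space A p"
  obtains \<gamma> e where "e > 0" "smooth_map (open_atlas {-e<..<e::real}) A \<gamma>" "\<gamma> 0 = p"
    and "\<And>f. smooth_at A p f \<Longrightarrow> ((\<lambda>t. f (\<gamma> t)) has_real_derivative v f) (at 0)"
proof -
  obtain \<gamma> e where \<gamma>: "e > 0" "smooth_map (open_atlas {-e<..<e::real}) A \<gamma>" "\<gamma> 0 = p" "v = velocity A \<gamma>"
    using v by (rule tangentE)
  have "((\<lambda>t. f (\<gamma> t)) has_real_derivative v f) (at 0)" if "smooth_at A p f" for f
    using curve_smooth_fn[OF A \<gamma>(2,1)] that by (simp add: \<gamma> velocity_def comp_def)
  then show thesis using that \<gamma> by blast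
qed

text \<open>
  A tangent vector only sees germs, because its curve stays in \<open>W\<close> for small times.  The equation also
  covers functions that are not smooth at \<open>p\<close>: then both sides are \<open>0\<close>.
\<close>

lemma tangent_local:
  assumes A: "manifold A" and v: "v \<in> tangent_space A p" and W: "open_in A W" "p \<in> W"
    and eq: "\<And>x. x \<in> W \<Longrightarrow> f x = g x"
  shows "v f = v g"
proof (cases "smooth_at A p f")
  case True
  obtain \<gamma> e where \<gamma>: "e > 0" "smooth_map (open_atlas {-e<..<e::real}) A \<gamma>" "\<gamma> 0 = p"
    and d: "\<And>f. smooth_at A p f \<Longrightarrow> ((\<lambda>t. f (\<gamma> t)) has_real_derivative v f) (at 0)"
    using tangent_derivative[OF A v] by blast
  have "open_in (open_atlas {-e<..<e}) {x \<in> points (open_atlas {-e<..<e}). \<gamma> x \<in> W}"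
    by (rule smooth_map_preimage[OF \<gamma>(2) W(1)])
  then have o: "open {x \<in> {-e<..<e}. \<gamma> x \<in> W}"
    by (simp add: open_in_open_atlas)
  have g: "smooth_at A p g"
    by (rule smooth_at_cong[OF A W _ True]) (use eq in auto)
  have "((\<lambda>t. g (\<gamma> t)) has_real_derivative v f) (at 0)"
    by (rule DERIV_cong_ev[THEN iffD1, OF refl _ refl d[OF True]])
      (use eq W \<gamma> in \<open>auto intro!: eventually_nhds_in_open[OF o, THEN eventually_mono]\<close>)
  then show ?thesis using d[OF g] DERIV_unique by blast
next
  case False
  then have "\<not> smooth_at A p g"
    using smooth_at_cong[OF A W, of f g] eq by blast
  then show ?thesis using False tangent_nonsmooth[OF v] by simp
qed

lemma tangent_add:
  assumes "manifold A" "v \<in> tangent_space A p" "smooth_at A p f" "smooth_at A p g"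
  shows "v (\<lambda>x. f x + g x) = v f + v g"
proof -
  obtain \<gamma> where d: "\<And>f. smooth_at A p f \<Longrightarrow> ((\<lambda>t. f (\<gamma> t)) has_real_derivative v f) (at 0)"
    using tangent_derivative[OF assms(1,2)] by metis
  show ?thesis
    using DERIV_unique[OF d[OF smooth_at_add[OF assms(1,3,4)]] DERIV_add[OF d[OF assms(3)] d[OF assms(4)]]] .
qed

lemma tangent_mult:
  assumes "manifold A" "v \<in> tangent_space A p" "smooth_at A p f" "smooth_at A p g"
  shows "v (\<lambda>x. f x * g x) = v f * g p + f p * v g"
proof -
  obtain \<gamma> where \<gamma>: "\<gamma> (0::real) = p"
    and d: "\<And>f. smooth_at A p f \<Longrightarrow> ((\<lambda>t. f (\<gamma> t)) has_real_derivative v f) (at 0)"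
    using tangent_derivative[OF assms(1,2)] by metis
  show ?thesis
    using DERIV_unique[OF d[OF smooth_at_mult[OF assms(1,3,4)]] DERIV_mult[OF d[OF assms(3)] d[OF assms(4)]]]
    by (simp add: \<gamma> mult.commute)
qed

lemma tangent_const:
  assumes "manifold A" "v \<in> tangent_space A p" shows "v (\<lambda>x. a) = 0"
proof -
  obtain \<gamma> where d: "\<And>f. smooth_at A p f \<Longrightarrow> ((\<lambda>t. f (\<gamma> t)) has_real_derivative v f) (at 0)"
    using tangent_derivative[OF assms(1,2)] by metis
  show ?thesis
    using DERIV_unique[OF d[OF smooth_at_const[OF assms(1) tangent_points[OF assms(2)], of a]] DERIV_const] .
qed

lemma tangent_scale:
  assumes "manifold A" "v \<in> tangent_space A p" "smooth_at A p f"
  shows "v (\<lambda>x. a * f x) = a * v f"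
  using tangent_mult[OF assms(1,2) smooth_at_const[OF assms(1) tangent_points[OF assms(2)], of a] assms(3)]
    tangent_const[OF assms(1,2), of a] by simp

lemma tangent_sum:
  assumes "manifold A" "v \<in> tangent_space A p" "\<And>i. i \<in> I \<Longrightarrow> smooth_at A p (f i)"
  shows "v (\<lambda>x. \<Sum>i\<in>I. f i x) = (\<Sum>i\<in>I. v (f i)) \<and> smooth_at A p (\<lambda>x. \<Sum>i\<in>I. f i x)"
  using assms(3)
proof (induction I rule: infinite_finite_induct)
  case (insert i I)
  then show ?case
    using tangent_add[OF assms(1,2), of "f i" "\<lambda>x. \<Sum>i\<in>I. f i x"] smooth_at_add[OF assms(1)] by simp
qed (use tangent_const[OF assms(1,2)] smooth_at_const[OF assms(1) tangent_points[OF assms(2)]] in auto)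

subsection \<open>Coordinate vectors\<close>

text \<open>
  The default value \<open>0\<close> on functions that are not smooth at \<open>p\<close> is the one used for velocities of curves, so
  that coordinate vectors can be equal to tangent vectors as functions.
\<close>

definition chart_vec :: "('p::topological_space, 'e::real_inner) atlas \<Rightarrow> 'p set \<Rightarrow> ('p \<Rightarrow> 'e) \<Rightarrow> 'e \<Rightarrow> 'p \<Rightarrow> 'p tvec" where
  "chart_vec A U \<phi> e p = (\<lambda>f. if smooth_at A p f then frechet_derivative (f \<circ> inv_into U \<phi>) (at (\<phi> p)) e else 0)"

context
  fixes A :: "('p::topological_space, 'e::real_inner) atlas" and U \<phi>
  assumes A: "manifold A" and chart: "(U, \<phi>) \<in> A"
begin

lemma chart_has_derivative:
  assumes "p \<in> U" "smooth_at A p f"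
  shows "(f \<circ> inv_into U \<phi> has_derivative frechet_derivative (f \<circ> inv_into U \<phi>) (at (\<phi> p))) (at (\<phi> p))"
proof -
  obtain V where "p \<in> V" "smooth_fn A V f" using assms(2) by (auto simp: smooth_at_def)
  then show ?thesis
    using smooth_on_has_derivative[OF smooth_fn_chart[OF _ chart]] assms(1) by blast
qed

lemma chart_coordinate_smooth: "smooth_fn A U (\<lambda>x. \<phi> x \<bullet> b)"
proof (rule smooth_fn_in_chart[OF A chart chart_open_in[OF A chart]])
  show "smooth_on (\<phi> ` U) ((\<lambda>x. \<phi> x \<bullet> b) \<circ> inv_into U \<phi>)"
    by (rule smooth_on_cong[OF chart_open[OF A chart] smooth_on_linear[OF bounded_linear_inner_left chart_open[OF A chart]]])
      (use chart_inv[OF A chart] in auto)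
qed simp

lemma linear_chart_vec:
  assumes "p \<in> U" shows "linear (\<lambda>e. chart_vec A U \<phi> e p)"
proof (rule linearI; rule ext)
  show "chart_vec A U \<phi> (x + y) p f = (chart_vec A U \<phi> x p + chart_vec A U \<phi> y p) f" for x y f
    using linear_add[OF has_derivative_linear[OF chart_has_derivative[OF assms]]]
    by (cases "smooth_at A p f") (simp_all add: chart_vec_def)
  show "chart_vec A U \<phi> (r *\<^sub>R x) p f = (r *\<^sub>R chart_vec A U \<phi> x p) f" for r x f
    using linear_scale[OF has_derivative_linear[OF chart_has_derivative[OF assms]]]
    by (cases "smooth_at A p f") (simp_all add: chart_vec_def scaleR_fun_def)
qed

lemma chart_vec_coordinate:
  assumes "p \<in> U" shows "chart_vec A U \<phi> e p (\<lambda>x. \<phi> x \<bullet> b) = e \<bullet> b"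
proof -
  have "((\<lambda>y. y \<bullet> b) has_derivative (\<lambda>y. y \<bullet> b)) (at (\<phi> p))"
    by (rule bounded_linear_imp_has_derivative[OF bounded_linear_inner_left])
  then have "((\<lambda>x. \<phi> x \<bullet> b) \<circ> inv_into U \<phi> has_derivative (\<lambda>y. y \<bullet> b)) (at (\<phi> p))"
    by (rule has_derivative_transform_within_open[OF _ chart_open[OF A chart]])
      (use assms chart_inv[OF A chart] in auto)
  then show ?thesis
    using frechet_derivative_at smooth_atI[OF chart_coordinate_smooth assms]
    unfolding chart_vec_def by metis
qed

text \<open>
  The curve is the straight line with direction \<open>e\<close> in the chart.
\<close>

lemma chart_vec_tangent:
  assumes p: "p \<in> U" shows "chart_vec A U \<phi> e p \<in> tangent_space A p"
proof -
  let ?l = "\<lambda>t::real. \<phi> p + t *\<^sub>R e" and ?\<gamma> = "\<lambda>t::real. inv_into U \<phi> (\<phi> p + t *\<^sub>R e)"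
  have "open (?l -` (\<phi> ` U))"
    by (intro open_vimage chart_open[OF A chart] continuous_intros)
  moreover have "0 \<in> ?l -` (\<phi> ` U)" using p by auto
  ultimately obtain r where r: "r > 0" "ball 0 r \<subseteq> ?l -` (\<phi> ` U)"
    using open_contains_ball by blast
  have I: "?l t \<in> \<phi> ` U" if "t \<in> {-r<..<r}" for t
    using r(2) that by (auto simp: subset_eq dist_real_def)
  then have inU: "?\<gamma> t \<in> U" "\<phi> (?\<gamma> t) = ?l t" if "t \<in> {-r<..<r}" for t
    using chart_image_inv[OF A chart _ order_refl] that by blast+
  have line: "smooth_on T ?l" if "open T" for T
    by (rule smooth_on_constant_derivative[OF that, where L = "\<lambda>s. s *\<^sub>R e"]) (auto intro!: derivative_eq_intros)
  have cont: "continuous_on {-r<..<r} ?\<gamma>"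
  proof (rule continuous_on_compose2[of "\<phi> ` U" "inv_into U \<phi>" _ ?l])
    show "continuous_on (\<phi> ` U) (inv_into U \<phi>)"
      using chart_homeomorphism[OF A chart] by (simp add: homeomorphism_def)
    show "continuous_on {-r<..<r} ?l" by (intro continuous_intros)
  qed (use I in blast)
  obtain B :: "'e set" where B: "onb B" using manifold_onb[OF A] by blast
  have "smooth_map (open_atlas {-r<..<r}) A ?\<gamma>"
    unfolding smooth_map_def points_open
  proof (intro conjI cont)
    show "?\<gamma> ` {-r<..<r} \<subseteq> points A"
      using inU chart_subset[OF chart] by blast
    have "smooth_on ({t \<in> {-r<..<r}. ?\<gamma> t \<in> V}) (\<psi> \<circ> ?\<gamma> \<circ> inv_into {-r<..<r} (\<lambda>x. x))"
      if V: "(V, \<psi>) \<in> A" for V \<psi>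
    proof -
      have VU: "open (\<phi> ` (U \<inter> V))"
        by (rule chart_set_open[OF A chart_open_in[OF A V] chart])
      have eq: "{t \<in> {-r<..<r}. ?\<gamma> t \<in> V} = {-r<..<r} \<inter> ?l -` (\<phi> ` (U \<inter> V))"
        using inU chart_image_inv[OF A chart, of _ "U \<inter> V"] by (auto simp: image_iff; metis IntI Int_lower1)
      have o: "open {t \<in> {-r<..<r}. ?\<gamma> t \<in> V}"
        unfolding eq by (intro open_Int open_vimage VU continuous_intros; simp)
      have "smooth_on {t \<in> {-r<..<r}. ?\<gamma> t \<in> V} (\<lambda>t. (\<psi> \<circ> inv_into U \<phi>) (?l t))"
        by (rule smooth_on_compose[OF B o VU _ line[OF o] chart_transition[OF A V chart]]) (use eq in blast)
      then show ?thesis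
        by (rule smooth_on_cong[OF o]) (auto simp: inv_into_f_f[of "\<lambda>x. x", simplified])
    qed
    then show "\<forall>(U, \<phi>)\<in>open_atlas {-r<..<r}. \<forall>(V, \<psi>)\<in>A.
        smooth_on (\<phi> ` {x \<in> U. ?\<gamma> x \<in> V}) (\<psi> \<circ> ?\<gamma> \<circ> inv_into U \<phi>)"
      by (auto simp: open_atlas_def)
  qed
  moreover have "chart_vec A U \<phi> e p = velocity A ?\<gamma>"
  proof
    fix f
    have "deriv (f \<circ> ?\<gamma>) 0 = frechet_derivative (f \<circ> inv_into U \<phi>) (at (\<phi> p)) e" if f: "smooth_at A p f"
    proof -
      note d = chart_has_derivative[OF p f]
      have "(?l has_derivative (\<lambda>s. s *\<^sub>R e)) (at 0)" by (auto intro!: derivative_eq_intros)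
      then have "((f \<circ> inv_into U \<phi>) \<circ> ?l has_derivative
          frechet_derivative (f \<circ> inv_into U \<phi>) (at (\<phi> p)) \<circ> (\<lambda>s. s *\<^sub>R e)) (at 0)"
        by (rule diff_chain_at) (use d in simp)
      then have "(f \<circ> ?\<gamma> has_real_derivative frechet_derivative (f \<circ> inv_into U \<phi>) (at (\<phi> p)) e) (at 0)"
        using linear_scale[OF has_derivative_linear[OF d]]
        by (simp add: has_field_derivative_def comp_def mult_commute_abs)
      then show ?thesis by (rule DERIV_imp_deriv)
    qed
    then show "chart_vec A U \<phi> e p f = velocity A ?\<gamma> f"
      using p chart_inv[OF A chart] by (simp add: chart_vec_def velocity_def)
  qed
  moreover have "?\<gamma> 0 = p" using p chart_inv[OF A chart] by simp
  ultimately show ?thesis using r(1) unfolding tangent_space_def by blast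
qed

lemma tangent_chart_vec:
  assumes p: "p \<in> U" and v: "v \<in> tangent_space A p"
  obtains e where "v = chart_vec A U \<phi> e p"
proof -
  obtain \<gamma> r where \<gamma>: "r > 0" "smooth_map (open_atlas {-r<..<r::real}) A \<gamma>" "\<gamma> 0 = p" "v = velocity A \<gamma>"
    using v by (rule tangentE)
  have "({-r<..<r}, \<lambda>x. x) \<in> open_atlas {-r<..<r}" by (simp add: open_atlas_def)
  from smooth_map_chart[OF \<gamma>(2) this chart]
  have s: "smooth_on {t \<in> {-r<..<r}. \<gamma> t \<in> U} (\<phi> \<circ> \<gamma> \<circ> inv_into {-r<..<r} (\<lambda>x. x))" by simp
  have "open_in (open_atlas {-r<..<r}) {x \<in> points (open_atlas {-r<..<r}). \<gamma> x \<in> U}"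
    by (rule smooth_map_preimage[OF \<gamma>(2) chart_open_in[OF A chart]])
  then have o: "open {x \<in> {-r<..<r}. \<gamma> x \<in> U}"
    by (simp add: open_in_open_atlas)
  have "smooth_on {t \<in> {-r<..<r}. \<gamma> t \<in> U} (\<phi> \<circ> \<gamma>)"
    by (rule smooth_on_cong[OF o s]) (auto simp: inv_into_f_f[of "\<lambda>x. x", simplified])
  from smooth_on_has_derivative[OF this] have d: "(\<phi> \<circ> \<gamma> has_derivative frechet_derivative (\<phi> \<circ> \<gamma>) (at 0)) (at 0)"
    using \<gamma> p by simp
  have "v f = chart_vec A U \<phi> (frechet_derivative (\<phi> \<circ> \<gamma>) (at 0) 1) p f" for f
  proof (cases "smooth_at A p f")
    case True
    note c = chart_has_derivative[OF p True]
    have "((f \<circ> inv_into U \<phi>) \<circ> (\<phi> \<circ> \<gamma>) has_derivative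
       frechet_derivative (f \<circ> inv_into U \<phi>) (at (\<phi> p)) \<circ> frechet_derivative (\<phi> \<circ> \<gamma>) (at 0)) (at 0)"
      by (rule diff_chain_at[OF d]) (use c \<gamma> in simp)
    then have "(f \<circ> \<gamma> has_derivative
       frechet_derivative (f \<circ> inv_into U \<phi>) (at (\<phi> p)) \<circ> frechet_derivative (\<phi> \<circ> \<gamma>) (at 0)) (at 0)"
      by (rule has_derivative_transform_within_open[OF _ o]) (use p \<gamma> chart_inv[OF A chart] in auto)
    then have "(f \<circ> \<gamma> has_real_derivative
       frechet_derivative (f \<circ> inv_into U \<phi>) (at (\<phi> p)) (frechet_derivative (\<phi> \<circ> \<gamma>) (at 0) 1)) (at 0)"
      unfolding has_field_derivative_def
    proof (rule has_derivative_eq_rhs, intro ext)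
      fix s :: real
      have "frechet_derivative (\<phi> \<circ> \<gamma>) (at 0) s = s *\<^sub>R frechet_derivative (\<phi> \<circ> \<gamma>) (at 0) 1"
        using linear_scale[OF has_derivative_linear[OF d], of s 1] by simp
      then show "(frechet_derivative (f \<circ> inv_into U \<phi>) (at (\<phi> p)) \<circ> frechet_derivative (\<phi> \<circ> \<gamma>) (at 0)) s =
          frechet_derivative (f \<circ> inv_into U \<phi>) (at (\<phi> p)) (frechet_derivative (\<phi> \<circ> \<gamma>) (at 0) 1) * s"
        using linear_scale[OF has_derivative_linear[OF c]] by simp
    qed
    then show ?thesis
      using True \<gamma> DERIV_imp_deriv by (simp add: velocity_def chart_vec_def)
  next
    case False
    then show ?thesis using \<gamma> by (simp add: velocity_def chart_vec_def)
  qed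
  then show thesis using that by blast
qed

lemma tangent_space_eq_range:
  "p \<in> U \<Longrightarrow> tangent_space A p = range (\<lambda>e. chart_vec A U \<phi> e p)"
  using tangent_chart_vec chart_vec_tangent by blast

lemma chart_vec_smooth_in_chart:
  assumes f: "smooth_fn A V f" "V \<subseteq> U"
  shows "smooth_fn A V (\<lambda>p. chart_vec A U \<phi> e p f)"
    and "y \<in> \<phi> ` V \<Longrightarrow> ((\<lambda>p. chart_vec A U \<phi> e p f) \<circ> inv_into U \<phi>) y = frechet_derivative (f \<circ> inv_into U \<phi>) (at y) e"
proof -
  have V: "open_in A V" using smooth_fn_open[OF f(1)] .
  have eq: "((\<lambda>p. chart_vec A U \<phi> e p f) \<circ> inv_into U \<phi>) y = frechet_derivative (f \<circ> inv_into U \<phi>) (at y) e"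
    if "y \<in> \<phi> ` V" for y
    using chart_image_inv[OF A chart that f(2)] smooth_atI[OF f(1)] by (auto simp: chart_vec_def)
  then show "y \<in> \<phi> ` V \<Longrightarrow> ((\<lambda>p. chart_vec A U \<phi> e p f) \<circ> inv_into U \<phi>) y = frechet_derivative (f \<circ> inv_into U \<phi>) (at y) e" .
  have "U \<inter> V = V" using f(2) by auto
  then have "smooth_on (\<phi> ` V) (f \<circ> inv_into U \<phi>)"
    using smooth_fn_chart[OF f(1) chart] by simp
  then show "smooth_fn A V (\<lambda>p. chart_vec A U \<phi> e p f)"
    by (intro smooth_fn_in_chart[OF A chart V f(2)] smooth_on_cong[OF chart_image_open[OF A chart V f(2)]
        smooth_on_frechet_derivative eq])
qed

lemma chart_vec_vector_field: "vector_field A U (chart_vec A U \<phi> e)"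
  unfolding vector_field_def
  using chart_open_in[OF A chart] chart_vec_tangent chart_vec_smooth_in_chart(1) by auto

text \<open>
  In the chart the two sides are iterated directional derivatives.
\<close>

lemma chart_vec_commute:
  assumes "p \<in> U" "smooth_at A p f"
  shows "chart_vec A U \<phi> a p (\<lambda>q. chart_vec A U \<phi> b q f) = chart_vec A U \<phi> b p (\<lambda>q. chart_vec A U \<phi> a q f)"
proof -
  obtain V where V: "p \<in> V" "V \<subseteq> U" "smooth_fn A V f"
    by (rule smooth_at_within[OF assms(2) chart_open_in[OF A chart] assms(1)])
  have o: "open (\<phi> ` V)" by (rule chart_image_open[OF A chart smooth_fn_open[OF V(3)] V(2)])
  have "U \<inter> V = V" using V(2) by auto
  then have s: "smooth_on (\<phi> ` V) (f \<circ> inv_into U \<phi>)"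
    using smooth_fn_chart[OF V(3) chart] by simp
  have "chart_vec A U \<phi> a p (\<lambda>q. chart_vec A U \<phi> b q f) =
      frechet_derivative (\<lambda>y. frechet_derivative (f \<circ> inv_into U \<phi>) (at y) b) (at (\<phi> p)) a" for a b
  proof -
    have "((\<lambda>y. frechet_derivative (f \<circ> inv_into U \<phi>) (at y) b) has_derivative
      frechet_derivative (\<lambda>y. frechet_derivative (f \<circ> inv_into U \<phi>) (at y) b) (at (\<phi> p))) (at (\<phi> p))"
      using smooth_on_has_derivative[OF smooth_on_frechet_derivative[OF s]] V(1) by blast
    then have "((\<lambda>q. chart_vec A U \<phi> b q f) \<circ> inv_into U \<phi> has_derivative
      frechet_derivative (\<lambda>y. frechet_derivative (f \<circ> inv_into U \<phi>) (at y) b) (at (\<phi> p))) (at (\<phi> p))"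
      by (rule has_derivative_transform_within_open[OF _ o])
        (use V(1) chart_vec_smooth_in_chart(2)[OF V(3,2)] in auto)
    from frechet_derivative_at[OF this] show ?thesis
      using smooth_atI[OF chart_vec_smooth_in_chart(1)[OF V(3,2)] V(1)]
      by (simp add: chart_vec_def[of A U \<phi> a])
  qed
  then show ?thesis
    using frechet_derivative_commute[OF o s, of "\<phi> p"] V(1) by simp
qed

text \<open>
  Every local computation below rests on this expansion.  Its coefficients are values of \<open>v\<close> on the coordinate
  functions, so for a vector field they are smooth functions of \<open>p\<close>.
\<close>

lemma tangent_expand:
  assumes p: "p \<in> U" and v: "v \<in> tangent_space A p" and B: "onb B"
  shows "v = (\<Sum>b\<in>B. v (\<lambda>x. \<phi> x \<bullet> b) *\<^sub>R chart_vec A U \<phi> b p)"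
proof -
  obtain e where e: "v = chart_vec A U \<phi> e p" using tangent_chart_vec[OF p v] by blast
  have "v (\<lambda>x. \<phi> x \<bullet> b) = e \<bullet> b" for b
    unfolding e by (rule chart_vec_coordinate[OF p])
  moreover have "v = (\<Sum>b\<in>B. (e \<bullet> b) *\<^sub>R chart_vec A U \<phi> b p)"
    unfolding e by (subst onb_expand[OF B, of e])
      (simp add: linear_sum[OF linear_chart_vec[OF p]] linear_scale[OF linear_chart_vec[OF p]])
  ultimately show ?thesis by simp
qed

lemma tangent_eqI:
  assumes "p \<in> U" "v \<in> tangent_space A p" "w \<in> tangent_space A p"
    and "\<And>b. v (\<lambda>x. \<phi> x \<bullet> b) = w (\<lambda>x. \<phi> x \<bullet> b)"
  shows "v = w"
proof -
  obtain B :: "'e set" where B: "onb B" using manifold_onb[OF A] by blast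
  show ?thesis
    using tangent_expand[OF assms(1,2) B] tangent_expand[OF assms(1,3) B] assms(4) by simp
qed

end

lemma sum_fun_apply: "(\<Sum>i\<in>I. f i) x = (\<Sum>i\<in>I. f i x)"
  by (induction I rule: infinite_finite_induct) auto

lemma tangent_expand_apply:
  assumes "manifold A" "(U, \<phi>) \<in> A" "p \<in> U" "v \<in> tangent_space A p" "onb B"
  shows "v f = (\<Sum>b\<in>B. v (\<lambda>x. \<phi> x \<bullet> b) * chart_vec A U \<phi> b p f)"
  by (subst tangent_expand[OF assms]) (simp add: sum_fun_apply scaleR_fun_def)

lemma subspace_tangent:
  assumes A: "manifold A" and p: "p \<in> points A" shows "subspace (tangent_space A p)"
proof -
  obtain U \<phi> where U: "(U, \<phi>) \<in> A" "p \<in> U" using p by (rule points_chartE)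
  show ?thesis
    unfolding tangent_space_eq_range[OF A U]
    by (rule linear_subspace_image[OF linear_chart_vec[OF A U] subspace_UNIV])
qed

text \<open>
  The coordinate functions separate the coordinate vectors, so the chart embeds the model space.
\<close>

lemma dim_tangent_space:
  assumes A: "manifold (A :: ('p::topological_space, 'e::real_inner) atlas)" and p: "p \<in> points A"
    and B: "onb (B :: 'e set)"
  shows "dim (tangent_space A p) = card B"
proof -
  obtain U \<phi> where U: "(U, \<phi>) \<in> A" "p \<in> U" using p by (rule points_chartE)
  let ?L = "\<lambda>e. chart_vec A U \<phi> e p"
  note lin = linear_chart_vec[OF A U]
  have inj: "inj ?L"
  proof (rule injI)
    fix a b assume "?L a = ?L b"
    then have "a \<bullet> c = b \<bullet> c" for c using chart_vec_coordinate[OF A U] by metis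
    then have "(a - b) \<bullet> (a - b) = 0" by (simp add: inner_diff_left)
    then show "a = b" by simp
  qed
  have "independent (?L ` B)"
    by (rule linear_independent_injective_image[OF lin onb_independent[OF B]]) (rule inj_on_subset[OF inj subset_UNIV])
  moreover have "span (?L ` B) = tangent_space A p"
    using linear_span_image[OF lin, of B] B by (simp add: onb_def tangent_space_eq_range[OF A U])
  ultimately have "dim (tangent_space A p) = card (?L ` B)"
    by (metis dim_eq_card_independent dim_span)
  then show ?thesis
    using card_image[OF inj_on_subset[OF inj subset_UNIV]] by metis
qed

subsection \<open>Vector fields\<close>

lemma vector_field_open: "vector_field A W X \<Longrightarrow> open_in A W"
  by (simp add: vector_field_def)

lemma vector_field_tangent: "vector_field A W X \<Longrightarrow> p \<in> W \<Longrightarrow> X p \<in> tangent_space A p"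
  by (simp add: vector_field_def)

lemma vector_field_smooth: "vector_field A W X \<Longrightarrow> smooth_fn A V f \<Longrightarrow> V \<subseteq> W \<Longrightarrow> smooth_fn A V (\<lambda>p. X p f)"
  by (simp add: vector_field_def)

lemma vector_field_smooth_at:
  assumes "vector_field A W X" "smooth_at A p f" "p \<in> W" shows "smooth_at A p (\<lambda>p. X p f)"
  by (metis assms smooth_at_within vector_field_open vector_field_smooth smooth_atI)

lemma vector_field_subset:
  "vector_field A W X \<Longrightarrow> open_in A V \<Longrightarrow> V \<subseteq> W \<Longrightarrow> vector_field A V X"
  unfolding vector_field_def by blast

lemma vector_field_scaleR:
  assumes A: "manifold A" and X: "vector_field A W X" and h: "smooth_fn A W h"
  shows "vector_field A W (\<lambda>p. h p *\<^sub>R X p)"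
  unfolding vector_field_def
proof (intro conjI ballI allI impI)
  show W: "open_in A W" by (rule vector_field_open[OF X])
  show "h p *\<^sub>R X p \<in> tangent_space A p" if "p \<in> W" for p
    using subspace_scale[OF subspace_tangent[OF A] vector_field_tangent[OF X that]] that open_in_subset[OF W] by blast
  show "smooth_fn A V (\<lambda>p. (h p *\<^sub>R X p) f)" if "V \<subseteq> W" "smooth_fn A V f" for V f
    unfolding scaleR_fun_def real_scaleR_def
    by (intro smooth_fn_mult A vector_field_smooth[OF X] smooth_fn_subset[OF h smooth_fn_open[OF that(2)]] that)
qed

text \<open>
  In coordinates \<open>X (Y f)\<close> is the sum of the terms \<open>X(Y\<^sup>b) \<partial>\<^sub>b f\<close> and \<open>X\<^sup>a Y\<^sup>b \<partial>\<^sub>a \<partial>\<^sub>b f\<close>.  The second-order part is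
  symmetric, so it cancels in the bracket, and what is left is a combination of coordinate vectors.
\<close>

lemma lie_bracket_tangent:
  fixes A :: "('p::topological_space, 'e::real_inner) atlas"
  assumes A: "manifold A" and X: "vector_field A W X" and Y: "vector_field A W Y" and p: "p \<in> W"
  shows "lie_bracket A X Y p \<in> tangent_space A p"
proof -
  have pA: "p \<in> points A" using open_in_subset[OF vector_field_open[OF X]] p by blast
  then obtain U \<phi> where U: "(U, \<phi>) \<in> A" "p \<in> U" by (rule points_chartE)
  obtain B :: "'e set" where B: "onb B" using manifold_onb[OF A] by blast
  let ?x = "\<lambda>b x. \<phi> x \<bullet> b" and ?E = "\<lambda>b q. chart_vec A U \<phi> b q"
  let ?O = "U \<inter> W"
  have O: "open_in A ?O" "p \<in> ?O"
    using open_in_Int[OF chart_open_in[OF A U(1)] vector_field_open[OF X]] U p by auto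
  have xs: "smooth_at A p (?x b)" for b using smooth_atI[OF chart_coordinate_smooth[OF A U(1)] U(2)] .
  have XY: "X' p (\<lambda>q. Y' q f) = (\<Sum>b\<in>B. X' p (\<lambda>q. Y' q (?x b)) * ?E b p f) +
      (\<Sum>b\<in>B. \<Sum>a\<in>B. Y' p (?x b) * (X' p (?x a) * ?E a p (\<lambda>q. ?E b q f)))"
    if X': "vector_field A W X'" and Y': "vector_field A W Y'" and f: "smooth_at A p f" for X' Y' f
  proof -
    have sY: "smooth_at A p (\<lambda>q. Y' q (?x b))" for b by (rule vector_field_smooth_at[OF Y' xs p])
    have sE: "smooth_at A p (\<lambda>q. ?E b q f)" for b
      by (rule vector_field_smooth_at[OF chart_vec_vector_field[OF A U(1)] f U(2)])
    have tX: "X' p \<in> tangent_space A p" by (rule vector_field_tangent[OF X' p])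
    have "X' p (\<lambda>q. Y' q f) = X' p (\<lambda>q. \<Sum>b\<in>B. Y' q (?x b) * ?E b q f)"
      by (rule tangent_local[OF A tX O]) (use tangent_expand_apply[OF A U(1) _ vector_field_tangent[OF Y'] B] in blast)
    also have "\<dots> = (\<Sum>b\<in>B. X' p (\<lambda>q. Y' q (?x b) * ?E b q f))"
      using tangent_sum[OF A tX, of B "\<lambda>b q. Y' q (?x b) * ?E b q f"] smooth_at_mult[OF A sY sE] by simp
    also have "\<dots> = (\<Sum>b\<in>B. X' p (\<lambda>q. Y' q (?x b)) * ?E b p f + Y' p (?x b) * X' p (\<lambda>q. ?E b q f))"
      by (simp add: tangent_mult[OF A tX sY sE])
    also have "\<dots> = (\<Sum>b\<in>B. X' p (\<lambda>q. Y' q (?x b)) * ?E b p f +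
        Y' p (?x b) * (\<Sum>a\<in>B. X' p (?x a) * ?E a p (\<lambda>q. ?E b q f)))"
      by (subst tangent_expand_apply[OF A U tX B, of "\<lambda>q. ?E b q f" for b]) simp
    finally show ?thesis by (simp add: sum.distrib sum_distrib_left)
  qed
  let ?c = "\<lambda>b. X p (\<lambda>q. Y q (?x b)) - Y p (\<lambda>q. X q (?x b))"
  have "lie_bracket A X Y p = (\<Sum>b\<in>B. ?c b *\<^sub>R ?E b p)"
  proof
    fix f
    show "lie_bracket A X Y p f = (\<Sum>b\<in>B. ?c b *\<^sub>R ?E b p) f"
    proof (cases "smooth_at A p f")
      case f: True
      have "(\<Sum>b\<in>B. \<Sum>a\<in>B. Y p (?x b) * (X p (?x a) * ?E a p (\<lambda>q. ?E b q f))) =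
          (\<Sum>b\<in>B. \<Sum>a\<in>B. X p (?x b) * (Y p (?x a) * ?E a p (\<lambda>q. ?E b q f)))"
        by (subst sum.swap, intro sum.cong refl, subst chart_vec_commute[OF A U f]) simp
      then show ?thesis
        using f unfolding lie_bracket_def XY[OF X Y f] XY[OF Y X f]
        by (simp add: sum_fun_apply scaleR_fun_def left_diff_distrib sum_subtractf)
    next
      case False
      then show ?thesis
        by (simp add: lie_bracket_def sum_fun_apply scaleR_fun_def chart_vec_def)
    qed
  qed
  also have "\<dots> \<in> tangent_space A p"
    by (intro subspace_sum[OF subspace_tangent[OF A pA]] subspace_scale[OF subspace_tangent[OF A pA]]
        chart_vec_tangent[OF A U])
  finally show ?thesis .
qed

subsection \<open>Differentials\<close>

lemma pushforward_add: "pushforward B F p (v + w) = pushforward B F p v + pushforward B F p w"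
  by (auto simp: pushforward_def fun_eq_iff)

lemma pushforward_scaleR: "pushforward B F p (a *\<^sub>R v) = a *\<^sub>R pushforward B F p v"
  by (auto simp: pushforward_def fun_eq_iff scaleR_fun_def)

lemma pushforward_diff: "pushforward B F p (v - w) = pushforward B F p v - pushforward B F p w"
  by (auto simp: pushforward_def fun_eq_iff)

lemma pushforward_zero [simp]: "pushforward B F p 0 = 0"
  by (auto simp: pushforward_def fun_eq_iff)

lemma pushforward_apply: "smooth_at B (F p) h \<Longrightarrow> pushforward B F p v h = v (\<lambda>x. h (F x))"
  by (simp add: pushforward_def comp_def)

lemma pushforward_velocity:
  assumes "manifold A" "manifold B" "smooth_map A B F" "\<gamma> 0 \<in> points A"
  shows "pushforward B F (\<gamma> 0) (velocity A \<gamma>) = velocity B (\<lambda>t. F (\<gamma> t))"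
  using smooth_at_compose[OF assms] by (auto simp: pushforward_def velocity_def fun_eq_iff comp_def)

lemma pushforward_tangent:
  assumes A: "manifold A" and B: "manifold B" and F: "smooth_map A B F" and v: "v \<in> tangent_space A p"
  shows "pushforward B F p v \<in> tangent_space B (F p)"
proof -
  obtain \<gamma> e where \<gamma>: "e > 0" "smooth_map (open_atlas {-e<..<e::real}) A \<gamma>" "\<gamma> 0 = p" "v = velocity A \<gamma>"
    using v by (rule tangentE)
  have "smooth_map (open_atlas {-e<..<e}) B (\<lambda>t. F (\<gamma> t))"
    by (rule smooth_map_compose[OF manifold_open A B \<gamma>(2) F]) simp
  moreover have "pushforward B F p v = velocity B (\<lambda>t. F (\<gamma> t))"
    using pushforward_velocity[OF A B F, of \<gamma>] tangent_points[OF v] \<gamma> by simp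
  ultimately show ?thesis
    using \<gamma> unfolding tangent_space_def by blast
qed

lemma pushforward_compose:
  assumes "manifold B" "manifold C" "smooth_map B C G" "F p \<in> points B"
  shows "pushforward C G (F p) (pushforward B F p v) = pushforward C (\<lambda>x. G (F x)) p v"
  using smooth_at_compose[OF assms] by (auto simp: pushforward_def fun_eq_iff comp_def)

lemma pushforward_ident: "v \<in> tangent_space A p \<Longrightarrow> pushforward A (\<lambda>x. x) p v = v"
  using tangent_nonsmooth by (fastforce simp: pushforward_def fun_eq_iff comp_def)

lemma pushforward_const:
  assumes "manifold A" "v \<in> tangent_space A p"
  shows "pushforward B (\<lambda>x. q) p v = 0"
  using tangent_const[OF assms] by (simp add: pushforward_def comp_def fun_eq_iff)

context
  fixes A :: "('p::topological_space, 'e::real_inner) atlas"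
    and B :: "('q::topological_space, 'f::real_inner) atlas"
  assumes A: "manifold A" and B: "manifold B"
begin

lemma smooth_map_Pair_left: "q \<in> points B \<Longrightarrow> smooth_map A (prod_atlas A B) (\<lambda>x. (x, q))"
  by (intro smooth_map_Pair A B smooth_map_ident smooth_map_const)

text \<open>
  Every coordinate function of a product chart is a sum of coordinate functions of the two factors.
\<close>

lemma tangent_prod_eqI:
  assumes v: "v \<in> tangent_space (prod_atlas A B) x" and w: "w \<in> tangent_space (prod_atlas A B) x"
    and 1: "pushforward A fst x v = pushforward A fst x w"
    and 2: "pushforward B snd x v = pushforward B snd x w"
  shows "v = w"
proof -
  note P = manifold_prod[OF A B]
  have "x \<in> points (prod_atlas A B)" by (rule tangent_points[OF v])
  then have "fst x \<in> points A" "snd x \<in> points B" by (auto simp: points_prod)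
  then obtain U \<phi> V \<psi> where U: "(U, \<phi>) \<in> A" "fst x \<in> U" and V: "(V, \<psi>) \<in> B" "snd x \<in> V"
    by (meson points_chartE)
  have c: "(U \<times> V, map_prod \<phi> \<psi>) \<in> prod_atlas A B"
    using U V prod_atlas_iff by blast
  have x: "x \<in> U \<times> V" using U V by (auto simp: mem_Times_iff)
  have s1: "smooth_at A (fst x) (\<lambda>y. \<phi> y \<bullet> a)" for a
    using smooth_atI[OF chart_coordinate_smooth[OF A U(1)] U(2)] .
  have s2: "smooth_at B (snd x) (\<lambda>y. \<psi> y \<bullet> b)" for b
    using smooth_atI[OF chart_coordinate_smooth[OF B V(1)] V(2)] .
  have t1: "smooth_at (prod_atlas A B) x (\<lambda>y. \<phi> (fst y) \<bullet> a)" for a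
    using smooth_at_compose[OF P A smooth_map_fst[OF A B] tangent_points[OF v], of "\<lambda>y. \<phi> y \<bullet> a"] s1 by simp
  have t2: "smooth_at (prod_atlas A B) x (\<lambda>y. \<psi> (snd y) \<bullet> b)" for b
    using smooth_at_compose[OF P B smooth_map_snd[OF A B] tangent_points[OF v], of "\<lambda>y. \<psi> y \<bullet> b"] s2 by simp
  have eq: "u (\<lambda>y. map_prod \<phi> \<psi> y \<bullet> (a, b)) =
      pushforward A fst x u (\<lambda>y. \<phi> y \<bullet> a) + pushforward B snd x u (\<lambda>y. \<psi> y \<bullet> b)"
    if u: "u \<in> tangent_space (prod_atlas A B) x" for u a b
    using tangent_add[OF P u t1 t2, of a b] pushforward_apply[where F = fst and p = x, OF s1, of u a]
      pushforward_apply[where F = snd and p = x, OF s2, of u b]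
    by (simp add: map_prod_def case_prod_unfold inner_Pair)
  show ?thesis
  proof (rule tangent_eqI[OF P c x v w])
    fix b show "v (\<lambda>y. map_prod \<phi> \<psi> y \<bullet> b) = w (\<lambda>y. map_prod \<phi> \<psi> y \<bullet> b)"
      using eq[OF v, of "fst b" "snd b"] eq[OF w, of "fst b" "snd b"] 1 2 by simp
  qed
qed

end

lemma tangent_real_chart_eqI:
  fixes \<phi> :: "'p::topological_space \<Rightarrow> real"
  assumes A: "manifold A" and c: "(U, \<phi>) \<in> A" "p \<in> U"
    and v: "v \<in> tangent_space A p" and w: "w \<in> tangent_space A p" and eq: "v \<phi> = w \<phi>"
  shows "v = w"
proof (rule tangent_eqI[OF A c v w])
  have s: "smooth_at A p \<phi>"
    using smooth_atI[OF chart_coordinate_smooth[OF A c(1), of 1] c(2)] by simp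
  fix b show "v (\<lambda>x. \<phi> x \<bullet> b) = w (\<lambda>x. \<phi> x \<bullet> b)"
    using tangent_scale[OF A v s, of b] tangent_scale[OF A w s, of b] eq by (simp add: mult.commute)
qed

section \<open>Tensor fields\<close>

lemma linear_on_add: "linear_on V L \<Longrightarrow> v \<in> V \<Longrightarrow> w \<in> V \<Longrightarrow> L (v + w) = L v + L w"
  unfolding linear_on_def by (metis scaleR_one)

lemma linear_on_scaleR: "linear_on V L \<Longrightarrow> v \<in> V \<Longrightarrow> L (a *\<^sub>R v) = a *\<^sub>R L v"
  unfolding linear_on_def by (metis add.right_neutral scaleR_zero_left)

lemma linear_on_zero: "linear_on V L \<Longrightarrow> v \<in> V \<Longrightarrow> L 0 = 0"
  using linear_on_scaleR[of V L v 0] by simp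

lemma linear_on_sum:
  assumes "subspace V" "linear_on V L" "\<And>i. i \<in> I \<Longrightarrow> f i \<in> V"
  shows "L (\<Sum>i\<in>I. c i *\<^sub>R f i) = (\<Sum>i\<in>I. c i *\<^sub>R L (f i))"
  using assms(3)
proof (induction I rule: infinite_finite_induct)
  case (insert i I)
  have "(\<Sum>i\<in>I. c i *\<^sub>R f i) \<in> V"
    using insert.prems by (intro subspace_sum assms(1) subspace_scale) auto
  then show ?case
    using insert linear_on_add[OF assms(2)] linear_on_scaleR[OF assms(2)] subspace_scale[OF assms(1)] by simp
qed (use linear_on_zero[OF assms(2) subspace_0[OF assms(1)]] in auto)

lemma one_form_linear: "one_form A \<alpha> \<Longrightarrow> p \<in> points A \<Longrightarrow> linear_on (tangent_space A p) (\<alpha> p)"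
  by (simp add: one_form_def)

lemma one_form_smooth: "one_form A \<alpha> \<Longrightarrow> vector_field A W X \<Longrightarrow> smooth_fn A W (\<lambda>p. \<alpha> p (X p))"
  by (simp add: one_form_def)

lemma tensor_bilinear: "smooth_tensor2 A b \<Longrightarrow> p \<in> points A \<Longrightarrow> bilinear_on (tangent_space A p) (b p)"
  by (simp add: smooth_tensor2_def)

lemma tensor_smooth:
  "smooth_tensor2 A b \<Longrightarrow> vector_field A W X \<Longrightarrow> vector_field A W Y \<Longrightarrow> smooth_fn A W (\<lambda>p. b p (X p) (Y p))"
  by (simp add: smooth_tensor2_def)

lemma bilinear_on_left: "bilinear_on V b \<Longrightarrow> v \<in> V \<Longrightarrow> linear_on V (b v)"
  by (simp add: bilinear_on_def)

lemma bilinear_on_right: "bilinear_on V b \<Longrightarrow> v \<in> V \<Longrightarrow> linear_on V (\<lambda>w. b w v)"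
  by (simp add: bilinear_on_def)

lemma vector_field_points: "vector_field A W X \<Longrightarrow> p \<in> W \<Longrightarrow> p \<in> points A"
  using open_in_subset vector_field_open by blast

context
  fixes A :: "('p::topological_space, 'e::real_inner) atlas" and U \<phi> and B :: "'e set"
  assumes A: "manifold A" and chart: "(U, \<phi>) \<in> A" and B: "onb B"
begin

lemma one_form_expand:
  assumes "one_form A \<alpha>" "p \<in> U" "v \<in> tangent_space A p"
  shows "\<alpha> p v = (\<Sum>b\<in>B. v (\<lambda>x. \<phi> x \<bullet> b) * \<alpha> p (chart_vec A U \<phi> b p))"
proof -
  have p: "p \<in> points A" by (rule tangent_points[OF assms(3)])
  show ?thesis
    by (subst tangent_expand[OF A chart assms(2,3) B],
        subst linear_on_sum[OF subspace_tangent[OF A p] one_form_linear[OF assms(1) p]])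
      (simp_all add: chart_vec_tangent[OF A chart assms(2)])
qed

lemma tensor_expand:
  assumes "bilinear_on (tangent_space A p) b" "p \<in> U" "v \<in> tangent_space A p" "w \<in> tangent_space A p"
  shows "b v w = (\<Sum>i\<in>B. \<Sum>j\<in>B. v (\<lambda>x. \<phi> x \<bullet> i) * w (\<lambda>x. \<phi> x \<bullet> j) *
    b (chart_vec A U \<phi> i p) (chart_vec A U \<phi> j p))"
proof -
  have p: "p \<in> points A" by (rule tangent_points[OF assms(3)])
  note s = subspace_tangent[OF A p] and E = chart_vec_tangent[OF A chart assms(2)]
  have 1: "b v w = (\<Sum>i\<in>B. v (\<lambda>x. \<phi> x \<bullet> i) * b (chart_vec A U \<phi> i p) w)"
    by (subst (1) tangent_expand[OF A chart assms(2,3) B],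
        subst linear_on_sum[OF s bilinear_on_right[OF assms(1,4)]]) (simp_all add: E)
  have 2: "b (chart_vec A U \<phi> i p) w = (\<Sum>j\<in>B. w (\<lambda>x. \<phi> x \<bullet> j) * b (chart_vec A U \<phi> i p) (chart_vec A U \<phi> j p))"
    for i
    by (subst (1) tangent_expand[OF A chart assms(2,4) B],
        subst linear_on_sum[OF s bilinear_on_left[OF assms(1) E]]) (simp_all add: E)
  show ?thesis
    unfolding 1 2 by (simp add: sum_distrib_left mult.assoc)
qed

end

text \<open>
  The differential is linear for trivial reasons, since vectors are operators and it acts by precomposition.
\<close>

lemma pullback1_linear:
  assumes "manifold A" "manifold B" "smooth_map A B F" "p \<in> points A"
    and "linear_on (tangent_space B (F p)) (\<alpha> (F p))"
  shows "linear_on (tangent_space A p) (pullback1 B F \<alpha> p)"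
  using assms(5) pushforward_tangent[OF assms(1-3)]
  by (simp add: linear_on_def pullback1_def pushforward_add pushforward_scaleR)

lemma pullback2_bilinear:
  assumes "manifold A" "manifold B" "smooth_map A B F"
    and "bilinear_on (tangent_space B (F p)) (b (F p))"
  shows "bilinear_on (tangent_space A p) (pullback2 B F b p)"
  using assms(4) pushforward_tangent[OF assms(1-3), of _ p]
  by (simp add: bilinear_on_def linear_on_def pullback2_def pushforward_add pushforward_scaleR)

text \<open>Near a point the pullback of a form is a sum of products of smooth functions.\<close>

context
  fixes A :: "('p::topological_space, 'e::real_inner) atlas"
    and B :: "('q::topological_space, 'f::real_inner) atlas"
    and F :: "'p \<Rightarrow> 'q" and V \<psi>
  assumes A: "manifold A" and B: "manifold B" and F: "smooth_map A B F" and chart: "(V, \<psi>) \<in> B"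
begin

lemma pulled_coordinate_smooth: "smooth_fn A {x \<in> points A. F x \<in> V} (\<lambda>x. \<psi> (F x) \<bullet> b)"
  using smooth_fn_pullback[OF A B F chart_coordinate_smooth[OF B chart]] .

lemma pushforward_coordinate:
  "F q \<in> V \<Longrightarrow> pushforward B F q v (\<lambda>x. \<psi> x \<bullet> b) = v (\<lambda>x. \<psi> (F x) \<bullet> b)"
  using pushforward_apply[where B = B and F = F and p = q and v = v and h = "\<lambda>x. \<psi> x \<bullet> b"]
    smooth_atI[OF chart_coordinate_smooth[OF B chart]] by simp

lemma pullback1_expand:
  assumes "one_form B \<alpha>" "onb E" "F q \<in> V" "v \<in> tangent_space A q"
  shows "pullback1 B F \<alpha> q v =
    (\<Sum>b\<in>E. v (\<lambda>x. \<psi> (F x) \<bullet> b) * \<alpha> (F q) (chart_vec B V \<psi> b (F q)))"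
  unfolding pullback1_def
    one_form_expand[OF B chart assms(2,1,3) pushforward_tangent[OF A B F assms(4)]]
    pushforward_coordinate[OF assms(3)] ..

lemma pulled_coefficient_smooth:
  "one_form B \<alpha> \<Longrightarrow> smooth_fn A {x \<in> points A. F x \<in> V} (\<lambda>x. \<alpha> (F x) (chart_vec B V \<psi> b (F x)))"
  using smooth_fn_pullback[OF A B F one_form_smooth[OF _ chart_vec_vector_field[OF B chart]]] .

end

lemma one_form_pullback:
  fixes B :: "('q::topological_space, 'f::real_inner) atlas"
  assumes A: "manifold A" and B: "manifold B" and F: "smooth_map A B F" and \<alpha>: "one_form B \<alpha>"
  shows "one_form A (pullback1 B F \<alpha>)"
  unfolding one_form_def
proof (intro conjI ballI allI impI)
  show "linear_on (tangent_space A p) (pullback1 B F \<alpha> p)" if "p \<in> points A" for p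
    using pullback1_linear[OF A B F that] one_form_linear[OF \<alpha>] smooth_map_points[OF F that] by blast
  fix W X assume X: "vector_field A W X"
  obtain E :: "'f set" where E: "onb E" using manifold_onb[OF B] by blast
  show "smooth_fn A W (\<lambda>p. pullback1 B F \<alpha> p (X p))"
  proof (rule smooth_fn_local[OF A])
    fix p assume p: "p \<in> W"
    obtain V \<psi> where V: "(V, \<psi>) \<in> B" "F p \<in> V"
      using smooth_map_points[OF F vector_field_points[OF X p]] by (rule points_chartE)
    let ?O = "W \<inter> {x \<in> points A. F x \<in> V}"
    have O: "open_in A ?O"
      by (intro open_in_Int vector_field_open[OF X] smooth_map_preimage[OF F chart_open_in[OF B V(1)]])
    note sub = smooth_fn_subset[OF _ O Int_lower2]
    have "smooth_fn A ?O (\<lambda>q. \<Sum>b\<in>E. X q (\<lambda>x. \<psi> (F x) \<bullet> b) * \<alpha> (F q) (chart_vec B V \<psi> b (F q)))"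
      by (intro smooth_fn_sum[OF A O] smooth_fn_mult[OF A] vector_field_smooth[OF X _ Int_lower1]
          sub[OF pulled_coordinate_smooth[OF A B F V(1)]] sub[OF pulled_coefficient_smooth[OF A B F V(1) \<alpha>]])
    then have "smooth_fn A ?O (\<lambda>p. pullback1 B F \<alpha> p (X p))"
      by (rule smooth_fn_cong[OF A])
        (use pullback1_expand[OF A B F V(1) \<alpha> E _ vector_field_tangent[OF X]] in simp)
    then show "\<exists>V. p \<in> V \<and> V \<subseteq> W \<and> smooth_fn A V (\<lambda>p. pullback1 B F \<alpha> p (X p))"
      using p V(2) vector_field_points[OF X p] by (intro exI[of _ ?O]) simp
  qed
qed

lemma smooth_tensor2_pullback:
  fixes B :: "('q::topological_space, 'f::real_inner) atlas"
  assumes A: "manifold A" and B: "manifold B" and F: "smooth_map A B F" and b: "smooth_tensor2 B b"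
  shows "smooth_tensor2 A (pullback2 B F b)"
  unfolding smooth_tensor2_def
proof (intro conjI ballI allI impI)
  show "bilinear_on (tangent_space A p) (pullback2 B F b p)" if "p \<in> points A" for p
    using pullback2_bilinear[OF A B F] tensor_bilinear[OF b] smooth_map_points[OF F that] by blast
  fix W X Y assume X: "vector_field A W X" and Y: "vector_field A W Y"
  obtain E :: "'f set" where E: "onb E" using manifold_onb[OF B] by blast
  show "smooth_fn A W (\<lambda>p. pullback2 B F b p (X p) (Y p))"
  proof (rule smooth_fn_local[OF A])
    fix p assume p: "p \<in> W"
    obtain V \<psi> where V: "(V, \<psi>) \<in> B" "F p \<in> V"
      using smooth_map_points[OF F vector_field_points[OF X p]] by (rule points_chartE)
    let ?O = "W \<inter> {x \<in> points A. F x \<in> V}"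
    have O: "open_in A ?O"
      by (intro open_in_Int vector_field_open[OF X] smooth_map_preimage[OF F chart_open_in[OF B V(1)]])
    note sub = smooth_fn_subset[OF _ O Int_lower2]
    note coef = smooth_fn_pullback[OF A B F tensor_smooth[OF b chart_vec_vector_field[OF B V(1)] chart_vec_vector_field[OF B V(1)]]]
    have "smooth_fn A ?O (\<lambda>q. \<Sum>i\<in>E. \<Sum>j\<in>E. X q (\<lambda>x. \<psi> (F x) \<bullet> i) * Y q (\<lambda>x. \<psi> (F x) \<bullet> j) *
        b (F q) (chart_vec B V \<psi> i (F q)) (chart_vec B V \<psi> j (F q)))"
      by (intro smooth_fn_sum[OF A O] smooth_fn_mult[OF A] vector_field_smooth[OF X _ Int_lower1]
          vector_field_smooth[OF Y _ Int_lower1] sub[OF pulled_coordinate_smooth[OF A B F V(1)]] sub[OF coef])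
    then have "smooth_fn A ?O (\<lambda>p. pullback2 B F b p (X p) (Y p))"
    proof (rule smooth_fn_cong[OF A])
      fix q assume q: "q \<in> ?O"
      note t = pushforward_tangent[OF A B F vector_field_tangent[OF X, of q]]
        pushforward_tangent[OF A B F vector_field_tangent[OF Y, of q]]
      have Fq: "F q \<in> V" using q by simp
      show "pullback2 B F b q (X q) (Y q) = (\<Sum>i\<in>E. \<Sum>j\<in>E. X q (\<lambda>x. \<psi> (F x) \<bullet> i) * Y q (\<lambda>x. \<psi> (F x) \<bullet> j) *
        b (F q) (chart_vec B V \<psi> i (F q)) (chart_vec B V \<psi> j (F q)))"
        unfolding pullback2_def
        by (subst tensor_expand[OF B V(1) E tensor_bilinear[OF b] Fq t])
          (use q smooth_map_points[OF F] pushforward_coordinate[OF A B F V(1) Fq] in simp_all)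
    qed
    then show "\<exists>V. p \<in> V \<and> V \<subseteq> W \<and> smooth_fn A V (\<lambda>p. pullback2 B F b p (X p) (Y p))"
      using p V(2) vector_field_points[OF X p] by (intro exI[of _ ?O]) simp
  qed
qed

lemma smooth_tensor2_cong:
  assumes A: "manifold A" and b: "smooth_tensor2 A b"
    and eq: "\<And>p v w. v \<in> tangent_space A p \<Longrightarrow> w \<in> tangent_space A p \<Longrightarrow> c p v w = b p v w"
  shows "smooth_tensor2 A c"
  unfolding smooth_tensor2_def
proof (intro conjI ballI allI impI)
  fix p assume p: "p \<in> points A"
  show "bilinear_on (tangent_space A p) (c p)"
    using tensor_bilinear[OF b p] subspace_tangent[OF A p] eq
    by (simp add: bilinear_on_def linear_on_def subspace_add subspace_scale)
next
  fix W X Y assume X: "vector_field A W X" and Y: "vector_field A W Y"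
  show "smooth_fn A W (\<lambda>p. c p (X p) (Y p))"
    by (rule smooth_fn_cong[OF A tensor_smooth[OF b X Y]])
      (use eq vector_field_tangent[OF X] vector_field_tangent[OF Y] in blast)
qed

lemma one_form_lincomb:
  assumes A: "manifold A" and h: "smooth_fn A (points A) h" and \<alpha>: "one_form A \<alpha>" and \<beta>: "one_form A \<beta>"
  shows "one_form A (\<lambda>p v. h p * \<alpha> p v + \<beta> p v)"
  unfolding one_form_def
proof (intro conjI ballI allI impI)
  show "linear_on (tangent_space A p) (\<lambda>v. h p * \<alpha> p v + \<beta> p v)" if "p \<in> points A" for p
    using one_form_linear[OF \<alpha> that] one_form_linear[OF \<beta> that] by (simp add: linear_on_def algebra_simps)
  fix W X assume X: "vector_field A W X"
  show "smooth_fn A W (\<lambda>p. h p * \<alpha> p (X p) + \<beta> p (X p))"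
    by (intro smooth_fn_add smooth_fn_mult A one_form_smooth[OF _ X] \<alpha> \<beta>
        smooth_fn_subset[OF h vector_field_open[OF X] open_in_subset[OF vector_field_open[OF X]]])
qed

lemma smooth_tensor2_lincomb:
  assumes A: "manifold A" and h: "smooth_fn A (points A) h" and b: "smooth_tensor2 A b" and c: "smooth_tensor2 A c"
  shows "smooth_tensor2 A (\<lambda>p v w. h p * b p v w + c p v w)"
  unfolding smooth_tensor2_def
proof (intro conjI ballI allI impI)
  show "bilinear_on (tangent_space A p) (\<lambda>v w. h p * b p v w + c p v w)" if "p \<in> points A" for p
    using tensor_bilinear[OF b that] tensor_bilinear[OF c that]
    by (simp add: bilinear_on_def linear_on_def algebra_simps)
  fix W X Y assume X: "vector_field A W X" and Y: "vector_field A W Y"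
  show "smooth_fn A W (\<lambda>p. h p * b p (X p) (Y p) + c p (X p) (Y p))"
    by (intro smooth_fn_add smooth_fn_mult A tensor_smooth[OF _ X Y] b c
        smooth_fn_subset[OF h vector_field_open[OF X] open_in_subset[OF vector_field_open[OF X]]])
qed

lemma smooth_tensor2_product:
  assumes A: "manifold A" and \<alpha>: "one_form A \<alpha>" and \<beta>: "one_form A \<beta>"
  shows "smooth_tensor2 A (\<lambda>p v w. \<alpha> p v * \<beta> p w)"
  unfolding smooth_tensor2_def
proof (intro conjI ballI allI impI)
  show "bilinear_on (tangent_space A p) (\<lambda>v w. \<alpha> p v * \<beta> p w)" if "p \<in> points A" for p
    using one_form_linear[OF \<alpha> that] one_form_linear[OF \<beta> that]
    by (simp add: bilinear_on_def linear_on_def algebra_simps)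
  fix W X Y assume X: "vector_field A W X" and Y: "vector_field A W Y"
  show "smooth_fn A W (\<lambda>p. \<alpha> p (X p) * \<beta> p (Y p))"
    by (intro smooth_fn_mult A one_form_smooth[OF \<alpha> X] one_form_smooth[OF \<beta> Y])
qed

lemma one_form_differential:
  assumes h: "smooth_fn A (points A) h" shows "one_form A (\<lambda>p v. v h)"
  unfolding one_form_def
proof (intro conjI ballI allI impI)
  show "linear_on (tangent_space A p) (\<lambda>v. v h)" for p
    by (simp add: linear_on_def scaleR_fun_def)
  fix W X assume X: "vector_field A W X"
  note W = vector_field_open[OF X]
  show "smooth_fn A W (\<lambda>p. X p h)"
    by (rule vector_field_smooth[OF X smooth_fn_subset[OF h W open_in_subset[OF W]] order_refl])
qed

lemma one_form_zero: "manifold A \<Longrightarrow> one_form A (\<lambda>p v. 0)"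
  by (auto simp: one_form_def linear_on_def intro: smooth_fn_const vector_field_open)

lemma smooth_tensor2_zero: "manifold A \<Longrightarrow> smooth_tensor2 A (\<lambda>p v w. 0)"
  by (auto simp: smooth_tensor2_def bilinear_on_def linear_on_def intro: smooth_fn_const vector_field_open)

subsection \<open>Angle forms\<close>

text \<open>
  The differential of an angle function is globally defined although the function is not: angles
  measured from two base points differ by a locally constant function.
\<close>

definition angle_form :: "('p \<Rightarrow> complex) \<Rightarrow> 'p form1" where
  "angle_form \<theta> = (\<lambda>y v. v (\<lambda>x. Arg (\<theta> x / \<theta> y)))"

lemma Arg_divide_local:
  assumes "norm z0 = 1" "norm z = 1" "z \<noteq> - z0"
  obtains V where "open_in circle_atlas V" "z \<in> V" "\<And>u. u \<in> V \<Longrightarrow> Arg (u / z0) = Arg (z / z0) + Arg (u / z)"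
proof -
  let ?a = "Arg (z / z0)" and ?U = "sphere 0 1 - {- z}"
  have n: "norm (z / z0) = 1" "z / z0 \<noteq> -1"
    using assms by (auto simp: norm_divide divide_eq_eq)
  define d where "d = min (pi - ?a) (?a + pi)"
  have d: "d > 0"
    using Arg_less_pi[OF n] Arg_bounded[of "z / z0"] by (simp add: d_def)
  have c: "(?U, \<lambda>u. Arg (u / z)) \<in> circle_atlas"
    unfolding circle_atlas_iff using assms(2) by blast
  show thesis
  proof (rule that)
    show "open_in circle_atlas {u \<in> ?U. Arg (u / z) \<in> ball 0 d}"
      by (rule chart_preimage_open[OF manifold_circle c]) simp
    show "z \<in> {u \<in> ?U. Arg (u / z) \<in> ball 0 d}"
      using assms(2) d by auto
    fix u assume u: "u \<in> {u \<in> ?U. Arg (u / z) \<in> ball 0 d}"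
    then have "z * cis (Arg (u / z)) = u"
      using circle_chart(2)[OF assms(2) refl refl] by simp
    moreover have "Arg (z / z0 * cis (Arg (u / z))) = ?a + Arg (u / z)"
      by (rule Arg_mult_cis[OF n(1)]) (use u in \<open>auto simp: d_def\<close>)
    ultimately show "Arg (u / z0) = ?a + Arg (u / z)"
      by (metis times_divide_eq_left)
  qed
qed

context
  fixes A :: "('p::topological_space, 'e::real_inner) atlas" and \<theta>
  assumes A: "manifold A" and \<theta>: "smooth_map A circle_atlas \<theta>"
begin

lemma angle_norm: "p \<in> points A \<Longrightarrow> norm (\<theta> p) = 1"
  using smooth_map_points[OF \<theta>] by auto

lemma angle_smooth:
  assumes "y \<in> points A"
  shows "smooth_fn A {x \<in> points A. \<theta> x \<noteq> - \<theta> y} (\<lambda>x. Arg (\<theta> x / \<theta> y))"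
proof -
  have "{x \<in> points A. \<theta> x \<in> sphere 0 1 - {- \<theta> y}} = {x \<in> points A. \<theta> x \<noteq> - \<theta> y}"
    using angle_norm by auto
  then show ?thesis
    using smooth_fn_pullback[OF A manifold_circle \<theta> smooth_fn_Arg[OF angle_norm[OF assms]]] by simp
qed

lemma angle_nonantipodal: "y \<in> points A \<Longrightarrow> \<theta> y \<noteq> - \<theta> y"
proof
  assume "y \<in> points A" "\<theta> y = - \<theta> y"
  then have "2 * \<theta> y = 0" by (metis add.right_inverse mult_2)
  then show False using angle_norm[OF \<open>y \<in> points A\<close>] by auto
qed

lemma angle_smooth_at: "y \<in> points A \<Longrightarrow> smooth_at A y (\<lambda>x. Arg (\<theta> x / \<theta> y))"
  by (rule smooth_atI[OF angle_smooth]) (use angle_nonantipodal in auto)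

text \<open>
  Near \<open>q\<close> the angles measured from \<open>y\<close> and from \<open>q\<close> differ by the constant angle from \<open>y\<close> to \<open>q\<close>.
\<close>

lemma angle_form_base_point:
  assumes y: "y \<in> points A" and q: "q \<in> points A" "\<theta> q \<noteq> - \<theta> y" and v: "v \<in> tangent_space A q"
  shows "angle_form \<theta> q v = v (\<lambda>x. Arg (\<theta> x / \<theta> y))"
proof -
  obtain V where V: "open_in circle_atlas V" "\<theta> q \<in> V"
    "\<And>u. u \<in> V \<Longrightarrow> Arg (u / \<theta> y) = Arg (\<theta> q / \<theta> y) + Arg (u / \<theta> q)"
    using Arg_divide_local[OF angle_norm[OF y] angle_norm[OF q(1)] q(2)] by blast
  have "v (\<lambda>x. Arg (\<theta> x / \<theta> y)) = v (\<lambda>x. Arg (\<theta> q / \<theta> y) + Arg (\<theta> x / \<theta> q))"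
    by (rule tangent_local[OF A v smooth_map_preimage[OF \<theta> V(1)]]) (use V(2) q(1) in simp, use V(3) in blast)
  then show ?thesis
    using tangent_add[OF A v smooth_at_const[OF A q(1)] angle_smooth_at[OF q(1)]] tangent_const[OF A v]
    by (simp add: angle_form_def)
qed

lemma one_form_angle: "one_form A (angle_form \<theta>)"
  unfolding one_form_def
proof (intro conjI ballI allI impI)
  show "linear_on (tangent_space A p) (angle_form \<theta> p)" for p
    by (simp add: linear_on_def angle_form_def scaleR_fun_def)
  fix W X assume X: "vector_field A W X"
  show "smooth_fn A W (\<lambda>p. angle_form \<theta> p (X p))"
  proof (rule smooth_fn_local[OF A])
    fix p assume p: "p \<in> W"
    note pA = vector_field_points[OF X p]
    let ?O = "W \<inter> {x \<in> points A. \<theta> x \<noteq> - \<theta> p}"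
    have O: "open_in A ?O"
      by (intro open_in_Int vector_field_open[OF X] smooth_fn_open[OF angle_smooth[OF pA]])
    have "smooth_fn A ?O (\<lambda>q. X q (\<lambda>x. Arg (\<theta> x / \<theta> p)))"
      by (rule vector_field_smooth[OF X smooth_fn_subset[OF angle_smooth[OF pA] O Int_lower2] Int_lower1])
    then have "smooth_fn A ?O (\<lambda>p. angle_form \<theta> p (X p))"
      by (rule smooth_fn_cong[OF A]) (use angle_form_base_point[OF pA _ _ vector_field_tangent[OF X]] in auto)
    then show "\<exists>V. p \<in> V \<and> V \<subseteq> W \<and> smooth_fn A V (\<lambda>p. angle_form \<theta> p (X p))"
      using p pA angle_nonantipodal[OF pA] by (intro exI[of _ ?O]) simp
  qed
qed

end

lemma angle_form_pushforward:
  assumes "manifold B" "smooth_map B circle_atlas \<theta>" "F p \<in> points B"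
  shows "angle_form \<theta> (F p) (pushforward B F p v) = angle_form (\<lambda>x. \<theta> (F x)) p v"
  unfolding angle_form_def using pushforward_apply[where B = B and F = F and p = p and v = v, OF angle_smooth_at[OF assms]] by simp

subsection \<open>Exterior derivatives\<close>

lemma is_ext_derivD:
  "is_ext_deriv A \<alpha> \<beta> \<Longrightarrow> vector_field A W X \<Longrightarrow> vector_field A W Y \<Longrightarrow> p \<in> W \<Longrightarrow>
    \<beta> p (X p) (Y p) = X p (\<lambda>q. \<alpha> q (Y q)) - Y p (\<lambda>q. \<alpha> q (X q)) - \<alpha> p (lie_bracket A X Y p)"
  unfolding is_ext_deriv_def by blast

text \<open>
  Near \<open>p\<close> the angle form is the differential of the angle measured from \<open>p\<close>, so what remains is the
  definition of the bracket evaluated on that function.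
\<close>

lemma ext_deriv_angle:
  assumes A: "manifold A" and \<theta>: "smooth_map A circle_atlas \<theta>"
  shows "is_ext_deriv A (angle_form \<theta>) (\<lambda>p v w. 0)"
  unfolding is_ext_deriv_def
proof (intro conjI allI impI ballI smooth_tensor2_zero A)
  fix W X Y p assume X: "vector_field A W X" and Y: "vector_field A W Y" and p: "p \<in> W"
  note pA = vector_field_points[OF X p]
  let ?h = "\<lambda>x. Arg (\<theta> x / \<theta> p)"
  let ?O = "W \<inter> {x \<in> points A. \<theta> x \<noteq> - \<theta> p}"
  have O: "open_in A ?O" "p \<in> ?O"
    using open_in_Int[OF vector_field_open[OF X] smooth_fn_open[OF angle_smooth[OF A \<theta> pA]]]
      p pA angle_nonantipodal[OF A \<theta> pA] by auto
  have *: "X' p (\<lambda>q. angle_form \<theta> q (Y' q)) = X' p (\<lambda>q. Y' q ?h)"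
    if X': "vector_field A W X'" and Y': "vector_field A W Y'" for X' Y'
    by (rule tangent_local[OF A vector_field_tangent[OF X' p] O])
      (use angle_form_base_point[OF A \<theta> pA _ _ vector_field_tangent[OF Y']] in auto)
  then show "0 = X p (\<lambda>q. angle_form \<theta> q (Y q)) - Y p (\<lambda>q. angle_form \<theta> q (X q)) -
      angle_form \<theta> p (lie_bracket A X Y p)"
    unfolding *[OF X Y] *[OF Y X] using angle_smooth_at[OF A \<theta> pA]
    by (simp add: angle_form_def lie_bracket_def)
qed

lemma ext_deriv_lincomb:
  assumes A: "manifold A" and \<alpha>: "one_form A \<alpha>" "is_ext_deriv A \<alpha> d\<alpha>"
    and \<beta>: "one_form A \<beta>" "is_ext_deriv A \<beta> d\<beta>"
  shows "is_ext_deriv A (\<lambda>p v. c * \<alpha> p v + \<beta> p v) (\<lambda>p v w. c * d\<alpha> p v w + d\<beta> p v w)"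
  unfolding is_ext_deriv_def
proof (intro conjI allI impI ballI)
  show "smooth_tensor2 A (\<lambda>p v w. c * d\<alpha> p v w + d\<beta> p v w)"
    using \<alpha>(2) \<beta>(2) by (intro smooth_tensor2_lincomb A smooth_fn_const open_in_points) (simp_all add: is_ext_deriv_def)
  fix W X Y p assume X: "vector_field A W X" and Y: "vector_field A W Y" and p: "p \<in> W"
  have *: "X' p (\<lambda>q. c * \<alpha> q (Y' q) + \<beta> q (Y' q)) = c * X' p (\<lambda>q. \<alpha> q (Y' q)) + X' p (\<lambda>q. \<beta> q (Y' q))"
    if X': "vector_field A W X'" and Y': "vector_field A W Y'" for X' Y'
  proof -
    note t = vector_field_tangent[OF X' p]
    note a = smooth_atI[OF one_form_smooth[OF \<alpha>(1) Y'] p] and b = smooth_atI[OF one_form_smooth[OF \<beta>(1) Y'] p]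
    show ?thesis
      using tangent_add[OF A t smooth_at_mult[OF A smooth_at_const[OF A vector_field_points[OF X p], of c] a] b]
        tangent_scale[OF A t a, of c] by simp
  qed
  then show "c * d\<alpha> p (X p) (Y p) + d\<beta> p (X p) (Y p) =
      X p (\<lambda>q. c * \<alpha> q (Y q) + \<beta> q (Y q)) - Y p (\<lambda>q. c * \<alpha> q (X q) + \<beta> q (X q)) -
      (c * \<alpha> p (lie_bracket A X Y p) + \<beta> p (lie_bracket A X Y p))"
    unfolding *[OF X Y] *[OF Y X] is_ext_derivD[OF \<alpha>(2) X Y p] is_ext_derivD[OF \<beta>(2) X Y p] by (simp add: algebra_simps)
qed

text \<open>
  Coordinate fields commute, so on them \<open>\<beta>\<close> has the components \<open>\<partial>\<^sub>i a\<^sub>j - \<partial>\<^sub>j a\<^sub>i\<close>: locally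
  \<open>\<alpha> = \<Sum> a\<^sub>b dx\<^sub>b\<close> and \<open>\<beta> = \<Sum> da\<^sub>b \<and> dx\<^sub>b\<close>.
\<close>

lemma ext_deriv_expand:
  fixes A :: "('p::topological_space, 'e::real_inner) atlas"
  assumes A: "manifold A" "(U, \<phi>) \<in> A" and B: "onb (B :: 'e set)" and \<alpha>: "one_form A \<alpha>" "is_ext_deriv A \<alpha> \<beta>"
    and p: "p \<in> U" and v: "v \<in> tangent_space A p" and w: "w \<in> tangent_space A p"
  defines "a \<equiv> \<lambda>b p. \<alpha> p (chart_vec A U \<phi> b p)" and "x \<equiv> \<lambda>b p. \<phi> p \<bullet> b"
  shows "\<beta> p v w = (\<Sum>b\<in>B. v (a b) * w (x b) - w (a b) * v (x b))"
proof -
  have pA: "p \<in> points A" by (rule tangent_points[OF v])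
  let ?E = "\<lambda>b. chart_vec A U \<phi> b"
  note E = chart_vec_vector_field[OF A]
  have "lie_bracket A (?E i) (?E j) p = 0" for i j
    using chart_vec_commute[OF A p] by (auto simp: lie_bracket_def fun_eq_iff)
  then have "\<beta> p (?E i p) (?E j p) = ?E i p (a j) - ?E j p (a i)" for i j
    using is_ext_derivD[OF \<alpha>(2) E E p, of i j] linear_on_zero[OF one_form_linear[OF \<alpha>(1) pA] v]
    by (simp add: a_def)
  then have "\<beta> p v w = (\<Sum>i\<in>B. \<Sum>j\<in>B. v (x i) * w (x j) * (?E i p (a j) - ?E j p (a i)))"
    using tensor_expand[OF A B tensor_bilinear[OF _ pA] p v w, of \<beta>] \<alpha>(2)
    by (simp add: is_ext_deriv_def x_def)
  also have "\<dots> = (\<Sum>i\<in>B. \<Sum>j\<in>B. v (x i) * w (x j) * ?E i p (a j)) - (\<Sum>i\<in>B. \<Sum>j\<in>B. v (x i) * w (x j) * ?E j p (a i))"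
    by (simp add: right_diff_distrib sum_subtractf)
  also have "(\<Sum>i\<in>B. \<Sum>j\<in>B. v (x i) * w (x j) * ?E i p (a j)) = (\<Sum>j\<in>B. v (a j) * w (x j))"
    by (subst sum.swap, subst tangent_expand_apply[OF A p v B])
      (simp add: x_def sum_distrib_left sum_distrib_right ac_simps)
  also have "(\<Sum>i\<in>B. \<Sum>j\<in>B. v (x i) * w (x j) * ?E j p (a i)) = (\<Sum>i\<in>B. w (a i) * v (x i))"
    by (subst tangent_expand_apply[OF A p w B]) (simp add: x_def sum_distrib_left sum_distrib_right ac_simps)
  finally show ?thesis by (simp add: sum_subtractf)
qed

text \<open>
  The pulled back form is \<open>\<Sum> (a\<^sub>b \<circ> F) d(x\<^sub>b \<circ> F)\<close>.  The Leibniz rule and the definition of the bracket on the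
  functions \<open>x\<^sub>b \<circ> F\<close> leave the terms \<open>d(a\<^sub>b \<circ> F) \<and> d(x\<^sub>b \<circ> F)\<close>.
\<close>

lemma ext_deriv_pullback:
  fixes B :: "('q::topological_space, 'f::real_inner) atlas"
  assumes A: "manifold A" and B: "manifold B" and F: "smooth_map A B F"
    and \<alpha>: "one_form B \<alpha>" "is_ext_deriv B \<alpha> \<beta>"
  shows "is_ext_deriv A (pullback1 B F \<alpha>) (pullback2 B F \<beta>)"
  unfolding is_ext_deriv_def
proof (intro conjI allI impI ballI)
  show "smooth_tensor2 A (pullback2 B F \<beta>)"
    using \<alpha>(2) by (intro smooth_tensor2_pullback A B F) (simp add: is_ext_deriv_def)
  fix W X Y p assume X: "vector_field A W X" and Y: "vector_field A W Y" and p: "p \<in> W"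
  note pA = vector_field_points[OF X p]
  obtain E :: "'f set" where E: "onb E" using manifold_onb[OF B] by blast
  obtain V \<psi> where V: "(V, \<psi>) \<in> B" "F p \<in> V"
    using smooth_map_points[OF F pA] by (rule points_chartE)
  let ?O = "W \<inter> {x \<in> points A. F x \<in> V}"
  have O: "open_in A ?O" "p \<in> ?O"
    using open_in_Int[OF vector_field_open[OF X] smooth_map_preimage[OF F chart_open_in[OF B V(1)]]] p pA V by auto
  define a where "a = (\<lambda>b p. \<alpha> p (chart_vec B V \<psi> b p))"
  define x where "x = (\<lambda>b p. \<psi> p \<bullet> b)"
  have sa: "smooth_at A p (\<lambda>q. a b (F q))" for b
    unfolding a_def using smooth_atI[OF pulled_coefficient_smooth[OF A B F V(1) \<alpha>(1)], of p b] O(2) by simp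
  have sx: "smooth_at A p (\<lambda>q. x b (F q))" for b
    unfolding x_def using smooth_atI[OF pulled_coordinate_smooth[OF A B F V(1)], of p b] O(2) by simp
  have D: "X' p (\<lambda>q. pullback1 B F \<alpha> q (Y' q)) =
      (\<Sum>b\<in>E. X' p (\<lambda>q. Y' q (\<lambda>r. x b (F r))) * a b (F p) + Y' p (\<lambda>r. x b (F r)) * X' p (\<lambda>q. a b (F q)))"
    if X': "vector_field A W X'" and Y': "vector_field A W Y'" for X' Y'
  proof -
    note t = vector_field_tangent[OF X' p]
    have s: "smooth_at A p (\<lambda>q. Y' q (\<lambda>r. x b (F r)))" for b
      by (rule vector_field_smooth_at[OF Y' sx p])
    have "X' p (\<lambda>q. pullback1 B F \<alpha> q (Y' q)) = X' p (\<lambda>q. \<Sum>b\<in>E. Y' q (\<lambda>r. x b (F r)) * a b (F q))"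
      unfolding x_def a_def
      by (rule tangent_local[OF A t O]) (use pullback1_expand[OF A B F V(1) \<alpha>(1) E _ vector_field_tangent[OF Y']] in simp)
    also have "\<dots> = (\<Sum>b\<in>E. X' p (\<lambda>q. Y' q (\<lambda>r. x b (F r)) * a b (F q)))"
      using tangent_sum[OF A t, of E "\<lambda>b q. Y' q (\<lambda>r. x b (F r)) * a b (F q)"] smooth_at_mult[OF A s sa] by simp
    finally show ?thesis by (simp add: tangent_mult[OF A t s sa])
  qed
  have "pullback1 B F \<alpha> p (lie_bracket A X Y p) =
      (\<Sum>b\<in>E. lie_bracket A X Y p (\<lambda>r. x b (F r)) * a b (F p))"
    unfolding x_def a_def using pullback1_expand[OF A B F V(1) \<alpha>(1) E V(2) lie_bracket_tangent[OF A X Y p]] .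
  also have "\<dots> = (\<Sum>b\<in>E. (X p (\<lambda>q. Y q (\<lambda>r. x b (F r))) - Y p (\<lambda>q. X q (\<lambda>r. x b (F r)))) * a b (F p))"
    using sx by (simp add: lie_bracket_def)
  finally have L: "pullback1 B F \<alpha> p (lie_bracket A X Y p) = \<dots>" .
  note t = vector_field_tangent[OF X p] vector_field_tangent[OF Y p]
  have push: "pushforward B F p v (a b) = v (\<lambda>q. a b (F q))" "pushforward B F p v (x b) = v (\<lambda>q. x b (F q))" for v b
    using pushforward_coordinate[OF A B F V, of v b]
      pushforward_apply[where B = B and F = F and p = p and v = v and h = "a b"]
      smooth_atI[OF one_form_smooth[OF \<alpha>(1) chart_vec_vector_field[OF B V(1)]] V(2)]
    by (simp_all add: a_def x_def)
  have "pullback2 B F \<beta> p (X p) (Y p) = (\<Sum>b\<in>E. pushforward B F p (X p) (a b) * pushforward B F p (Y p) (x b) -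
      pushforward B F p (Y p) (a b) * pushforward B F p (X p) (x b))"
    unfolding a_def x_def pullback2_def
    by (rule ext_deriv_expand[OF B V(1) E \<alpha> V(2) pushforward_tangent[OF A B F t(1)] pushforward_tangent[OF A B F t(2)]])
  also have "\<dots> = (\<Sum>b\<in>E. X p (\<lambda>q. a b (F q)) * Y p (\<lambda>q. x b (F q)) -
      Y p (\<lambda>q. a b (F q)) * X p (\<lambda>q. x b (F q)))"
    unfolding push ..
  finally have "pullback2 B F \<beta> p (X p) (Y p) = \<dots>" .
  then show "pullback2 B F \<beta> p (X p) (Y p) = X p (\<lambda>q. pullback1 B F \<alpha> q (Y q)) -
      Y p (\<lambda>q. pullback1 B F \<alpha> q (X q)) - pullback1 B F \<alpha> p (lie_bracket A X Y p)"
    unfolding L D[OF X Y] D[OF Y X] by (simp add: sum_subtractf[symmetric] sum.distrib[symmetric] algebra_simps)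
qed

subsection \<open>Signatures\<close>

text \<open>
  Pairing a vanishing linear combination with one of the vectors isolates its coefficient.
\<close>

lemma orthogonal_independent:
  assumes V: "subspace V" and b: "bilinear_on V b" and B: "finite B" "B \<subseteq> V"
    and orth: "\<And>v w. v \<in> B \<Longrightarrow> w \<in> B \<Longrightarrow> v \<noteq> w \<Longrightarrow> b v w = 0" and null: "\<And>v. v \<in> B \<Longrightarrow> b v v \<noteq> 0"
  shows "independent B"
  unfolding independent_explicit_finite_subsets
proof (intro allI impI ballI)
  fix S c v assume S: "S \<subseteq> B" "finite S" and 0: "(\<Sum>u\<in>S. c u *\<^sub>R u) = 0" and v: "v \<in> S"
  have "b v (\<Sum>u\<in>S. c u *\<^sub>R u) = (\<Sum>u\<in>S. c u *\<^sub>R b v u)"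
    using S B v by (intro linear_on_sum[OF V bilinear_on_left[OF b]]) auto
  also have "\<dots> = (\<Sum>u\<in>S. if u = v then c v * b v v else 0)"
    using S v orth by (intro sum.cong) auto
  also have "\<dots> = c v * b v v" using S v by simp
  finally have "c v * b v v = b v 0" by (simp add: 0)
  also have "\<dots> = 0"
    using S B v by (intro linear_on_zero[OF bilinear_on_left[OF b], of v v]) auto
  finally show "c v = 0" using null v S by auto
qed

lemma has_signature_nondegenerate:
  assumes V: "subspace V" and s: "has_signature V b m n" and v: "v \<in> V" and 0: "\<And>w. w \<in> V \<Longrightarrow> b v w = 0"
  shows "v = 0"
proof -
  obtain Pos Neg where fin: "finite Pos" "finite Neg" and B2: "span (Pos \<union> Neg) = V"
    and orth0: "\<forall>v\<in>Pos \<union> Neg. \<forall>w\<in>Pos \<union> Neg. v \<noteq> w \<longrightarrow> b v w = 0"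
    and sgn: "\<forall>v\<in>Pos. b v v > 0" "\<forall>v\<in>Neg. b v v < 0"
    using s unfolding has_signature_def by (elim exE conjE) (rule that)
  have b: "bilinear_on V b" using s by (simp add: has_signature_def)
  have B: "finite (Pos \<union> Neg)" "span (Pos \<union> Neg) = V" using fin B2 by auto
  have orth: "b v w = 0" if "v \<in> Pos \<union> Neg" "w \<in> Pos \<union> Neg" "v \<noteq> w" for v w
    using orth0 that by blast
  let ?B = "Pos \<union> Neg"
  have sub: "?B \<subseteq> V" using span_superset[of ?B] unfolding B(2) .
  obtain c where c: "v = (\<Sum>u\<in>?B. c u *\<^sub>R u)"
    using v span_finite[OF B(1)] unfolding B(2) by auto
  have "c w = 0" if w: "w \<in> ?B" for w
  proof -
    have "b v w = (\<Sum>u\<in>?B. c u *\<^sub>R b u w)"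
      unfolding c by (rule linear_on_sum[OF V bilinear_on_right[OF b]]) (use w sub in auto)
    also have "\<dots> = (\<Sum>u\<in>?B. if u = w then c w * b w w else 0)"
      using w orth by (intro sum.cong) auto
    also have "\<dots> = c w * b w w" using w B(1) by simp
    finally have "c w * b w w = 0" using 0 w sub by auto
    moreover have "b w w \<noteq> 0" using sgn w by (metis UnE less_irrefl)
    ultimately show ?thesis by simp
  qed
  then show ?thesis unfolding c by (simp add: sum.neutral)
qed

text \<open>
  \<open>V\<close> is the orthogonal sum of a copy of \<open>W\<close>, rescaled by a positive factor, and of the definite plane spanned
  by \<open>e1\<close> and \<open>e2\<close>; these two vectors complete the image of a diagonalizing basis of \<open>W\<close> to one of \<open>V\<close>.
\<close>

lemma has_signature_extend:
  assumes V: "subspace V" and b: "bilinear_on V b" and sym: "\<And>v w. v \<in> V \<Longrightarrow> w \<in> V \<Longrightarrow> b v w = b w v"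
    and W: "subspace W" "has_signature W d m n"
    and L: "linear_on W L" "\<And>u. u \<in> W \<Longrightarrow> L u \<in> V"
    and s: "s > 0" "\<And>u u'. u \<in> W \<Longrightarrow> u' \<in> W \<Longrightarrow> b (L u) (L u') = s * d u u'"
    and e: "e1 \<in> V" "e2 \<in> V" "b e1 e2 = 0" "\<And>u. u \<in> W \<Longrightarrow> b e1 (L u) = 0" "\<And>u. u \<in> W \<Longrightarrow> b e2 (L u) = 0"
    and split: "\<And>v. v \<in> V \<Longrightarrow> \<exists>u\<in>W. \<exists>x y. v = L u + x *\<^sub>R e1 + y *\<^sub>R e2"
  shows "b e1 e1 > 0 \<Longrightarrow> b e2 e2 > 0 \<Longrightarrow> has_signature V b (m + 2) n"
    and "b e1 e1 < 0 \<Longrightarrow> b e2 e2 < 0 \<Longrightarrow> has_signature V b m (n + 2)"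
proof -
  obtain Pos Neg where PN: "finite Pos" "finite Neg" "Pos \<inter> Neg = {}" "card Pos = m" "card Neg = n"
    and span: "span (Pos \<union> Neg) = W"
    and orth0: "\<forall>v\<in>Pos \<union> Neg. \<forall>w\<in>Pos \<union> Neg. v \<noteq> w \<longrightarrow> d v w = 0"
    and sgn0: "\<forall>v\<in>Pos. d v v > 0" "\<forall>v\<in>Neg. d v v < 0"
    using W(2) unfolding has_signature_def by (elim exE conjE) (rule that)
  have orth: "d v w = 0" if "v \<in> Pos \<union> Neg" "w \<in> Pos \<union> Neg" "v \<noteq> w" for v w
    using orth0 that by blast
  have sgn: "d v v > 0" if "v \<in> Pos" for v using sgn0(1) that by blast
  have sgn_neg: "d v v < 0" if "v \<in> Neg" for v using sgn0(2) that by blast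
  let ?B = "Pos \<union> Neg"
  have sub: "?B \<subseteq> W" using span_superset[of ?B] unfolding span .
  have inW: "u \<in> W" if "u \<in> ?B" for u using sub that by blast
  have norm: "b (L u) (L u) \<noteq> 0" if "u \<in> ?B" for u
  proof -
    have "d u u \<noteq> 0" using that by (metis UnE sgn sgn_neg less_irrefl)
    then show ?thesis using s(1) s(2)[OF inW[OF that] inW[OF that]] by simp
  qed
  have inj: "inj_on L ?B"
  proof (rule inj_onI)
    fix u u' assume u: "u \<in> ?B" "u' \<in> ?B" "L u = L u'"
    show "u = u'"
    proof (rule ccontr)
      assume "u \<noteq> u'"
      then have "b (L u) (L u') = 0"
        using s(2)[OF inW[OF u(1)] inW[OF u(2)]] orth[OF u(1,2)] by simp
      then show False using norm[OF u(1)] unfolding u(3) by simp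
    qed
  qed
  have disj: "L ` Pos \<inter> L ` Neg = {}"
    using inj PN(3) by (metis image_empty inf_sup_ord(3,4) inj_on_image_Int)
  have card: "card (L ` Pos) = m" "card (L ` Neg) = n"
    using PN card_image[OF inj_on_subset[OF inj]] by auto
  have nz: "e1 \<noteq> e2 \<and> e1 \<notin> L ` ?B \<and> e2 \<notin> L ` ?B" if "b e1 e1 \<noteq> 0" "b e2 e2 \<noteq> 0"
    using that e inW by (metis imageE)
  have span': "span (L ` ?B \<union> {e1, e2}) = V"
  proof
    show "span (L ` ?B \<union> {e1, e2}) \<subseteq> V"
      by (rule span_minimal[OF _ V]) (use L(2) inW e in auto)
    show "V \<subseteq> span (L ` ?B \<union> {e1, e2})"
    proof
      fix v assume "v \<in> V"
      then obtain u x y where u: "u \<in> W" "v = L u + x *\<^sub>R e1 + y *\<^sub>R e2" using split by blast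
      obtain c where c: "u = (\<Sum>i\<in>?B. c i *\<^sub>R i)"
        using u(1) span_finite[of ?B] PN(1,2) unfolding span by auto
      have "L u = (\<Sum>i\<in>?B. c i *\<^sub>R L i)"
        unfolding c by (rule linear_on_sum[OF W(1) L(1) inW])
      then show "v \<in> span (L ` ?B \<union> {e1, e2})"
        unfolding u(2) by (simp only:) (intro span_add span_sum span_scale span_base; blast)
    qed
  qed
  have orth': "b v w = 0" if "v \<in> L ` ?B \<union> {e1, e2}" "w \<in> L ` ?B \<union> {e1, e2}" "v \<noteq> w" for v w
  proof -
    have *: "b (L u) (L u') = 0" if "u \<in> ?B" "u' \<in> ?B" "L u \<noteq> L u'" for u u'
      using that s(2)[OF inW inW] orth by (metis mult_zero_right)
    have **: "b (L u) e1 = 0" "b (L u) e2 = 0" "b e2 e1 = 0" if "u \<in> ?B" for u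
      using sym e L(2) inW[OF that] by metis+
    have "b e2 e1 = 0" using sym e by metis
    then show ?thesis using that * ** e inW by blast
  qed
  have sgn': "v \<in> Pos \<Longrightarrow> b (L v) (L v) > 0" "v \<in> Neg \<Longrightarrow> b (L v) (L v) < 0" for v
    using s sgn[of v] sgn_neg[of v] inW[of v] by (simp_all add: mult_pos_neg)
  have main: "has_signature V b (card Pos') (card Neg')"
    if "finite Pos'" "finite Neg'" "Pos' \<inter> Neg' = {}" "Pos' \<union> Neg' = L ` ?B \<union> {e1, e2}"
      "\<And>v. v \<in> Pos' \<Longrightarrow> b v v > 0" "\<And>v. v \<in> Neg' \<Longrightarrow> b v v < 0" for Pos' Neg'
  proof -
    have "independent (Pos' \<union> Neg')"
    proof (rule orthogonal_independent[OF V b])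
      show "Pos' \<union> Neg' \<subseteq> V" unfolding that(4) using span_superset[of "L ` ?B \<union> {e1, e2}"] unfolding span' .
      show "b v v \<noteq> 0" if "v \<in> Pos' \<union> Neg'" for v using that \<open>\<And>v. v \<in> Pos' \<Longrightarrow> b v v > 0\<close> \<open>\<And>v. v \<in> Neg' \<Longrightarrow> b v v < 0\<close> by force
      show "finite (Pos' \<union> Neg')" using that(1,2) by simp
      show "b v w = 0" if "v \<in> Pos' \<union> Neg'" "w \<in> Pos' \<union> Neg'" "v \<noteq> w" for v w
        using that orth' unfolding \<open>Pos' \<union> Neg' = L ` ?B \<union> {e1, e2}\<close> by metis
    qed
    then show ?thesis
      unfolding has_signature_def using that b sym orth' span' by (intro conjI exI[of _ Pos'] exI[of _ Neg']) auto
  qed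
  show "has_signature V b (m + 2) n" if pos: "b e1 e1 > 0" "b e2 e2 > 0"
  proof -
    have nz': "e1 \<noteq> e2" "e1 \<notin> L ` ?B" "e2 \<notin> L ` ?B" using nz pos by auto
    have "has_signature V b (card (L ` Pos \<union> {e1, e2})) (card (L ` Neg))"
      by (rule main) (use PN(1,2) disj nz' sgn' pos in auto)
    moreover have "card (L ` Pos \<union> {e1, e2}) = m + 2"
      using PN(1) nz' card(1) by (subst card_Un_disjoint) auto
    ultimately show ?thesis using card(2) by simp
  qed
  show "has_signature V b m (n + 2)" if neg: "b e1 e1 < 0" "b e2 e2 < 0"
  proof -
    have nz': "e1 \<noteq> e2" "e1 \<notin> L ` ?B" "e2 \<notin> L ` ?B" using nz neg by auto
    have "has_signature V b (card (L ` Pos)) (card (L ` Neg \<union> {e1, e2}))"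
      by (rule main) (use PN(1,2) disj nz' sgn' neg in auto)
    moreover have "card (L ` Neg \<union> {e1, e2}) = n + 2"
      using PN(2) nz' card(2) by (subst card_Un_disjoint) auto
    ultimately show ?thesis using card(1) by simp
  qed
qed

section \<open>The Euler field and the Killing field of a cone\<close>

lemma linear_on_diff: "linear_on V L \<Longrightarrow> v \<in> V \<Longrightarrow> w \<in> V \<Longrightarrow> L (v - w) = L v - L w"
  unfolding linear_on_def using scaleR_one scaleR_minus1_left by (metis add_uminus_conv_diff)

locale kaehler_cone =
  fixes lam :: real and S :: "('p::topological_space, 'e::real_inner) atlas" and gS :: "'p tensor2"
    and J :: "(real \<times> 'p) endo" and D :: "(real \<times> 'p) connection"
  assumes cone: "pseudo_kaehler_cone lam S gS J D"
begin

abbreviation "M \<equiv> cone_atlas S"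
abbreviation "g \<equiv> cone_metric lam S gS"
abbreviation "\<xi> \<equiv> euler S"
abbreviation "Z \<equiv> \<lambda>p. 2 *\<^sub>R J p (\<xi> p)"
abbreviation "T \<equiv> tangent_space M"

lemma conical: "conical_pseudo_kaehler lam M J g D \<xi>"
  using cone by (simp add: pseudo_kaehler_cone_def)

lemma lam_cases: "lam = 1 \<or> lam = -1"
  using conical by (auto simp: conical_pseudo_kaehler_def)

lemma lam_square [simp]: "lam * lam = 1" "lam\<^sup>2 = 1"
  using lam_cases by auto

lemma lam_square_left [simp]: "lam * (lam * x) = x"
  using lam_cases by auto

lemma kaehler: "pseudo_kaehler M J g D"
  using conical by (simp add: conical_pseudo_kaehler_def)

lemma manifold_S: "manifold S"
  using cone by (simp add: pseudo_kaehler_cone_def pseudo_riemannian_def)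

lemma tensor_gS: "smooth_tensor2 S gS"
  using cone by (simp add: pseudo_kaehler_cone_def pseudo_riemannian_def)

lemma gS_symmetric: "v \<in> tangent_space S q \<Longrightarrow> w \<in> tangent_space S q \<Longrightarrow> gS q v w = gS q w v"
  using cone tangent_points[of v S q] by (simp add: pseudo_kaehler_cone_def pseudo_riemannian_def)

lemma manifold_M: "manifold M"
  using kaehler by (simp add: pseudo_kaehler_def pseudo_riemannian_def)

lemma points_M: "points M = {0<..} \<times> points S"
  by (simp add: cone_atlas_def points_prod)

lemma smooth_map_radius: "smooth_map M (open_atlas {0<..}) fst"
  and smooth_map_base: "smooth_map M S snd"
  unfolding cone_atlas_def
  by (rule smooth_map_fst smooth_map_snd; simp add: manifold_open manifold_S)+

lemma smooth_fn_radius: "smooth_fn M (points M) fst"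
  using smooth_map_radius smooth_map_open_iff[OF manifold_M, of "{0<..}" fst] by simp

lemma radius_smooth_at: "p \<in> points M \<Longrightarrow> smooth_at M p fst"
  by (rule smooth_atI[OF smooth_fn_radius])

lemma tensor_g: "smooth_tensor2 M g"
  using kaehler by (simp add: pseudo_kaehler_def pseudo_riemannian_def)

lemma g_symmetric: "v \<in> T p \<Longrightarrow> w \<in> T p \<Longrightarrow> g p v w = g p w v"
  using kaehler tangent_points[of v M p] by (simp add: pseudo_kaehler_def pseudo_riemannian_def)

lemma g_bilinear: "p \<in> points M \<Longrightarrow> bilinear_on (T p) (g p)"
  by (rule tensor_bilinear[OF tensor_g])

lemmas g_left = bilinear_on_left[OF g_bilinear] and g_right = bilinear_on_right[OF g_bilinear]

lemma J_linear: "p \<in> points M \<Longrightarrow> linear_on (T p) (J p)"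
  using kaehler by (simp add: pseudo_kaehler_def)

lemma J_tangent: "v \<in> T p \<Longrightarrow> J p v \<in> T p"
  using kaehler tangent_points[of v M p] by (simp add: pseudo_kaehler_def)

lemma J_square: "v \<in> T p \<Longrightarrow> J p (J p v) = - v"
  using kaehler tangent_points[of v M p] by (simp add: pseudo_kaehler_def)

lemma J_skew: "v \<in> T p \<Longrightarrow> w \<in> T p \<Longrightarrow> g p (J p v) w = - g p v (J p w)"
  using kaehler tangent_points[of v M p] by (simp add: pseudo_kaehler_def)

lemma J_vector_field: "vector_field M W X \<Longrightarrow> vector_field M W (\<lambda>p. J p (X p))"
  using kaehler by (simp add: pseudo_kaehler_def)

lemma J_parallel: "vector_field M W X \<Longrightarrow> p \<in> W \<Longrightarrow> v \<in> T p \<Longrightarrow> D p v (\<lambda>q. J q (X q)) = J p (D p v X)"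
  using kaehler by (simp add: pseudo_kaehler_def)

lemma affine: "affine_connection M D"
  using kaehler by (simp add: pseudo_kaehler_def levi_civita_def)

lemma D_vector_field: "vector_field M W X \<Longrightarrow> vector_field M W Y \<Longrightarrow> vector_field M W (\<lambda>p. D p (X p) Y)"
  using affine by (simp add: affine_connection_def)

lemma D_leibniz:
  "vector_field M W Y \<Longrightarrow> p \<in> W \<Longrightarrow> v \<in> T p \<Longrightarrow> smooth_fn M W h \<Longrightarrow>
    D p v (\<lambda>q. h q *\<^sub>R Y q) = v h *\<^sub>R Y p + h p *\<^sub>R D p v Y"
  using affine unfolding affine_connection_def by blast

lemma torsion_free:
  "vector_field M W X \<Longrightarrow> vector_field M W Y \<Longrightarrow> p \<in> W \<Longrightarrow>
    lie_bracket M X Y p = D p (X p) Y - D p (Y p) X"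
  using kaehler by (simp add: pseudo_kaehler_def levi_civita_def)

lemma metric_connection:
  "vector_field M W X \<Longrightarrow> vector_field M W Y \<Longrightarrow> p \<in> W \<Longrightarrow> v \<in> T p \<Longrightarrow>
    v (\<lambda>q. g q (X q) (Y q)) = g p (D p v X) (Y p) + g p (X p) (D p v Y)"
  using kaehler by (simp add: pseudo_kaehler_def levi_civita_def)

lemma euler_vector_field: "vector_field M (points M) \<xi>"
  using conical by (simp add: conical_pseudo_kaehler_def)

lemma D_euler: "v \<in> T p \<Longrightarrow> D p v \<xi> = v"
  using conical tangent_points[of v M p] by (simp add: conical_pseudo_kaehler_def)

lemma euler_tangent: "p \<in> points M \<Longrightarrow> \<xi> p \<in> T p"
  by (rule vector_field_tangent[OF euler_vector_field])

lemma J_euler_vector_field: "vector_field M (points M) (\<lambda>p. J p (\<xi> p))"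
  by (rule J_vector_field[OF euler_vector_field])

lemma J_euler_tangent: "p \<in> points M \<Longrightarrow> J p (\<xi> p) \<in> T p"
  by (rule J_tangent[OF euler_tangent])

lemma Z_vector_field: "vector_field M (points M) Z"
  by (rule vector_field_scaleR[OF manifold_M J_euler_vector_field smooth_fn_const[OF manifold_M open_in_points]])

lemma Z_vector_field_on: "open_in M W \<Longrightarrow> vector_field M W Z"
  by (rule vector_field_subset[OF Z_vector_field _ open_in_subset])

lemma Z_tangent: "p \<in> points M \<Longrightarrow> Z p \<in> T p"
  by (rule vector_field_tangent[OF Z_vector_field])

text \<open>Everything about \<open>Z = 2 J \<xi>\<close> follows from this, since \<open>J\<close> is parallel and \<open>D \<xi> = Id\<close>.\<close>

lemma D_Z:
  assumes v: "v \<in> T p" shows "D p v Z = 2 *\<^sub>R J p v"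
proof -
  note p = tangent_points[OF v]
  have "D p v Z = v (\<lambda>q. 2) *\<^sub>R J p (\<xi> p) + 2 *\<^sub>R D p v (\<lambda>q. J q (\<xi> q))"
    by (rule D_leibniz[OF J_euler_vector_field p v smooth_fn_const[OF manifold_M open_in_points]])
  also have "\<dots> = 2 *\<^sub>R J p v"
    using tangent_const[OF manifold_M v] J_parallel[OF euler_vector_field p v] D_euler[OF v] by simp
  finally show ?thesis .
qed

lemma D_tangent:
  assumes "vector_field M W X" "vector_field M W Y" "p \<in> W" shows "D p (X p) Y \<in> T p"
  by (rule vector_field_tangent[OF D_vector_field[OF assms(1,2)] assms(3)])

lemma lie_bracket_Z:
  assumes X: "vector_field M W X" and p: "p \<in> W"
  shows "lie_bracket M Z X p = D p (Z p) X - 2 *\<^sub>R J p (X p)"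
  using torsion_free[OF Z_vector_field_on[OF vector_field_open[OF X]] X p] D_Z[OF vector_field_tangent[OF X p]]
  by simp

text \<open>
  \<open>[Z, X] = D\<^sub>Z X - 2 J X\<close>, and both \<open>D\<^sub>Z\<close> and the endomorphism \<open>2 J\<close> commute with \<open>J\<close>.
\<close>

lemma holomorphic_Z: "holomorphic_field M J Z"
  unfolding holomorphic_field_def
proof (intro conjI Z_vector_field allI impI ballI)
  fix W X p assume X: "vector_field M W X" and p: "p \<in> W"
  note pM = vector_field_points[OF X p] and x = vector_field_tangent[OF X p]
  note Z = Z_vector_field_on[OF vector_field_open[OF X]]
  have "lie_bracket M Z (\<lambda>q. J q (X q)) p = J p (D p (Z p) X) - 2 *\<^sub>R J p (J p (X p))"
    using lie_bracket_Z[OF J_vector_field[OF X] p] J_parallel[OF X p Z_tangent[OF pM]] by simp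
  also have "\<dots> = J p (D p (Z p) X - 2 *\<^sub>R J p (X p))"
    using linear_on_diff[OF J_linear[OF pM] D_tangent[OF Z X p]
        subspace_scale[OF subspace_tangent[OF manifold_M pM] J_tangent[OF x], of 2]]
      linear_on_scaleR[OF J_linear[OF pM] J_tangent[OF x], of 2] by simp
  finally show "lie_bracket M Z (\<lambda>q. J q (X q)) p = J p (lie_bracket M Z X p)"
    using lie_bracket_Z[OF X p] by simp
qed

text \<open>
  The metric is parallel and the endomorphism \<open>2 J\<close> is skew.
\<close>

lemma killing_Z: "killing_field M g Z"
  unfolding killing_field_def
proof (intro conjI Z_vector_field allI impI ballI)
  fix W X Y p assume X: "vector_field M W X" and Y: "vector_field M W Y" and p: "p \<in> W"
  note pM = vector_field_points[OF X p] and x = vector_field_tangent[OF X p] and y = vector_field_tangent[OF Y p]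
  note Z = Z_vector_field_on[OF vector_field_open[OF X]]
  note sub = subspace_tangent[OF manifold_M pM]
  have "g p (lie_bracket M Z X p) (Y p) = g p (D p (Z p) X) (Y p) - 2 * g p (J p (X p)) (Y p)"
    unfolding lie_bracket_Z[OF X p]
    using linear_on_diff[OF g_right[OF pM y] D_tangent[OF Z X p] subspace_scale[OF sub J_tangent[OF x], of 2]]
      linear_on_scaleR[OF g_right[OF pM y] J_tangent[OF x], of 2] by simp
  moreover have "g p (X p) (lie_bracket M Z Y p) = g p (X p) (D p (Z p) Y) - 2 * g p (X p) (J p (Y p))"
    unfolding lie_bracket_Z[OF Y p]
    using linear_on_diff[OF g_left[OF pM x] D_tangent[OF Z Y p] subspace_scale[OF sub J_tangent[OF y], of 2]]
      linear_on_scaleR[OF g_left[OF pM x] J_tangent[OF y], of 2] by simp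
  ultimately show "Z p (\<lambda>q. g q (X q) (Y q)) = g p (lie_bracket M Z X p) (Y p) + g p (X p) (lie_bracket M Z Y p)"
    using metric_connection[OF X Y p Z_tangent[OF pM]] J_skew[OF x y] by simp
qed

subsection \<open>Computations along the rays\<close>

lemma radius_positive: "p \<in> points M \<Longrightarrow> fst p > 0"
  by (auto simp: points_M)

lemma euler_apply:
  assumes "smooth_at M p h" shows "\<xi> p h = fst p * deriv (\<lambda>t. h (fst p + t, snd p)) 0"
  using assms by (simp add: euler_def velocity_def scaleR_fun_def comp_def)

lemma euler_radius: "p \<in> points M \<Longrightarrow> \<xi> p fst = fst p"
  using euler_apply[OF radius_smooth_at, of p] DERIV_imp_deriv[of "\<lambda>t. fst p + t" 1 0]
  by (auto intro!: derivative_eq_intros)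

lemma euler_base_function:
  assumes "p \<in> points M" "smooth_at S (snd p) h" shows "\<xi> p (\<lambda>x. h (snd x)) = 0"
  using euler_apply[OF smooth_at_compose[OF manifold_M manifold_S smooth_map_base assms]] by simp

lemma euler_base: "p \<in> points M \<Longrightarrow> pushforward S snd p (\<xi> p) = 0"
  using euler_base_function by (auto simp: pushforward_def fun_eq_iff comp_def)

lemma base_tangent: "v \<in> T p \<Longrightarrow> pushforward S snd p v \<in> tangent_space S (snd p)"
  by (rule pushforward_tangent[OF manifold_M manifold_S smooth_map_base])

lemma g_apply: "g p v w = lam * (v fst * w fst) + (fst p)\<^sup>2 * gS (snd p) (pushforward S snd p v) (pushforward S snd p w)"
  by (simp add: cone_metric_def pullback2_def)

lemma gS_zero:
  assumes "v \<in> tangent_space S q" shows "gS q v 0 = 0" "gS q 0 v = 0"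
  using linear_on_zero[OF bilinear_on_left[OF tensor_bilinear[OF tensor_gS tangent_points[OF assms]] assms] assms]
    linear_on_zero[OF bilinear_on_right[OF tensor_bilinear[OF tensor_gS tangent_points[OF assms]] assms] assms]
  by auto

lemma g_euler: "v \<in> T p \<Longrightarrow> g p (\<xi> p) v = lam * fst p * v fst"
  using tangent_points[of v M p] gS_zero[OF base_tangent, of v p] by (simp add: g_apply euler_radius euler_base)

lemma g_euler_euler: "p \<in> points M \<Longrightarrow> g p (\<xi> p) (\<xi> p) = lam * (fst p)\<^sup>2"
  using g_euler[OF euler_tangent] by (simp add: euler_radius power2_eq_square)

lemma cone_radius: "p \<in> points M \<Longrightarrow> cone_radius g \<xi> p = fst p"
  using lam_cases radius_positive[of p] by (auto simp: cone_radius_def g_euler_euler abs_mult)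

lemma g_Z_Z: "p \<in> points M \<Longrightarrow> g p (Z p) (Z p) = 4 * lam * (fst p)\<^sup>2"
proof -
  assume p: "p \<in> points M"
  note x = euler_tangent[OF p] and jx = J_euler_tangent[OF p]
  have "g p (Z p) (Z p) = 4 * g p (J p (\<xi> p)) (J p (\<xi> p))"
    using linear_on_scaleR[OF g_left[OF p Z_tangent[OF p]] jx, of 2] linear_on_scaleR[OF g_right[OF p jx] jx, of 2]
    by simp
  also have "\<dots> = 4 * g p (\<xi> p) (\<xi> p)"
    using J_skew[OF x jx] J_square[OF x] linear_on_scaleR[OF g_left[OF p x] x, of "-1"] by simp
  finally show ?thesis using g_euler_euler[OF p] by simp
qed

text \<open>
  \<open>J \<xi>\<close> is orthogonal to \<open>\<xi>\<close> by skewness of \<open>J\<close>, and the radial component is proportional to the product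
  with \<open>\<xi>\<close>.
\<close>

lemma J_euler_radius: "p \<in> points M \<Longrightarrow> J p (\<xi> p) fst = 0"
proof -
  assume p: "p \<in> points M"
  note x = euler_tangent[OF p] and jx = J_euler_tangent[OF p]
  have "g p (\<xi> p) (J p (\<xi> p)) = 0"
    using J_skew[OF x x] g_symmetric[OF x jx] by simp
  then show ?thesis using g_euler[OF jx] radius_positive[OF p] lam_cases by auto
qed

lemma euler_bracket: "p \<in> points M \<Longrightarrow> lie_bracket M \<xi> (\<lambda>p. J p (\<xi> p)) p = 0"
  using torsion_free[OF euler_vector_field J_euler_vector_field]
    J_parallel[OF euler_vector_field _ euler_tangent] D_euler[OF euler_tangent] D_euler[OF J_euler_tangent] by simp

text \<open>
  For a function \<open>h\<close> on \<open>S\<close>, the bracket relation says that \<open>\<xi>\<close> annihilates \<open>(J \<xi>) h\<close>; that is, the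
  derivative of this function along the ray vanishes.
\<close>

lemma J_euler_base:
  assumes p: "p \<in> points M" shows "pushforward S snd p (J p (\<xi> p)) = reeb_field S J (snd p)"
proof -
  let ?Y = "\<lambda>p. J p (\<xi> p)"
  define q where "q = snd p"
  have q: "q \<in> points S" using p by (auto simp: points_M q_def)
  have ray: "(r, q) \<in> points M" if "r > 0" for r using q that by (simp add: points_M)
  have const: "?Y p (\<lambda>x. h (snd x)) = ?Y (1, q) (\<lambda>x. h (snd x))" if h: "smooth_at S q h" for h
  proof -
    obtain W where W: "q \<in> W" "smooth_fn S W h" using h by (auto simp: smooth_at_def)
    let ?V = "{x \<in> points M. snd x \<in> W}" and ?h = "\<lambda>x. h (snd x)"
    have V: "smooth_fn M ?V ?h"
      by (rule smooth_fn_pullback[OF manifold_M manifold_S smooth_map_base W(2)])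
    let ?G = "\<lambda>x. ?Y x ?h"
    have G: "smooth_fn M ?V ?G"
      by (rule vector_field_smooth[OF J_euler_vector_field V]) auto
    have "((\<lambda>r. ?G (r, q)) has_real_derivative 0) (at r)" if r: "r > 0" for r
    proof -
      have inV: "(r, q) \<in> ?V" using W(1) ray[OF r] by simp
      have "?Y (r, q) (\<lambda>x. \<xi> x ?h) = ?Y (r, q) (\<lambda>x. 0)"
        by (rule tangent_local[OF manifold_M J_euler_tangent[OF ray[OF r]] smooth_fn_open[OF V] inV])
          (use euler_base_function smooth_atI[OF W(2)] in simp)
      then have "\<xi> (r, q) ?G = 0"
        using fun_cong[OF euler_bracket[OF ray[OF r]], of ?h] smooth_atI[OF V inV]
          tangent_const[OF manifold_M J_euler_tangent[OF ray[OF r]]]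
        by (simp add: lie_bracket_def)
      then have 0: "deriv (\<lambda>t. ?G (r + t, q)) 0 = 0"
        using euler_apply[OF smooth_atI[OF G inV]] r by simp
      have "smooth_map (open_atlas {0<..}) M (\<lambda>r. (r, q))"
        unfolding cone_atlas_def by (rule smooth_map_Pair_left[OF manifold_open manifold_S q]) simp
      from smooth_fn_pullback[OF manifold_open manifold_M this G]
      have "smooth_fn (open_atlas {0<..}) {x \<in> {0<..}. (x, q) \<in> ?V} (\<lambda>r. ?G (r, q))" by simp
      then have d: "((\<lambda>r. ?G (r, q)) has_real_derivative deriv (\<lambda>r. ?G (r, q)) r) (at r)"
        by (intro smooth_on_real_deriv[OF smooth_fn_open_atlas_D(3)]) (use r inV in auto)
      then have "((\<lambda>t. ?G (r + t, q)) has_real_derivative deriv (\<lambda>r. ?G (r, q)) r) (at 0)"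
        using DERIV_shift[of "\<lambda>r. ?G (r, q)" _ 0 r] by (simp add: add.commute)
      from DERIV_imp_deriv[OF this] 0 have "deriv (\<lambda>r. ?G (r, q)) r = 0" by (rule trans[OF sym])
      with d show ?thesis by (simp only:)
    qed
    then have "\<exists>k. \<forall>r\<in>{0<..}. ?G (r, q) = k"
      by (intro has_field_derivative_zero_constant) (auto intro: has_field_derivative_at_within)
    then have "?G (fst p, q) = ?G (1, q)" using radius_positive[OF p] by (metis greaterThan_iff zero_less_one)
    then show ?thesis by (simp add: q_def)
  qed
  show ?thesis
  proof
    fix h
    show "pushforward S snd p (J p (\<xi> p)) h = reeb_field S J (snd p) h"
      using const[of h] by (simp add: reeb_field_def pushforward_def comp_def q_def)
  qed
qed

lemma g_J_euler:
  "v \<in> T p \<Longrightarrow> g p (J p (\<xi> p)) v = (fst p)\<^sup>2 * gS (snd p) (reeb_field S J (snd p)) (pushforward S snd p v)"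
  using tangent_points[of v M p] by (simp add: g_apply J_euler_radius J_euler_base)

lemma contact_form_apply:
  "v \<in> T p \<Longrightarrow> contact_form lam J g \<xi> p v = lam * gS (snd p) (reeb_field S J (snd p)) (pushforward S snd p v)"
  using tangent_points[of v M p] radius_positive[of p] by (simp add: contact_form_def g_J_euler cone_radius)

text \<open>
  The radial parts cancel, since \<open>lam g = dr\<^sup>2 + lam r\<^sup>2 gS\<close>: the transverse metric is \<open>gS - lam \<eta>\<^sup>2\<close>.
\<close>

lemma transverse_metric_apply:
  assumes v: "v \<in> T p" and w: "w \<in> T p"
  shows "transverse_metric lam J g \<xi> p v w = gS (snd p) (pushforward S snd p v) (pushforward S snd p w) -
    lam * (contact_form lam J g \<xi> p v * contact_form lam J g \<xi> p w)"
proof -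
  note p = tangent_points[OF v]
  have "v (cone_radius g \<xi>) = v fst" "w (cone_radius g \<xi>) = w fst"
    by (rule tangent_local[OF manifold_M _ open_in_points p]; simp add: v w cone_radius)+
  then show ?thesis
    unfolding transverse_metric_def cone_radius[OF p]
    using radius_positive[OF p] by (simp add: g_apply algebra_simps)
qed

lemma one_form_contact: "one_form M (contact_form lam J g \<xi>)"
  unfolding one_form_def
proof (intro conjI ballI allI impI)
  fix p assume p: "p \<in> points M"
  show "linear_on (T p) (contact_form lam J g \<xi> p)"
  proof -
    define k where "k = lam / (cone_radius g \<xi> p)\<^sup>2"
    have "contact_form lam J g \<xi> p = (\<lambda>v. k * g p (J p (\<xi> p)) v)"
      by (simp add: contact_form_def k_def fun_eq_iff)
    then show ?thesis
      using g_left[OF p J_euler_tangent[OF p]] by (simp only: linear_on_def) (simp add: algebra_simps)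
  qed
next
  fix W X assume X: "vector_field M W X"
  note W = vector_field_open[OF X]
  have r: "smooth_fn M W fst" by (rule smooth_fn_subset[OF smooth_fn_radius W open_in_subset[OF W]])
  have "smooth_fn M W (\<lambda>p. lam / (fst p * fst p) * g p (J p (\<xi> p)) (X p))"
    by (intro smooth_fn_mult[OF manifold_M] smooth_fn_divide[OF manifold_M] smooth_fn_const[OF manifold_M W] r
        tensor_smooth[OF tensor_g vector_field_subset[OF J_euler_vector_field W open_in_subset[OF W]] X])
      (use radius_positive vector_field_points[OF X] in force)
  then show "smooth_fn M W (\<lambda>p. contact_form lam J g \<xi> p (X p))"
    by (rule smooth_fn_cong[OF manifold_M])
      (simp add: contact_form_def cone_radius vector_field_points[OF X] power2_eq_square)
qed

lemma tensor_transverse: "smooth_tensor2 M (transverse_metric lam J g \<xi>)"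
proof -
  have "smooth_tensor2 M (\<lambda>p v w. - lam * (contact_form lam J g \<xi> p v * contact_form lam J g \<xi> p w) +
      pullback2 S snd gS p v w)"
    by (intro smooth_tensor2_lincomb[OF manifold_M] smooth_fn_const[OF manifold_M open_in_points]
        smooth_tensor2_product[OF manifold_M] one_form_contact
        smooth_tensor2_pullback[OF manifold_M manifold_S smooth_map_base tensor_gS])
  then show ?thesis
    by (rule smooth_tensor2_cong[OF manifold_M]) (simp add: transverse_metric_apply pullback2_def)
qed

subsection \<open>The data of the correspondence\<close>

context
  fixes c :: real
begin

abbreviation "f \<equiv> \<lambda>p. lam * (cone_radius g \<xi> p)\<^sup>2 - c"

lemma hamiltonian: "p \<in> points M \<Longrightarrow> f p = lam * (fst p)\<^sup>2 - c"
  by (simp add: cone_radius)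

lemma hamiltonian_f1: "p \<in> points M \<Longrightarrow> kk_f1 g Z f p = - (lam * (fst p)\<^sup>2 + c)"
  by (simp add: kk_f1_def g_Z_Z cone_radius)

lemma hamiltonian_differential:
  assumes v: "v \<in> T p" shows "v f = 2 * lam * fst p * v fst"
proof -
  note p = tangent_points[OF v] and m = manifold_M
  note r = radius_smooth_at[OF p]
  have "v f = v (\<lambda>x. lam * (fst x * fst x) + (- c))"
    by (rule tangent_local[OF m v open_in_points p]) (simp add: cone_radius power2_eq_square)
  also have "\<dots> = lam * v (\<lambda>x. fst x * fst x)"
    using tangent_add[OF m v smooth_at_mult[OF m smooth_at_const[OF m p] smooth_at_mult[OF m r r]] smooth_at_const[OF m p], of lam "-c"]
      tangent_scale[OF m v smooth_at_mult[OF m r r], of lam] tangent_const[OF m v, of "-c"] by simp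
  finally show ?thesis using tangent_mult[OF m v r r] by simp
qed

lemma kk_data_cone: "kk_data M J g D Z f"
  unfolding kk_data_def
proof (intro conjI kaehler killing_Z ballI)
  show "(\<forall>p\<in>points M. g p (Z p) (Z p) > 0) \<or> (\<forall>p\<in>points M. g p (Z p) (Z p) < 0)"
  proof -
    have "lam * g p (Z p) (Z p) > 0" if "p \<in> points M" for p
      unfolding g_Z_Z[OF that] using lam_cases radius_positive[OF that] by (elim disjE) simp_all
    moreover have "lam > 0 \<or> lam < 0" using lam_cases by auto
    ultimately show ?thesis by (auto simp: zero_less_mult_iff)
  qed
  have "smooth_fn M (points M) (\<lambda>p. lam * (fst p * fst p) + (- c))"
    by (intro smooth_fn_add smooth_fn_mult smooth_fn_const manifold_M smooth_fn_radius open_in_points)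
  then show "smooth_fn M (points M) f"
    by (rule smooth_fn_cong[OF manifold_M]) (simp add: cone_radius power2_eq_square)
  fix p v assume p: "p \<in> points M" and v: "v \<in> T p"
  note x = euler_tangent[OF p]
  have "J p (Z p) = (- 2) *\<^sub>R \<xi> p"
    using linear_on_scaleR[OF J_linear[OF p] J_euler_tangent[OF p], of 2] J_square[OF x] by simp
  then have "kaehler_form J g p (Z p) v = - 2 * g p (\<xi> p) v"
    unfolding kaehler_form_def using linear_on_scaleR[OF g_right[OF p v] x, of "-2"] by simp
  then show "v f = - kaehler_form J g p (Z p) v"
    using hamiltonian_differential[OF v] g_euler[OF v] by simp
qed

end

lemma one_form_gZ: "one_form M (\<lambda>p. g p (Z p))"
  unfolding one_form_def
  using g_left[OF _ Z_tangent] tensor_smooth[OF tensor_g Z_vector_field_on[OF vector_field_open]] by auto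

lemma tensor_kaehler: "smooth_tensor2 M (kaehler_form J g)"
  unfolding smooth_tensor2_def
proof (intro conjI ballI allI impI)
  fix p assume p: "p \<in> points M"
  show "bilinear_on (T p) (kaehler_form J g p)"
    using g_bilinear[OF p] J_linear[OF p] J_tangent[of _ p]
    by (simp add: bilinear_on_def linear_on_def kaehler_form_def)
next
  fix W X Y assume "vector_field M W X" "vector_field M W Y"
  then show "smooth_fn M W (\<lambda>p. kaehler_form J g p (X p) (Y p))"
    unfolding kaehler_form_def by (intro tensor_smooth[OF tensor_g] J_vector_field)
qed

text \<open>
  \<open>d(g(Z, \<cdot>))(X, Y) = g(D\<^sub>X Z, Y) - g(D\<^sub>Y Z, X)\<close> because the connection is metric and torsion-free; with
  \<open>D Z = 2 J\<close> both terms contribute \<open>2 \<omega>(X, Y)\<close>.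
\<close>

lemma ext_deriv_gZ: "is_ext_deriv M (\<lambda>p. g p (Z p)) (\<lambda>p v w. 4 * kaehler_form J g p v w)"
  unfolding is_ext_deriv_def
proof (intro conjI allI impI ballI)
  have "smooth_tensor2 M (\<lambda>p v w. 4 * kaehler_form J g p v w + 0)"
    by (intro smooth_tensor2_lincomb[where h = "\<lambda>p. 4"] manifold_M smooth_fn_const open_in_points tensor_kaehler smooth_tensor2_zero)
  then show "smooth_tensor2 M (\<lambda>p v w. 4 * kaehler_form J g p v w)" by simp
  fix W X Y p assume X: "vector_field M W X" and Y: "vector_field M W Y" and p: "p \<in> W"
  note pM = vector_field_points[OF X p] and x = vector_field_tangent[OF X p] and y = vector_field_tangent[OF Y p]
  note Z = Z_vector_field_on[OF vector_field_open[OF X]]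
  have D: "v (\<lambda>q. g q (Z q) (Y' q)) = 2 * g p (J p v) (Y' p) + g p (Z p) (D p v Y')"
    if Y': "vector_field M W Y'" and v: "v \<in> T p" for Y' v
    using metric_connection[OF Z Y' p v] D_Z[OF v]
      linear_on_scaleR[OF g_right[OF pM vector_field_tangent[OF Y' p]] J_tangent[OF v], of 2] by simp
  have "g p (Z p) (lie_bracket M X Y p) = g p (Z p) (D p (X p) Y) - g p (Z p) (D p (Y p) X)"
    unfolding torsion_free[OF X Y p]
    by (rule linear_on_diff[OF g_left[OF pM Z_tangent[OF pM]] D_tangent[OF X Y p] D_tangent[OF Y X p]])
  then show "4 * kaehler_form J g p (X p) (Y p) = X p (\<lambda>q. g q (Z q) (Y q)) - Y p (\<lambda>q. g q (Z q) (X q)) -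
      g p (Z p) (lie_bracket M X Y p)"
    unfolding D[OF X y] D[OF Y x] kaehler_form_def
    using J_skew[OF x y] g_symmetric[OF x J_tangent[OF y]] by simp
qed

subsection \<open>The circle bundle\<close>

abbreviation "P \<equiv> circle_bundle M"
abbreviation "\<eta> \<equiv> kk_eta M g Z"

lemma manifold_P: "manifold P"
  unfolding circle_bundle_def by (intro manifold_prod manifold_M manifold_circle)

lemma points_P: "points P = points M \<times> sphere 0 1"
  by (simp add: circle_bundle_def points_prod)

lemma smooth_map_P_fst: "smooth_map P M fst"
  unfolding circle_bundle_def by (intro smooth_map_fst manifold_M manifold_circle)

lemma smooth_map_P_snd: "smooth_map P circle_atlas snd"
  unfolding circle_bundle_def by (intro smooth_map_snd manifold_M manifold_circle)

lemma ds_eq: "ds = angle_form snd"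
  by (simp add: ds_def angle_form_def)

lemma kk_eta_eq: "\<eta> = (\<lambda>y v. - (1/4) * pullback1 M fst (\<lambda>p. g p (Z p)) y v + angle_form snd y v)"
  by (auto simp: kk_eta_def ds_eq fun_eq_iff)

lemma one_form_eta: "one_form P \<eta>"
  unfolding kk_eta_eq
  by (intro one_form_lincomb[where h = "\<lambda>y. - (1/4)"] manifold_P smooth_fn_const open_in_points
      one_form_pullback[OF manifold_P manifold_M smooth_map_P_fst one_form_gZ]
      one_form_angle[OF manifold_P smooth_map_P_snd])

lemma fundamental_base: "y \<in> points P \<Longrightarrow> pushforward M fst y (fundamental_field M y) = 0"
  using pushforward_velocity[OF manifold_P manifold_M smooth_map_P_fst, of "\<lambda>t. (fst y, snd y * cis t)"]
  by (simp add: fundamental_field_def velocity_def fun_eq_iff comp_def)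

lemma ds_fundamental:
  assumes y: "y \<in> points P" shows "angle_form snd y (fundamental_field M y) = 1"
proof -
  have n: "snd y \<noteq> 0" using y by (auto simp: points_P)
  have "((\<lambda>t. Arg (1 * cis t)) has_derivative (\<lambda>t. t)) (at 0)"
    by (rule has_derivative_Arg_cis) auto
  then have "((\<lambda>t. Arg (cis t)) has_real_derivative 1) (at 0)"
    by (intro has_derivative_imp_has_field_derivative) auto
  then have "deriv (\<lambda>t. Arg (cis t)) 0 = 1" by (rule DERIV_imp_deriv)
  then show ?thesis
    using angle_smooth_at[OF manifold_P smooth_map_P_snd y] n
    by (simp add: angle_form_def fundamental_field_def velocity_def comp_def)
qed

lemma eta_rotation:
  assumes u: "u \<in> sphere 0 1" and v: "v \<in> tangent_space P y"
  shows "pullback1 P (\<lambda>(p, z). (p, z * u)) \<eta> y v = \<eta> y v"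
proof -
  let ?R = "\<lambda>x. (fst x, snd x * u)"
  note y = tangent_points[OF v]
  have u0: "u \<noteq> 0" using u by auto
  have R: "smooth_map P P ?R"
    unfolding circle_bundle_def[of M]
    by (intro smooth_map_Pair smooth_map_P_fst[unfolded circle_bundle_def] manifold_prod
        smooth_map_compose[OF _ manifold_circle manifold_circle smooth_map_P_snd[unfolded circle_bundle_def] smooth_map_rotation]
        manifold_M manifold_circle) (use u in auto)
  note Ry = smooth_map_points[OF R y]
  have "pushforward M fst (?R y) (pushforward P ?R y v) = pushforward M fst y v"
    using pushforward_compose[OF manifold_P manifold_M smooth_map_P_fst, of ?R y v] Ry by simp
  moreover have "angle_form snd (?R y) (pushforward P ?R y v) = angle_form snd y v"
    using angle_form_pushforward[where F = ?R and p = y, OF manifold_P smooth_map_P_snd Ry, of v] u0 by (simp add: angle_form_def)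
  ultimately show ?thesis
    by (simp add: pullback1_def kk_eta_eq case_prod_unfold)
qed

text \<open>
  With \<open>\<beta> = 4 \<omega>\<close> the curvature to be realized is \<open>\<omega> - \<beta> / 2 = - \<omega>\<close>, and this is \<open>- \<beta> / 4\<close>.
\<close>

lemma kk_connection_cone: "kk_connection M J g Z \<eta>"
  unfolding kk_connection_def
proof (intro conjI ballI one_form_eta)
  fix y assume y: "y \<in> points P"
  then have "fst y \<in> points M" by (auto simp: points_P)
  then show "\<eta> y (fundamental_field M y) = 1"
    using fundamental_base[OF y] ds_fundamental[OF y] linear_on_zero[OF g_left[OF _ Z_tangent] Z_tangent]
    by (simp add: kk_eta_eq pullback1_def)
next
  show "\<And>y u v. u \<in> sphere 0 1 \<Longrightarrow> v \<in> tangent_space P y \<Longrightarrow> pullback1 P (\<lambda>(p, z). (p, z * u)) \<eta> y v = \<eta> y v"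
    by (rule eta_rotation)
  have E1: "is_ext_deriv P \<eta> (\<lambda>y v w. - (1/4) * pullback2 M fst (\<lambda>p v w. 4 * kaehler_form J g p v w) y v w + 0)"
    unfolding kk_eta_eq
    by (intro ext_deriv_lincomb manifold_P one_form_pullback[OF manifold_P manifold_M smooth_map_P_fst one_form_gZ]
        ext_deriv_pullback[OF manifold_P manifold_M smooth_map_P_fst one_form_gZ ext_deriv_gZ]
        one_form_angle[OF manifold_P smooth_map_P_snd] ext_deriv_angle[OF manifold_P smooth_map_P_snd])
  have E2: "(\<lambda>y v w. - (1/4) * pullback2 M fst (\<lambda>p v w. 4 * kaehler_form J g p v w) y v w + 0) =
      pullback2 M fst (\<lambda>p v w. kaehler_form J g p v w - 4 * kaehler_form J g p v w / 2)"
    by (auto simp: pullback2_def fun_eq_iff)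
  have "is_ext_deriv P \<eta> (pullback2 M fst (\<lambda>p v w. kaehler_form J g p v w - 4 * kaehler_form J g p v w / 2))"
    using E1 unfolding E2 .
  then show "\<exists>\<beta>. is_ext_deriv M (\<lambda>p. g p (Z p)) \<beta> \<and>
      is_ext_deriv P \<eta> (pullback2 M fst (\<lambda>p v w. kaehler_form J g p v w - \<beta> p v w / 2))"
    by (intro exI[of _ "\<lambda>p v w. 4 * kaehler_form J g p v w"] conjI ext_deriv_gZ)
qed

end

section \<open>The hypersurface in the circle bundle\<close>

lemma card_onb_Times:
  fixes A :: "'a::real_inner set" and B :: "'b::real_inner set"
  assumes "onb A" "onb B" shows "card ((\<lambda>a. (a, 0)) ` A \<union> (\<lambda>b. (0, b)) ` B) = card A + card B"
proof -
  have "0 \<notin> A" using assms(1) unfolding onb_def by (metis inner_zero_left zero_neq_one)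
  then have "(\<lambda>a. (a, 0)) ` A \<inter> (\<lambda>b. (0, b)) ` B = {}" by auto
  moreover have "card ((\<lambda>a. (a, 0::'b)) ` A) = card A" "card ((\<lambda>b. (0::'a, b)) ` B) = card B"
    by (auto intro!: card_image inj_onI)
  ultimately show ?thesis
    using assms by (simp add: card_Un_disjoint onb_def)
qed

locale kaehler_cone_hypersurface = kaehler_cone lam S gS J D
  for lam :: real and S :: "('p::topological_space, 'e::real_inner) atlas" and gS :: "'p tensor2"
    and J :: "(real \<times> 'p) endo" and D :: "(real \<times> 'p) connection" +
  fixes N :: "('p, 'b::real_inner) atlas" and c :: real
  assumes hyper: "hypersurface N S" and trans: "transversal N S (reeb_field S J)"
begin

abbreviation "N' \<equiv> circle_bundle (cone_atlas N)"
abbreviation "\<Phi> \<equiv> kk_embed lam c :: real \<times> complex \<times> 'p \<Rightarrow> _"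
abbreviation "\<eta>N \<equiv> pullback1 M (\<lambda>q. (1, q)) (contact_form lam J g \<xi>)"
abbreviation "gN \<equiv> pullback2 M (\<lambda>q. (1, q)) (transverse_metric lam J g \<xi>)"
abbreviation "ham \<equiv> \<lambda>p. lam * (cone_radius g \<xi> p)\<^sup>2 - c"
abbreviation "g' \<equiv> pullback2 P \<Phi> (kk_tensor M g Z ham \<eta>)"

lemma manifold_N: "manifold N"
  using hyper by (simp add: hypersurface_def)

lemma inclusion: "smooth_map N S (\<lambda>p. p)"
  using hyper by (simp add: hypersurface_def)

lemma inclusion_injective: "p \<in> points N \<Longrightarrow> inj_on (pushforward S (\<lambda>p. p) p) (tangent_space N p)"
  using hyper by (simp add: hypersurface_def)

lemma points_N: "p \<in> points N \<Longrightarrow> p \<in> points S"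
  using smooth_map_points[OF inclusion] by simp

lemma manifold_cone_N: "manifold (cone_atlas N)"
  unfolding cone_atlas_def by (intro manifold_prod manifold_open manifold_N) simp

lemma manifold_N': "manifold N'"
  unfolding circle_bundle_def by (intro manifold_prod manifold_cone_N manifold_circle)

lemma points_N': "points N' = ({0<..} \<times> points N) \<times> sphere 0 1"
  by (simp add: circle_bundle_def cone_atlas_def points_prod)

lemma N'_cone: "smooth_map N' (cone_atlas N) fst"
  unfolding circle_bundle_def by (intro smooth_map_fst manifold_cone_N manifold_circle)

lemma N'_angle: "smooth_map N' circle_atlas snd"
  unfolding circle_bundle_def by (intro smooth_map_snd manifold_cone_N manifold_circle)

lemma cone_N_radius: "smooth_map (cone_atlas N) (open_atlas {0<..}) fst"
  and cone_N_base: "smooth_map (cone_atlas N) N snd"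
  unfolding cone_atlas_def by (rule smooth_map_fst smooth_map_snd; simp add: manifold_open manifold_N)+

lemma N'_radius: "smooth_map N' (open_atlas {0<..}) (\<lambda>y. fst (fst y))"
  by (rule smooth_map_compose[OF manifold_N' manifold_cone_N manifold_open N'_cone cone_N_radius]) simp

lemma N'_base: "smooth_map N' N (\<lambda>y. snd (fst y))"
  by (rule smooth_map_compose[OF manifold_N' manifold_cone_N manifold_N N'_cone cone_N_base])

lemma P_radius: "smooth_map P (open_atlas {0<..}) (\<lambda>y. fst (fst y))"
  by (rule smooth_map_compose[OF manifold_P manifold_M manifold_open smooth_map_P_fst smooth_map_radius]) simp

lemma P_base: "smooth_map P S (\<lambda>y. snd (fst y))"
  by (rule smooth_map_compose[OF manifold_P manifold_M manifold_S smooth_map_P_fst smooth_map_base])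

lemma N'_inclusion: "smooth_map N' P (\<lambda>y. y)"
proof -
  have "smooth_map N' P (\<lambda>y. ((fst (fst y), snd (fst y)), snd y))"
    unfolding circle_bundle_def[of M] unfolding cone_atlas_def[of S]
    by (intro smooth_map_Pair manifold_prod manifold_open manifold_S manifold_circle manifold_N' N'_radius N'_angle
        smooth_map_compose[OF manifold_N' manifold_N manifold_S N'_base inclusion]) simp_all
  then show ?thesis by simp
qed

lemma N'_tangent_eqI:
  assumes v: "v \<in> tangent_space N' y" and w: "w \<in> tangent_space N' y"
    and 1: "pushforward (open_atlas {0<..}) (\<lambda>y. fst (fst y)) y v = pushforward (open_atlas {0<..}) (\<lambda>y. fst (fst y)) y w"
    and 2: "pushforward N (\<lambda>y. snd (fst y)) y v = pushforward N (\<lambda>y. snd (fst y)) y w"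
    and 3: "pushforward circle_atlas snd y v = pushforward circle_atlas snd y w"
  shows "v = w"
proof (rule tangent_prod_eqI[OF manifold_cone_N manifold_circle v[unfolded circle_bundle_def] w[unfolded circle_bundle_def] _ 3])
  have y: "fst y \<in> points (cone_atlas N)"
    by (rule smooth_map_points[OF N'_cone tangent_points[OF v]])
  note t = pushforward_tangent[OF manifold_N' manifold_cone_N N'_cone]
  note mo = manifold_open[of "{0<..}", simplified]
  show "pushforward (cone_atlas N) fst y v = pushforward (cone_atlas N) fst y w"
  proof (rule tangent_prod_eqI[OF mo manifold_N])
    show "pushforward (cone_atlas N) fst y v \<in> tangent_space (prod_atlas (open_atlas {0<..}) N) (fst y)"
      "pushforward (cone_atlas N) fst y w \<in> tangent_space (prod_atlas (open_atlas {0<..}) N) (fst y)"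
      using t[OF v] t[OF w] by (simp_all add: cone_atlas_def)
    show "pushforward (open_atlas {0<..}) fst (fst y) (pushforward (cone_atlas N) fst y v) =
        pushforward (open_atlas {0<..}) fst (fst y) (pushforward (cone_atlas N) fst y w)"
      using pushforward_compose[where F = fst and p = y, OF manifold_cone_N mo cone_N_radius y] 1 by simp
    show "pushforward N snd (fst y) (pushforward (cone_atlas N) fst y v) =
        pushforward N snd (fst y) (pushforward (cone_atlas N) fst y w)"
      using pushforward_compose[where F = fst and p = y, OF manifold_cone_N manifold_N cone_N_base y] 2 by simp
  qed
qed

lemma pushforward_P_base:
  assumes v: "v \<in> tangent_space N' y"
  shows "pushforward S (\<lambda>y. snd (fst y)) y (pushforward P (\<lambda>y. y) y v) =
    pushforward S (\<lambda>p. p) (snd (fst y)) (pushforward N (\<lambda>y. snd (fst y)) y v)"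
  using pushforward_compose[OF manifold_P manifold_S P_base, of "\<lambda>y. y" y v]
    pushforward_compose[OF manifold_N manifold_S inclusion, of "\<lambda>y. snd (fst y)" y v]
    smooth_map_points[OF N'_base tangent_points[OF v]] smooth_map_points[OF N'_inclusion tangent_points[OF v]]
  by simp

lemma hypersurface_N': "hypersurface N' P"
  unfolding hypersurface_def
proof (intro conjI manifold_N' N'_inclusion ballI)
  fix y assume y: "y \<in> points N'"
  then have yP: "y \<in> points P" and q: "snd (fst y) \<in> points N"
    using smooth_map_points[OF N'_inclusion] smooth_map_points[OF N'_base] by auto
  note mo = manifold_open[of "{0<..}", simplified]
  show "inj_on (pushforward P (\<lambda>p. p) y) (tangent_space N' y)"
  proof (rule inj_onI)
    fix v w assume v: "v \<in> tangent_space N' y" and w: "w \<in> tangent_space N' y"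
      and eq: "pushforward P (\<lambda>p. p) y v = pushforward P (\<lambda>p. p) y w"
    have "pushforward S (\<lambda>p. p) (snd (fst y)) (pushforward N (\<lambda>y. snd (fst y)) y v) =
        pushforward S (\<lambda>p. p) (snd (fst y)) (pushforward N (\<lambda>y. snd (fst y)) y w)"
      using pushforward_P_base[OF v] pushforward_P_base[OF w] eq by simp
    then have 2: "pushforward N (\<lambda>y. snd (fst y)) y v = pushforward N (\<lambda>y. snd (fst y)) y w"
      by (rule inj_onD[OF inclusion_injective[OF q]]) (intro pushforward_tangent[OF manifold_N' manifold_N N'_base] v w)+
    have 1: "pushforward (open_atlas {0<..}) (\<lambda>y. fst (fst y)) y u =
        pushforward (open_atlas {0<..}) (\<lambda>y. fst (fst y)) y (pushforward P (\<lambda>y. y) y u)" for u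
      using pushforward_compose[OF manifold_P mo P_radius, of "\<lambda>y. y" y u] yP by simp
    have 3: "pushforward circle_atlas snd y u = pushforward circle_atlas snd y (pushforward P (\<lambda>y. y) y u)" for u
      using pushforward_compose[OF manifold_P manifold_circle smooth_map_P_snd, of "\<lambda>y. y" y u] yP by simp
    show "v = w"
      by (rule N'_tangent_eqI[OF v w _ 2]) (simp_all only: 1[of v] 1[of w] 3[of v] 3[of w] eq)
  qed
  obtain E :: "'e set" where E: "onb E" using manifold_onb[OF manifold_S] by blast
  obtain B :: "'b set" where B: "onb B" using manifold_onb[OF manifold_N] by blast
  have "dim (tangent_space S (snd (fst y))) = dim (tangent_space N (snd (fst y))) + 1"
    using hyper q by (simp add: hypersurface_def)
  then have "card E = card B + 1"
    using dim_tangent_space[OF manifold_S points_N[OF q] E] dim_tangent_space[OF manifold_N q B] by simp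
  then show "dim (tangent_space P y) = dim (tangent_space N' y) + 1"
    using dim_tangent_space[OF manifold_P yP onb_Times[OF onb_Times[OF onb_real E] onb_real]]
      dim_tangent_space[OF manifold_N' y onb_Times[OF onb_Times[OF onb_real B] onb_real]]
    unfolding card_onb_Times[OF onb_Times[OF onb_real E] onb_real] card_onb_Times[OF onb_real E]
      card_onb_Times[OF onb_Times[OF onb_real B] onb_real] card_onb_Times[OF onb_real B] by simp
qed

text \<open>
  The projection of \<open>Z\<^sup>P\<close> to \<open>S\<close> is twice the Reeb field, whereas vectors tangent to the hypersurface
  project to vectors tangent to \<open>N\<close>.
\<close>

lemma transversal_N': "transversal N' P (kk_ZP M g Z ham \<eta>)"
  unfolding transversal_def
proof (intro ballI notI)
  fix y assume y: "y \<in> points N'"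
  assume "kk_ZP M g Z ham \<eta> y \<in> pushforward P (\<lambda>p. p) y ` tangent_space N' y"
  then obtain w where w: "w \<in> tangent_space N' y" "kk_ZP M g Z ham \<eta> y = pushforward P (\<lambda>p. p) y w" by blast
  have yP: "y \<in> points P" and q: "snd (fst y) \<in> points N"
    using y smooth_map_points[OF N'_inclusion] smooth_map_points[OF N'_base] by auto
  have yM: "fst y \<in> points M" using yP by (simp add: points_P mem_Times_iff)
  let ?u = "pushforward N (\<lambda>y. snd (fst y)) y w"
  have u: "?u \<in> tangent_space N (snd (fst y))"
    by (rule pushforward_tangent[OF manifold_N' manifold_N N'_base w(1)])
  let ?F = "fundamental_field M y" and ?H = "pushforward P (\<lambda>p. (p, snd y)) (fst y) (Z (fst y))"
  have F: "pushforward S (\<lambda>y. snd (fst y)) y ?F = 0"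
    using pushforward_compose[OF manifold_M manifold_S smooth_map_base, of fst y ?F] yM fundamental_base[OF yP] by simp
  have "pushforward S (\<lambda>y. snd (fst y)) y ?H = pushforward S snd (fst y) (Z (fst y))"
    using pushforward_compose[OF manifold_P manifold_S P_base, of "\<lambda>p. (p, snd y)" "fst y" "Z (fst y)"] yP by simp
  also have "\<dots> = 2 *\<^sub>R reeb_field S J (snd (fst y))"
    by (simp add: pushforward_scaleR J_euler_base[OF yM])
  finally have "pushforward S (\<lambda>y. snd (fst y)) y (kk_ZP M g Z ham \<eta> y) = 2 *\<^sub>R reeb_field S J (snd (fst y))"
    using F by (simp add: kk_ZP_def horizontal_lift_def Let_def pushforward_add pushforward_diff pushforward_scaleR)
  then have "2 *\<^sub>R reeb_field S J (snd (fst y)) = pushforward S (\<lambda>p. p) (snd (fst y)) ?u"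
    using pushforward_P_base[OF w(1)] w(2) by simp
  then have "reeb_field S J (snd (fst y)) = (1/2) *\<^sub>R pushforward S (\<lambda>p. p) (snd (fst y)) ?u"
    using scaleR_scaleR[of "1/2" 2 "reeb_field S J (snd (fst y))"] by simp
  also have "\<dots> = pushforward S (\<lambda>p. p) (snd (fst y)) ((1/2) *\<^sub>R ?u)"
    by (simp add: pushforward_scaleR)
  finally show False
    using trans q subspace_scale[OF subspace_tangent[OF manifold_N q] u] unfolding transversal_def by blast
qed

lemma slice_map: "smooth_map N M (\<lambda>q. (1, q))"
  unfolding cone_atlas_def
  by (intro smooth_map_Pair manifold_open manifold_N manifold_S smooth_map_const inclusion) simp_all

lemma base_vector:
  assumes u: "u \<in> tangent_space N q"
  shows "pushforward M (\<lambda>q. (1, q)) q u \<in> T (1, q)"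
    and "pushforward S snd (1, q) (pushforward M (\<lambda>q. (1, q)) q u) = pushforward S (\<lambda>p. p) q u"
proof -
  show "pushforward M (\<lambda>q. (1, q)) q u \<in> T (1, q)"
    by (rule pushforward_tangent[OF manifold_N manifold_M slice_map u])
  show "pushforward S snd (1, q) (pushforward M (\<lambda>q. (1, q)) q u) = pushforward S (\<lambda>p. p) q u"
    using pushforward_compose[OF manifold_M manifold_S smooth_map_base, of "\<lambda>q. (1, q)" q u]
      smooth_map_points[OF slice_map tangent_points[OF u]] by simp
qed

lemma eta_N_apply:
  "u \<in> tangent_space N q \<Longrightarrow> \<eta>N q u = lam * gS q (reeb_field S J q) (pushforward S (\<lambda>p. p) q u)"
  using contact_form_apply[OF base_vector(1)] base_vector(2) by (simp add: pullback1_def)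

lemma g_N_apply:
  assumes "u \<in> tangent_space N q" "w \<in> tangent_space N q"
  shows "gN q u w = gS q (pushforward S (\<lambda>p. p) q u) (pushforward S (\<lambda>p. p) q w) - lam * (\<eta>N q u * \<eta>N q w)"
  using transverse_metric_apply[OF base_vector(1)[OF assms(1)] base_vector(1)[OF assms(2)]]
    base_vector(2)[OF assms(1)] base_vector(2)[OF assms(2)]
  by (simp add: pullback1_def pullback2_def)

lemma one_form_eta_N: "one_form N \<eta>N"
  by (rule one_form_pullback[OF manifold_N manifold_M slice_map one_form_contact])

lemma tensor_g_N: "smooth_tensor2 N gN"
  by (rule smooth_tensor2_pullback[OF manifold_N manifold_M slice_map tensor_transverse])

lemma g_N_symmetric:
  assumes "u \<in> tangent_space N q" "w \<in> tangent_space N q" shows "gN q u w = gN q w u"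
  using g_N_apply[OF assms] g_N_apply[OF assms(2,1)]
    gS_symmetric[OF pushforward_tangent[OF manifold_N manifold_S inclusion assms(1)]
      pushforward_tangent[OF manifold_N manifold_S inclusion assms(2)]] by simp

end

section \<open>The product of an interval, a circle and a manifold\<close>

locale product_chart =
  fixes N :: "('p::topological_space, 'b::real_inner) atlas" and I :: "real set"
  assumes manifold_base: "manifold N" and open_I: "open I"
begin

abbreviation "K \<equiv> KKM I N"
abbreviation "\<theta> \<equiv> \<lambda>x::real \<times> complex \<times> 'p. fst (snd x)"

lemma base_proj_eq: "base_proj = (\<lambda>x. snd (snd x))"
  by (auto simp: base_proj_def fun_eq_iff)

lemma manifold_Q: "manifold (prod_atlas circle_atlas N)"
  by (intro manifold_prod manifold_circle manifold_base)

lemma manifold_I: "manifold (open_atlas I)"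
  by (rule manifold_open[OF open_I])

lemma manifold_K: "manifold K"
  unfolding KKM_def by (intro manifold_prod manifold_I manifold_Q)

lemma points_K: "points K = I \<times> sphere 0 1 \<times> points N"
  by (simp add: KKM_def points_prod)

lemma K_rho: "smooth_map K (open_atlas I) fst"
  unfolding KKM_def by (intro smooth_map_fst manifold_I manifold_Q)

lemma K_snd: "smooth_map K (prod_atlas circle_atlas N) snd"
  unfolding KKM_def by (intro smooth_map_snd manifold_I manifold_Q)

lemma K_angle: "smooth_map K circle_atlas \<theta>"
  by (rule smooth_map_compose[OF manifold_K manifold_Q manifold_circle K_snd smooth_map_fst[OF manifold_circle manifold_base]])

lemma K_base: "smooth_map K N base_proj"
  unfolding base_proj_eq
  by (rule smooth_map_compose[OF manifold_K manifold_Q manifold_base K_snd smooth_map_snd[OF manifold_circle manifold_base]])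

lemma rho_in_I: "x \<in> points K \<Longrightarrow> fst x \<in> I"
  by (auto simp: points_K)

lemma smooth_fn_rho: "smooth_fn K (points K) fst"
  using K_rho smooth_map_open_iff[OF manifold_K open_I] by blast

lemma smooth_fn_affine_rho: "smooth_fn K (points K) (\<lambda>x. a * (fst x + b))"
  by (intro smooth_fn_mult smooth_fn_add smooth_fn_const smooth_fn_rho manifold_K open_in_points)

lemma dphi_angle:
  assumes v: "v \<in> tangent_space K x" shows "dphi x v = - 4 * angle_form \<theta> x v"
  using tangent_scale[OF manifold_K v angle_smooth_at[OF manifold_K K_angle tangent_points[OF v]], of "-4"]
  by (simp add: dphi_def angle_form_def)

lemma K_tangent_eqI:
  assumes v: "v \<in> tangent_space K x" and w: "w \<in> tangent_space K x"
    and 1: "v fst = w fst" and 2: "angle_form \<theta> x v = angle_form \<theta> x w"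
    and 3: "pushforward N base_proj x v = pushforward N base_proj x w"
  shows "v = w"
proof (rule tangent_prod_eqI[OF manifold_I manifold_Q v[unfolded KKM_def] w[unfolded KKM_def]])
  note x = tangent_points[OF v]
  have chart: "(I, \<lambda>x. x) \<in> open_atlas I" by (simp add: open_atlas_def)
  have id: "smooth_at (open_atlas I) (fst x) (\<lambda>x. x)"
    by (rule smooth_atI[OF smooth_fn_open_atlas[OF open_I smooth_on_id[OF open_I]] rho_in_I[OF x]])
  show "pushforward (open_atlas I) fst x v = pushforward (open_atlas I) fst x w"
    by (rule tangent_real_chart_eqI[OF manifold_I chart rho_in_I[OF x]
          pushforward_tangent[OF manifold_K manifold_I K_rho v] pushforward_tangent[OF manifold_K manifold_I K_rho w]])
      (simp add: pushforward_apply[where F = fst and p = x, OF id] 1)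
  have tQ: "pushforward (prod_atlas circle_atlas N) snd x u \<in> tangent_space (prod_atlas circle_atlas N) (snd x)"
    if "u \<in> tangent_space K x" for u
    by (rule pushforward_tangent[OF manifold_K manifold_Q K_snd that])
  note xQ = smooth_map_points[OF K_snd x]
  show "pushforward (prod_atlas circle_atlas N) snd x v = pushforward (prod_atlas circle_atlas N) snd x w"
  proof (rule tangent_prod_eqI[OF manifold_circle manifold_base tQ[OF v] tQ[OF w]])
    have z: "norm (\<theta> x) = 1" by (rule angle_norm[OF manifold_K K_angle x])
    have c: "(sphere 0 1 - {- \<theta> x}, \<lambda>u. Arg (u / \<theta> x)) \<in> circle_atlas" "\<theta> x \<in> sphere 0 1 - {- \<theta> x}"
      unfolding circle_atlas_iff using z angle_nonantipodal[OF manifold_K K_angle x] by auto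
    have s: "smooth_at circle_atlas (\<theta> x) (\<lambda>u. Arg (u / \<theta> x))"
      by (rule smooth_atI[OF smooth_fn_Arg[OF z] c(2)])
    have *: "pushforward circle_atlas fst (snd x) (pushforward (prod_atlas circle_atlas N) snd x u) = pushforward circle_atlas \<theta> x u" for u
      by (rule pushforward_compose[where F = snd and p = x, OF manifold_Q manifold_circle smooth_map_fst[OF manifold_circle manifold_base] xQ])
    show "pushforward circle_atlas fst (snd x) (pushforward (prod_atlas circle_atlas N) snd x v) =
        pushforward circle_atlas fst (snd x) (pushforward (prod_atlas circle_atlas N) snd x w)"
      unfolding *
      by (rule tangent_real_chart_eqI[OF manifold_circle c
            pushforward_tangent[OF manifold_K manifold_circle K_angle v] pushforward_tangent[OF manifold_K manifold_circle K_angle w]])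
        (use 2 in \<open>simp add: pushforward_apply[where F = \<theta> and p = x, OF s] angle_form_def\<close>)
    have "pushforward N snd (snd x) (pushforward (prod_atlas circle_atlas N) snd x u) = pushforward N base_proj x u" for u
      unfolding base_proj_eq
      by (rule pushforward_compose[where F = snd and p = x, OF manifold_Q manifold_base smooth_map_snd[OF manifold_circle manifold_base] xQ])
    then show "pushforward N snd (snd x) (pushforward (prod_atlas circle_atlas N) snd x v) =
        pushforward N snd (snd x) (pushforward (prod_atlas circle_atlas N) snd x w)"
      using 3 by simp
  qed
qed

lemma pushed_coordinates:
  assumes A: "manifold A" and F: "smooth_map A K F" and v: "v \<in> tangent_space A p"
  shows "pushforward K F p v \<in> tangent_space K (F p)"
    and "pushforward K F p v fst = v (\<lambda>y. fst (F y))"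
    and "angle_form \<theta> (F p) (pushforward K F p v) = angle_form (\<lambda>y. \<theta> (F y)) p v"
    and "pushforward N base_proj (F p) (pushforward K F p v) = pushforward N (\<lambda>y. base_proj (F y)) p v"
proof -
  note Fp = smooth_map_points[OF F tangent_points[OF v]]
  show "pushforward K F p v \<in> tangent_space K (F p)"
    by (rule pushforward_tangent[OF A manifold_K F v])
  show "pushforward K F p v fst = v (\<lambda>y. fst (F y))"
    by (rule pushforward_apply[where F = F and p = p, OF smooth_atI[OF smooth_fn_rho Fp]])
  show "angle_form \<theta> (F p) (pushforward K F p v) = angle_form (\<lambda>y. \<theta> (F y)) p v"
    by (rule angle_form_pushforward[where F = F and p = p, OF manifold_K K_angle Fp])
  show "pushforward N base_proj (F p) (pushforward K F p v) = pushforward N (\<lambda>y. base_proj (F y)) p v"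
    by (rule pushforward_compose[where F = F and p = p, OF manifold_K manifold_base K_base Fp])
qed

text \<open>
  The next three lemmas provide \<open>\<partial>\<^sub>\<rho>\<close>, multiples of \<open>\<partial>\<^sub>s\<close>, and the lift of a vector of \<open>N\<close> to the slice of
  constant \<open>\<rho>\<close> and \<open>s\<close>, characterized by their coordinates in the sense of \<open>K_tangent_eqI\<close>.
\<close>

lemma rho_vector:
  assumes x: "x \<in> points K"
  obtains e where "e \<in> tangent_space K x" "e fst = 1" "angle_form \<theta> x e = 0" "pushforward N base_proj x e = 0"
proof -
  have chart: "(I, \<lambda>x. x) \<in> open_atlas I" by (simp add: open_atlas_def)
  let ?v = "chart_vec (open_atlas I) I (\<lambda>x. x) 1 (fst x)"
  have v: "?v \<in> tangent_space (open_atlas I) (fst x)"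
    by (rule chart_vec_tangent[OF manifold_I chart rho_in_I[OF x]])
  have 1: "?v (\<lambda>x. x) = 1"
    using chart_vec_coordinate[OF manifold_I chart rho_in_I[OF x], of 1 1] by simp
  have F: "smooth_map (open_atlas I) K (\<lambda>\<rho>. (\<rho>, snd x))"
    unfolding KKM_def by (rule smooth_map_Pair_left[OF manifold_I manifold_Q smooth_map_points[OF K_snd x]])
  note pc = pushed_coordinates[OF manifold_I F v]
  show thesis
  proof (rule that)
    show "pushforward K (\<lambda>\<rho>. (\<rho>, snd x)) (fst x) ?v \<in> tangent_space K x" using pc(1) by simp
    show "pushforward K (\<lambda>\<rho>. (\<rho>, snd x)) (fst x) ?v fst = 1" using pc(2) 1 by simp
    show "angle_form \<theta> x (pushforward K (\<lambda>\<rho>. (\<rho>, snd x)) (fst x) ?v) = 0"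
      using pc(3) tangent_const[OF manifold_I v] by (simp add: angle_form_def)
    show "pushforward N base_proj x (pushforward K (\<lambda>\<rho>. (\<rho>, snd x)) (fst x) ?v) = 0"
      using pc(4) pushforward_const[OF manifold_I v, of N "snd (snd x)"] by (simp add: base_proj_eq)
  qed
qed

lemma angle_vector:
  assumes x: "x \<in> points K"
  obtains e where "e \<in> tangent_space K x" "e fst = 0" "angle_form \<theta> x e = a" "pushforward N base_proj x e = 0"
proof -
  let ?U = "sphere 0 1 - {- \<theta> x}" and ?\<phi> = "\<lambda>u. Arg (u / \<theta> x)"
  have z: "norm (\<theta> x) = 1" by (rule angle_norm[OF manifold_K K_angle x])
  have c: "(?U, ?\<phi>) \<in> circle_atlas" "\<theta> x \<in> ?U"
    unfolding circle_atlas_iff using z angle_nonantipodal[OF manifold_K K_angle x] by auto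
  let ?v = "chart_vec circle_atlas ?U ?\<phi> a (\<theta> x)"
  have v: "?v \<in> tangent_space circle_atlas (\<theta> x)"
    by (rule chart_vec_tangent[OF manifold_circle c])
  have 1: "?v ?\<phi> = a"
    using chart_vec_coordinate[OF manifold_circle c, of a 1] by simp
  have F: "smooth_map circle_atlas K (\<lambda>z. (fst x, (z, snd (snd x))))"
    unfolding KKM_def using x
    by (intro smooth_map_Pair manifold_I manifold_Q manifold_circle manifold_base smooth_map_ident smooth_map_const)
      (auto simp: points_K)
  note pc = pushed_coordinates[OF manifold_circle F v]
  let ?V = "pushforward K (\<lambda>z. (fst x, (z, snd (snd x)))) (\<theta> x) ?v"
  show thesis
  proof (rule that)
    show "?V \<in> tangent_space K x" using pc(1) by simp
    show "?V fst = 0" using pc(2) tangent_const[OF manifold_circle v] by simp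
    show "angle_form \<theta> x ?V = a" using pc(3) 1 by (simp add: angle_form_def)
    show "pushforward N base_proj x ?V = 0"
      using pc(4) pushforward_const[OF manifold_circle v, of N "snd (snd x)"] by (simp add: base_proj_eq)
  qed
qed

lemma base_vectors:
  assumes x: "x \<in> points K" and u: "u \<in> tangent_space N (base_proj x)"
  defines "v \<equiv> pushforward K (\<lambda>q. (fst x, (\<theta> x, q))) (base_proj x) u"
  shows "v \<in> tangent_space K x" "v fst = 0" "angle_form \<theta> x v = 0" "pushforward N base_proj x v = u"
proof -
  have F: "smooth_map N K (\<lambda>q. (fst x, (\<theta> x, q)))"
    unfolding KKM_def using x
    by (intro smooth_map_Pair manifold_I manifold_Q manifold_circle manifold_base smooth_map_ident smooth_map_const)
      (auto simp: points_K)
  have xx: "(fst x, (\<theta> x, base_proj x)) = x" by (simp add: base_proj_eq)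
  show "v \<in> tangent_space K x" "v fst = 0" "angle_form \<theta> x v = 0" "pushforward N base_proj x v = u"
    using pushed_coordinates[OF manifold_base F u, unfolded xx, folded v_def] tangent_const[OF manifold_base u]
      pushforward_ident[OF u] by (simp_all add: angle_form_def base_proj_def)
qed

end

section \<open>The explicit coordinates\<close>

locale kk_chart = kaehler_cone_hypersurface lam S gS J D N c + product_chart N I
  for lam :: real and S :: "('p::topological_space, 'e::real_inner) atlas" and gS :: "'p tensor2"
    and J :: "(real \<times> 'p) endo" and D :: "(real \<times> 'p) connection"
    and N :: "('p, 'b::real_inner) atlas" and c :: real and I :: "real set" +
  assumes I_radius: "\<rho> \<in> I \<Longrightarrow> lam * (\<rho> + c) > 0"
begin

abbreviation "rad \<equiv> \<lambda>x::real \<times> complex \<times> 'p. sqrt (lam * (fst x + c))"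

lemma embed_eq: "\<Phi> = (\<lambda>x. ((rad x, snd (snd x)), fst (snd x)))"
  by (auto simp: kk_embed_def fun_eq_iff)

lemma smooth_fn_rad: "smooth_fn K (points K) rad"
  by (rule smooth_fn_real_compose[OF manifold_K smooth_fn_affine_rho _ _ smooth_on_sqrt])
    (use I_radius rho_in_I in auto)

lemma K_rad: "smooth_map K (open_atlas {0<..}) rad"
  using smooth_fn_rad smooth_map_open_iff[OF manifold_K, of "{0<..}" rad] I_radius rho_in_I by auto

lemma embed_N': "smooth_map K N' \<Phi>"
  unfolding embed_eq circle_bundle_def cone_atlas_def
  by (intro smooth_map_Pair manifold_K manifold_prod manifold_open manifold_N manifold_circle K_rad K_angle
      K_base[unfolded base_proj_eq]) simp_all

lemma embed_P: "smooth_map K P \<Phi>"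
  by (rule smooth_map_compose[OF manifold_K manifold_N' manifold_P embed_N' N'_inclusion])

lemma embed_M: "smooth_map K M (\<lambda>x. fst (\<Phi> x))"
  by (rule smooth_map_compose[OF manifold_K manifold_P manifold_M embed_P smooth_map_P_fst])

lemma radius_square: "x \<in> points K \<Longrightarrow> (rad x)\<^sup>2 = lam * (fst x + c)"
  using I_radius[OF rho_in_I[of x]] by simp

lemma hamiltonian_embed: "x \<in> points K \<Longrightarrow> ham (fst (\<Phi> x)) = fst x"
  using hamiltonian[OF smooth_map_points[OF embed_M, of x]] radius_square[of x] by (simp add: embed_eq)

lemma image_embed: "\<Phi> ` points K = {y \<in> points N'. lam * (fst (fst y))\<^sup>2 - c \<in> I}"
proof (intro subset_antisym subsetI)
  fix y assume "y \<in> \<Phi> ` points K"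
  then obtain x where x: "x \<in> points K" "y = \<Phi> x" by blast
  have "y \<in> points N'" using smooth_map_points[OF embed_N' x(1)] x(2) by simp
  moreover have "lam * (fst (fst y))\<^sup>2 - c = fst x"
    using radius_square[OF x(1)] by (simp add: x(2) embed_eq)
  ultimately show "y \<in> {y \<in> points N'. lam * (fst (fst y))\<^sup>2 - c \<in> I}"
    using rho_in_I[OF x(1)] by simp
next
  fix y assume y: "y \<in> {y \<in> points N'. lam * (fst (fst y))\<^sup>2 - c \<in> I}"
  obtain r q z where yy: "y = ((r, q), z)" by (metis prod.collapse)
  have "r > 0" "q \<in> points N" "z \<in> sphere 0 1" "lam * r\<^sup>2 - c \<in> I"
    using y by (auto simp: points_N' yy)
  then show "y \<in> \<Phi> ` points K"
    by (intro image_eqI[of _ _ "(lam * r\<^sup>2 - c, z, q)"]) (auto simp: yy embed_eq points_K)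
qed

lemma N'_rho: "smooth_map N' (open_atlas UNIV) (\<lambda>y. lam * (fst (fst y))\<^sup>2 - c)"
proof -
  have r: "smooth_fn N' (points N') (\<lambda>y. fst (fst y))"
    using N'_radius smooth_map_open_iff[OF manifold_N', of "{0<..}" "\<lambda>y. fst (fst y)"] by simp
  have "smooth_fn N' (points N') (\<lambda>y. lam * (fst (fst y) * fst (fst y)) + (- c))"
    by (intro smooth_fn_add smooth_fn_mult smooth_fn_const manifold_N' open_in_points r)
  then show ?thesis
    using smooth_map_open_iff[OF manifold_N', of UNIV] by (simp add: power2_eq_square)
qed

lemma image_embed_open: "open_in N' (\<Phi> ` points K)"
  unfolding image_embed using smooth_map_preimage[OF N'_rho, of I] by (simp add: open_in_open_atlas open_I)

lemma diffeomorphism_embed: "diffeomorphism K (restrict_atlas N' (\<Phi> ` points K)) \<Phi>"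
  unfolding diffeomorphism_def
proof (intro conjI)
  let ?R = "restrict_atlas N' (\<Phi> ` points K)"
  let ?\<Psi> = "\<lambda>y. (lam * (fst (fst y))\<^sup>2 - c, (snd y, snd (fst y)))"
  show "manifold K" by (rule manifold_K)
  show R: "manifold ?R" by (rule manifold_restrict[OF manifold_N' image_embed_open])
  have pts: "points ?R = \<Phi> ` points K"
    using open_in_subset[OF image_embed_open] by (simp add: points_restrict Int_absorb1)
  have inv: "?\<Psi> (\<Phi> x) = x" if "x \<in> points K" for x
    using radius_square[OF that] by (simp add: embed_eq)
  have inj: "inj_on \<Phi> (points K)" by (rule inj_on_inverseI[where g = ?\<Psi>]) (rule inv)
  then show "bij_betw \<Phi> (points K) (points ?R)"
    unfolding pts by (rule inj_on_imp_bij_betw)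
  show "smooth_map K ?R \<Phi>"
    by (rule smooth_map_into_restrict[OF embed_N']) simp
  note res = smooth_map_from_restrict[OF manifold_N' image_embed_open]
  have "smooth_map ?R (open_atlas UNIV) (\<lambda>y. lam * (fst (fst y))\<^sup>2 - c)"
    by (rule res[OF N'_rho manifold_open[OF open_UNIV]])
  moreover have "(\<lambda>y. lam * (fst (fst y))\<^sup>2 - c) ` points ?R \<subseteq> I"
    unfolding pts unfolding image_embed by auto
  ultimately have "smooth_map ?R (open_atlas I) (\<lambda>y. lam * (fst (fst y))\<^sup>2 - c)"
    using smooth_map_open_iff[OF R open_UNIV] smooth_map_open_iff[OF R open_I] by simp
  then have "smooth_map ?R (prod_atlas (open_atlas I) (prod_atlas circle_atlas N)) ?\<Psi>"
    by (intro smooth_map_Pair R manifold_I manifold_Q manifold_circle manifold_N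
        res[OF N'_angle manifold_circle] res[OF N'_base manifold_N])
  then have "smooth_map ?R K ?\<Psi>" by (simp only: KKM_def)
  then show "smooth_map ?R K (inv_into (points K) \<Phi>)"
  proof (rule smooth_map_cong[OF R manifold_K])
    fix y assume "y \<in> points ?R"
    then obtain x where "x \<in> points K" "y = \<Phi> x" unfolding pts by blast
    then show "inv_into (points K) \<Phi> y = ?\<Psi> y"
      by (simp only: inv_into_f_f[OF inj] inv)
  qed
qed

subsection \<open>The metric in these coordinates\<close>

text \<open>
  Differentiating \<open>r\<^sup>2 = lam (\<rho> + c)\<close> avoids the derivative of the square root.
\<close>

lemma rad_differential:
  assumes v: "v \<in> tangent_space K x" shows "2 * rad x * v rad = lam * v fst"
proof -
  note x = tangent_points[OF v] and m = manifold_K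
  note r = smooth_atI[OF smooth_fn_rad x] and rho = smooth_atI[OF smooth_fn_rho x]
  have "v (\<lambda>x. rad x * rad x) = v (\<lambda>x. lam * fst x + lam * c)"
    by (rule tangent_local[OF m v open_in_points x])
      (use radius_square in \<open>simp add: power2_eq_square algebra_simps\<close>)
  then show ?thesis
    using tangent_mult[OF m v r r] tangent_scale[OF m v rho, of lam] tangent_const[OF m v, of "lam * c"]
      tangent_add[OF m v smooth_at_mult[OF m smooth_at_const[OF m x, of lam] rho] smooth_at_const[OF m x, of "lam * c"]]
    by simp
qed

text \<open>
  This reduces the tensor on \<open>P\<close> to the coordinates of \<open>v\<close>: it only involves the radial, the base and the
  angular component of the image of \<open>v\<close>.
\<close>

lemma embed_vector:
  assumes v: "v \<in> tangent_space K x"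
  defines "V \<equiv> pushforward P \<Phi> x v" and "u \<equiv> pushforward N base_proj x v" and "q \<equiv> base_proj x"
  shows "pushforward M fst (\<Phi> x) V \<in> T (fst (\<Phi> x))"
    and "pushforward M fst (\<Phi> x) V fst = v rad"
    and "pushforward S snd (fst (\<Phi> x)) (pushforward M fst (\<Phi> x) V) = pushforward S (\<lambda>p. p) q u"
    and "angle_form snd (\<Phi> x) V = angle_form \<theta> x v"
    and "u \<in> tangent_space N q"
proof -
  note x = tangent_points[OF v]
  note xP = smooth_map_points[OF embed_P x] and xM = smooth_map_points[OF embed_M x] and xN = smooth_map_points[OF K_base x]
  have M: "pushforward M fst (\<Phi> x) V = pushforward M (\<lambda>x. fst (\<Phi> x)) x v"
    unfolding V_def by (rule pushforward_compose[where F = \<Phi> and p = x, OF manifold_P manifold_M smooth_map_P_fst xP])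
  show "pushforward M fst (\<Phi> x) V \<in> T (fst (\<Phi> x))"
    unfolding M by (rule pushforward_tangent[OF manifold_K manifold_M embed_M v])
  show "pushforward M fst (\<Phi> x) V fst = v rad"
    unfolding M using pushforward_apply[where F = "\<lambda>x. fst (\<Phi> x)" and p = x and v = v, OF radius_smooth_at[OF xM]]
    by (simp add: embed_eq)
  show "pushforward S snd (fst (\<Phi> x)) (pushforward M fst (\<Phi> x) V) = pushforward S (\<lambda>p. p) q u"
    unfolding M u_def q_def pushforward_compose[where F = base_proj and p = x, OF manifold_N manifold_S inclusion xN]
      pushforward_compose[where F = "\<lambda>x. fst (\<Phi> x)" and p = x, OF manifold_M manifold_S smooth_map_base xM]
    by (simp add: embed_eq base_proj_eq)
  show "angle_form snd (\<Phi> x) V = angle_form \<theta> x v"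
    unfolding V_def using angle_form_pushforward[where F = \<Phi> and p = x and v = v, OF manifold_P smooth_map_P_snd xP]
    by (simp add: embed_eq)
  show "u \<in> tangent_space N q"
    unfolding u_def q_def by (rule pushforward_tangent[OF manifold_K manifold_N K_base v])
qed

text \<open>
  Here \<open>k = \<rho> + c = lam r\<^sup>2\<close> and \<open>m = \<rho> + 2 c = - f\<^sub>1\<close>; the letters \<open>a\<close>, \<open>s\<close>, \<open>e\<close> stand for the values of
  \<open>d\<rho>\<close>, \<open>ds\<close> and the contact form on one vector, the primed ones for those on the other, and \<open>G\<close> for the
  transverse part.  The left-hand side is \<open>(2 / f\<^sub>1) \<eta>\<^sup>2 + g - (2 / f) (\<theta>\<^sub>0\<^sup>2 + \<theta>\<^sub>1\<^sup>2)\<close>.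
\<close>

lemma explicit_metric_algebra:
  fixes k \<rho> m a a' s s' e e' G :: real
  assumes "k \<noteq> 0" "\<rho> \<noteq> 0" "m \<noteq> 0" "\<rho> = k - c" "m = k + c"
  shows "2 / (- m) * ((s - k * e / 2) * (s' - k * e' / 2)) + (a * a' / (4 * k) + G + k * (e * e'))
      - 2 / \<rho> * ((- a / 2) * (- a' / 2) + (s + k * e / 2) * (s' + k * e' / 2)) =
    G - 1 / (4 * \<rho>) * (m / k) * (a * a')
      - 1 / (4 * \<rho>) * (k / m) * ((- 4 * s - 2 * c * e) * (- 4 * s' - 2 * c * e'))"
proof -
  have "k - c \<noteq> 0" "k + c \<noteq> 0" using assms by auto
  with \<open>k \<noteq> 0\<close> show ?thesis
    unfolding assms(4,5) by (simp add: divide_simps) (simp add: algebra_simps)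
qed

lemma g'_explicit:
  assumes v: "v \<in> tangent_space K x" and w: "w \<in> tangent_space K x"
    and nz: "fst x \<noteq> 0" "fst x + 2 * c \<noteq> 0"
  shows "g' x v w = explicit_metric lam c N \<eta>N gN x v w"
proof -
  note x = tangent_points[OF v]
  define k where "k = fst x + c"
  have k: "lam * k > 0" "k \<noteq> 0" using I_radius[OF rho_in_I[OF x]] by (auto simp: k_def)
  define p where "p = fst (\<Phi> x)"
  have p: "p \<in> points M" "fst p = rad x" "snd p = base_proj x"
    using smooth_map_points[OF embed_M x] by (auto simp: p_def embed_eq base_proj_eq)
  have r2: "(fst p)\<^sup>2 = lam * k" using radius_square[OF x] by (simp add: p k_def)
  have r0: "fst p \<noteq> 0" using radius_positive[OF p(1)] by simp
  let ?V = "\<lambda>v. pushforward P \<Phi> x v" and ?u = "\<lambda>v. pushforward N base_proj x v" and ?q = "base_proj x"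
  let ?vM = "\<lambda>v. pushforward M fst (\<Phi> x) (?V v)"
  let ?e = "\<lambda>v. \<eta>N ?q (?u v)" and ?s = "\<lambda>v. angle_form \<theta> x v"
  have f: "ham p = fst x" "kk_f1 g Z ham p = - (fst x + 2 * c)"
    using hamiltonian_embed[OF x] hamiltonian_f1[OF p(1), of c] r2 by (simp_all add: p_def[symmetric] k_def)
  have gZ: "g p (Z p) (?vM v) = 2 * k * ?e v" if v: "v \<in> tangent_space K x" for v
  proof -
    note E = embed_vector[OF v, folded p_def]
    have "g p (Z p) (?vM v) = 2 * g p (J p (\<xi> p)) (?vM v)"
      using linear_on_scaleR[OF g_right[OF p(1) E(1)] J_euler_tangent[OF p(1)], of 2] by simp
    then show ?thesis
      using g_J_euler[OF E(1)] eta_N_apply[OF E(5)] by (simp add: E(3) r2 p(3))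
  qed
  have d: "?vM v ham = v fst" if v: "v \<in> tangent_space K x" for v
  proof -
    have "?vM v ham = lam * (2 * rad x * v rad)"
      using hamiltonian_differential[OF embed_vector(1)[OF v], of c]
      by (simp add: embed_vector(2)[OF v] p_def[symmetric] p(2))
    then show ?thesis unfolding rad_differential[OF v] by simp
  qed
  have gP: "g p (?vM v) (?vM w) = v fst * w fst / (4 * k) + lam * k * gN ?q (?u v) (?u w) + k * (?e v * ?e w)"
  proof -
    note E = embed_vector[OF v, folded p_def] and E' = embed_vector[OF w, folded p_def]
    have "v fst * w fst = 4 * (lam * k) * (v rad * w rad)"
    proof -
      have "v fst * w fst = (lam * v fst) * (lam * w fst)" using lam_cases by auto
      also have "\<dots> = (2 * fst p * v rad) * (2 * fst p * w rad)"
        using rad_differential[OF v] rad_differential[OF w] by (simp add: p(2))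
      also have "\<dots> = 4 * (fst p)\<^sup>2 * (v rad * w rad)" by (simp add: power2_eq_square)
      finally show ?thesis by (simp only: r2)
    qed
    then have 1: "lam * (v rad * w rad) = v fst * w fst / (4 * k)" using k(2) by (simp add: field_simps)
    have 2: "gS ?q (pushforward S (\<lambda>p. p) ?q (?u v)) (pushforward S (\<lambda>p. p) ?q (?u w)) =
        gN ?q (?u v) (?u w) + lam * (?e v * ?e w)"
      using g_N_apply[OF E(5) E'(5)] by simp
    have "g p (?vM v) (?vM w) = lam * (v rad * w rad) + lam * k * (gN ?q (?u v) (?u w) + lam * (?e v * ?e w))"
      by (simp add: g_apply E(2,3) E'(2,3) p(3) r2 2)
    also have "lam * k * (gN ?q (?u v) (?u w) + lam * (?e v * ?e w)) = lam * k * gN ?q (?u v) (?u w) + k * (?e v * ?e w)"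
      using lam_cases by (auto simp: algebra_simps)
    finally show ?thesis using 1 by simp
  qed
  have "g' x v w = 1 / (2 * \<bar>fst x\<bar>) * (2 / (- (fst x + 2 * c)) * ((?s v - k * ?e v / 2) * (?s w - k * ?e w / 2)) +
      (v fst * w fst / (4 * k) + lam * k * gN ?q (?u v) (?u w) + k * (?e v * ?e w)) -
      2 / fst x * ((- v fst / 2) * (- w fst / 2) + (?s v + k * ?e v / 2) * (?s w + k * ?e w / 2)))"
  proof -
    have eta: "\<eta> (\<Phi> x) (?V v) = ?s v - k * ?e v / 2" if v: "v \<in> tangent_space K x" for v
      using gZ[OF v] embed_vector(4)[OF v] by (simp add: kk_eta_eq pullback1_def p_def)
    have t0: "kk_theta0 M ham (\<Phi> x) (?V v) = - v fst / 2" if v: "v \<in> tangent_space K x" for v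
      using d[OF v] by (simp add: kk_theta0_def pullback1_def)
    have t1: "kk_theta1 M g Z \<eta> (\<Phi> x) (?V v) = ?s v + k * ?e v / 2" if v: "v \<in> tangent_space K x" for v
      using gZ[OF v] eta[OF v] by (simp add: kk_theta1_def pullback1_def p_def)
    show ?thesis
      unfolding pullback2_def[of P] kk_tensor_def kk_gP_tilde_def kk_gP_def eta[OF v] eta[OF w] t0[OF v] t0[OF w]
        t1[OF v] t1[OF w] pullback2_def[of M fst] p_def[symmetric] f gP ..
  qed
  also have "\<dots> = explicit_metric lam c N \<eta>N gN x v w"
    unfolding explicit_metric_def Let_def dphi_angle[OF v] dphi_angle[OF w] drho_def
      pullback1_def[of N base_proj] pullback2_def[of N base_proj] k_def[symmetric]
    by (rule arg_cong[where f = "\<lambda>t. 1 / (2 * \<bar>fst x\<bar>) * t"], rule explicit_metric_algebra)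
      (use k(2) nz in \<open>simp_all add: k_def\<close>)
  finally show ?thesis .
qed

end

section \<open>Signature and the undeformed case\<close>

context kk_chart
begin

lemma explicit_coordinates:
  assumes "v \<in> tangent_space K x" "w \<in> tangent_space K x"
  defines "A \<equiv> \<lambda>v. - 4 * angle_form \<theta> x v - 2 * c * \<eta>N (base_proj x) (pushforward N base_proj x v)"
  shows "explicit_metric lam c N \<eta>N gN x v w = 1 / (2 * \<bar>fst x\<bar>) *
    (lam * (fst x + c) * gN (base_proj x) (pushforward N base_proj x v) (pushforward N base_proj x w)
     - 1 / (4 * fst x) * ((fst x + 2 * c) / (fst x + c)) * (v fst * w fst)
     - 1 / (4 * fst x) * ((fst x + c) / (fst x + 2 * c)) * (A v * A w))"
  unfolding explicit_metric_def Let_def A_def dphi_angle[OF assms(1)] dphi_angle[OF assms(2)] drho_def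
    pullback1_def[of N base_proj] pullback2_def[of N base_proj] ..

lemma base_vector_tangent: "v \<in> tangent_space K x \<Longrightarrow> pushforward N base_proj x v \<in> tangent_space N (base_proj x)"
  by (rule pushforward_tangent[OF manifold_K manifold_N K_base])

context
  assumes nonzero: "\<And>\<rho>. \<rho> \<in> I \<Longrightarrow> \<rho> \<noteq> 0 \<and> \<rho> + 2 * c \<noteq> 0"
begin

lemma I_nonzero: "x \<in> points K \<Longrightarrow> fst x \<noteq> 0" "x \<in> points K \<Longrightarrow> fst x + 2 * c \<noteq> 0" "x \<in> points K \<Longrightarrow> fst x + c \<noteq> 0"
  using nonzero[OF rho_in_I] I_radius[OF rho_in_I, of x] by auto

lemma g'_eq:
  assumes "v \<in> tangent_space K x" "w \<in> tangent_space K x"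
  shows "g' x v w = explicit_metric lam c N \<eta>N gN x v w"
  by (rule g'_explicit[OF assms]) (use I_nonzero tangent_points[OF assms(1)] in auto)

text \<open>
  On tangent vectors \<open>g'\<close> agrees with the explicit expression, whose coefficients are smooth; \<open>\<bar>\<rho>\<bar>\<close> is
  written as \<open>sqrt (\<rho> \<rho>)\<close>, which is smooth away from \<open>0\<close> whatever the sign of \<open>\<rho>\<close>.
\<close>

lemma tensor_g': "smooth_tensor2 K g'"
proof -
  let ?h = "\<lambda>x::real \<times> complex \<times> 'p. 1 / (2 * sqrt (fst x * fst x))"
  let ?h1 = "\<lambda>x. ?h x * (lam * (fst x + c))"
    and ?h2 = "\<lambda>x. ?h x * (- 1 / (4 * (fst x)) * ((fst x + 2 * c) / (fst x + c)))"
    and ?h3 = "\<lambda>x. ?h x * (- 1 / (4 * (fst x)) * ((fst x + c) / (fst x + 2 * c)))"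
  let ?\<beta> = "\<lambda>x v. - 4 * angle_form \<theta> x v + (- 2 * c * pullback1 N base_proj \<eta>N x v + 0)"
  have rho: "smooth_fn K (points K) (\<lambda>x. fst x + b)" for b
    by (intro smooth_fn_add smooth_fn_const smooth_fn_rho manifold_K open_in_points)
  have const: "smooth_fn K (points K) (\<lambda>x. a)" for a
    by (rule smooth_fn_const[OF manifold_K open_in_points])
  have "smooth_fn K (points K) (\<lambda>x. sqrt (fst x * fst x))"
    by (rule smooth_fn_real_compose[OF manifold_K smooth_fn_mult[OF manifold_K smooth_fn_rho smooth_fn_rho] _ _ smooth_on_sqrt])
      (use I_nonzero(1) in \<open>auto simp flip: power2_eq_square\<close>)
  then have h: "smooth_fn K (points K) ?h"
    by (intro smooth_fn_divide[OF manifold_K] smooth_fn_mult[OF manifold_K] const) (use I_nonzero(1) in auto)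
  have 1: "smooth_fn K (points K) ?h1"
    by (intro smooth_fn_mult[OF manifold_K] h const rho)
  have 2: "smooth_fn K (points K) ?h2"
    by (intro smooth_fn_mult[OF manifold_K] smooth_fn_divide[OF manifold_K] h const rho smooth_fn_rho)
      (use I_nonzero in auto)
  have 3: "smooth_fn K (points K) ?h3"
    by (intro smooth_fn_mult[OF manifold_K] smooth_fn_divide[OF manifold_K] h const rho smooth_fn_rho)
      (use I_nonzero in auto)
  have \<beta>: "one_form K ?\<beta>"
    by (intro one_form_lincomb[where h = "\<lambda>x. - 4"] one_form_lincomb[where h = "\<lambda>x. - 2 * c"] one_form_zero manifold_K const
        one_form_angle[OF manifold_K K_angle] one_form_pullback[OF manifold_K manifold_N K_base one_form_eta_N])
  have "smooth_tensor2 K (\<lambda>x v w. ?h1 x * pullback2 N base_proj gN x v w +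
      (?h2 x * (v fst * w fst) + (?h3 x * (?\<beta> x v * ?\<beta> x w) + 0)))"
    by (intro smooth_tensor2_lincomb[where h = ?h1] smooth_tensor2_lincomb[where h = ?h2] smooth_tensor2_lincomb[where h = ?h3]
        smooth_tensor2_zero manifold_K 1 2 3 smooth_tensor2_pullback[OF manifold_K manifold_N K_base tensor_g_N]
        smooth_tensor2_product[OF manifold_K] one_form_differential smooth_fn_rho \<beta>)
  moreover have alg: "h * (X * G - R * A * a - R * B * ((s - 2 * c * e) * (s' - 2 * c * e'))) =
      h * X * G + (h * (R' * A) * a + (h * (R' * B) * ((s + (- 2 * c * e + 0)) * (s' + (- 2 * c * e' + 0))) + 0))"
    if "R' = - R" for h X G R R' A B a s e s' e' :: real
    unfolding that by (simp add: algebra_simps)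
  ultimately show ?thesis
  proof (elim smooth_tensor2_cong[OF manifold_K])
    fix x v w assume v: "v \<in> tangent_space K x" and w: "w \<in> tangent_space K x"
    show "g' x v w = ?h1 x * pullback2 N base_proj gN x v w +
      (?h2 x * (v fst * w fst) + (?h3 x * (?\<beta> x v * ?\<beta> x w) + 0))"
      unfolding g'_eq[OF v w] explicit_coordinates[OF v w] pullback2_def[of N] pullback1_def[of N] real_sqrt_abs2
      by (rule alg) simp
  qed
qed

lemma g'_symmetric:
  assumes v: "v \<in> tangent_space K x" and w: "w \<in> tangent_space K x" shows "g' x v w = g' x w v"
  unfolding g'_eq[OF v w] g'_eq[OF w v] explicit_coordinates[OF v w] explicit_coordinates[OF w v]
    g_N_symmetric[OF base_vector_tangent[OF v] base_vector_tangent[OF w]]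
  by (simp only: mult.commute[of "v fst"] mult.commute[of "- 4 * angle_form \<theta> x v - 2 * c * \<eta>N (base_proj x) (pushforward N base_proj x v)"])

text \<open>
  The definite plane is spanned by \<open>\<partial>\<^sub>\<rho>\<close> and \<open>\<partial>\<^sub>\<phi>\<close>, and the lift of \<open>u\<close> orthogonal to it is
  \<open>u + 2 c \<eta>N(u) \<partial>\<^sub>\<phi>\<close>, since this is annihilated by \<open>d\<phi> - 2 c \<eta>N\<close>.
\<close>

lemma signature_g':
  assumes sig: "metric_signature N gN m n"
  shows "(\<And>\<rho>. \<rho> \<in> I \<Longrightarrow> (\<rho> + 2 * c) / (\<rho> * (\<rho> + c)) < 0) \<Longrightarrow> metric_signature K g' (m + 2) n"
    and "(\<And>\<rho>. \<rho> \<in> I \<Longrightarrow> (\<rho> + 2 * c) / (\<rho> * (\<rho> + c)) > 0) \<Longrightarrow> metric_signature K g' m (n + 2)"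
proof -
  have main: "((fst x + 2 * c) / (fst x * (fst x + c)) < 0 \<longrightarrow> has_signature (tangent_space K x) (g' x) (m + 2) n) \<and>
      ((fst x + 2 * c) / (fst x * (fst x + c)) > 0 \<longrightarrow> has_signature (tangent_space K x) (g' x) m (n + 2))"
    if x: "x \<in> points K" for x
  proof -
    let ?q = "base_proj x" and ?\<rho> = "fst x"
    let ?V = "tangent_space K x" and ?W = "tangent_space N ?q"
    note xN = smooth_map_points[OF K_base x]
    note V = subspace_tangent[OF manifold_K x] and W = subspace_tangent[OF manifold_N xN]
    obtain e1 where e1: "e1 \<in> ?V" "e1 fst = 1" "angle_form \<theta> x e1 = 0" "pushforward N base_proj x e1 = 0"
      by (rule rho_vector[OF x])
    \<comment> \<open>\<open>\<partial>\<^sub>\<phi>\<close>, because \<open>\<phi> = - 4 s\<close>\<close>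
    obtain e2 where e2: "e2 \<in> ?V" "e2 fst = 0" "angle_form \<theta> x e2 = - 1 / 4" "pushforward N base_proj x e2 = 0"
      by (rule angle_vector[OF x])
    let ?F = "pushforward K (\<lambda>q. (fst x, (\<theta> x, q))) ?q"
    let ?L = "\<lambda>u. ?F u + (2 * c * \<eta>N ?q u) *\<^sub>R e2"
    note F = base_vectors[OF x]
    have L: "?L u \<in> ?V" "?L u fst = 0" "angle_form \<theta> x (?L u) = - (c * \<eta>N ?q u / 2)" "pushforward N base_proj x (?L u) = u"
      if u: "u \<in> ?W" for u
    proof -
      show "?L u \<in> ?V" by (intro subspace_add[OF V] subspace_scale[OF V] F(1)[OF u] e2(1))
      show "?L u fst = 0" using F(2)[OF u] e2(2) by (simp add: scaleR_fun_def)
      show "angle_form \<theta> x (?L u) = - (c * \<eta>N ?q u / 2)"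
        using F(3)[OF u] e2(3) by (simp add: angle_form_def scaleR_fun_def)
      show "pushforward N base_proj x (?L u) = u"
        using F(4)[OF u] e2(4) by (simp add: pushforward_add pushforward_scaleR)
    qed
    have eta0: "\<eta>N ?q 0 = 0"
      using linear_on_zero[OF one_form_linear[OF one_form_eta_N xN] subspace_0[OF W]] .
    have gN0: "gN ?q 0 u = 0" "gN ?q u 0 = 0" if u: "u \<in> ?W" for u
      using linear_on_zero[OF bilinear_on_right[OF tensor_bilinear[OF tensor_g_N xN] u] u]
        linear_on_zero[OF bilinear_on_left[OF tensor_bilinear[OF tensor_g_N xN] u] u] by auto
    have g: "g' x v w = 1 / (2 * \<bar>?\<rho>\<bar>) *
      (lam * (?\<rho> + c) * gN ?q (pushforward N base_proj x v) (pushforward N base_proj x w)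
       - 1 / (4 * ?\<rho>) * ((?\<rho> + 2 * c) / (?\<rho> + c)) * (v fst * w fst)
       - 1 / (4 * ?\<rho>) * ((?\<rho> + c) / (?\<rho> + 2 * c)) *
         ((- 4 * angle_form \<theta> x v - 2 * c * \<eta>N ?q (pushforward N base_proj x v)) *
          (- 4 * angle_form \<theta> x w - 2 * c * \<eta>N ?q (pushforward N base_proj x w))))"
      if "v \<in> ?V" "w \<in> ?V" for v w
      unfolding g'_eq[OF that] by (rule explicit_coordinates[OF that])
    have s: "lam * (?\<rho> + c) / (2 * \<bar>?\<rho>\<bar>) > 0"
      using I_radius[OF rho_in_I[OF x]] I_nonzero(1)[OF x] by simp
    have gL: "g' x (?L u) (?L u') = lam * (?\<rho> + c) / (2 * \<bar>?\<rho>\<bar>) * gN ?q u u'" if "u \<in> ?W" "u' \<in> ?W" for u u'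
      unfolding g[OF L(1)[OF that(1)] L(1)[OF that(2)]] L(2-4)[OF that(1)] L(2-4)[OF that(2)] by simp
    have g12: "g' x e1 e2 = 0"
      unfolding g[OF e1(1) e2(1)] e1(2-4) e2(2-4) using gN0[OF subspace_0[OF W]] eta0 by simp
    have g1L: "g' x e1 (?L u) = 0" if "u \<in> ?W" for u
      unfolding g[OF e1(1) L(1)[OF that]] e1(2-4) L(2-4)[OF that] using gN0[OF that] eta0 by simp
    have g2L: "g' x e2 (?L u) = 0" if "u \<in> ?W" for u
      unfolding g[OF e2(1) L(1)[OF that]] e2(2-4) L(2-4)[OF that] using gN0[OF that] eta0 by simp
    define r where "r = (?\<rho> + 2 * c) / (?\<rho> * (?\<rho> + c))"
    have pos: "1 / (8 * \<bar>?\<rho>\<bar>) > 0" "(1 / (8 * \<bar>?\<rho>\<bar>)) * ((?\<rho> + c) / (?\<rho> + 2 * c))\<^sup>2 > 0"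
      using I_nonzero[OF x] by simp_all
    have g11: "g' x e1 e1 = - r * (1 / (8 * \<bar>?\<rho>\<bar>))"
      unfolding g[OF e1(1) e1(1)] e1(2-4) using gN0[OF subspace_0[OF W]] eta0 by (simp add: r_def)
    have g22: "g' x e2 e2 = - r * ((1 / (8 * \<bar>?\<rho>\<bar>)) * ((?\<rho> + c) / (?\<rho> + 2 * c))\<^sup>2)"
      unfolding g[OF e2(1) e2(1)] e2(2-4) using gN0[OF subspace_0[OF W]] eta0 I_nonzero[OF x]
      by (simp add: r_def power2_eq_square)
    have linL: "linear_on ?W ?L"
      using one_form_linear[OF one_form_eta_N xN]
      by (simp add: linear_on_def pushforward_add pushforward_scaleR scaleR_add_left algebra_simps)
    have split: "\<exists>u\<in>?W. \<exists>a b. v = ?L u + a *\<^sub>R e1 + b *\<^sub>R e2" if v: "v \<in> ?V" for v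
    proof -
      define u where "u = pushforward N base_proj x v"
      have u: "u \<in> ?W" unfolding u_def by (rule base_vector_tangent[OF v])
      define b where "b = - 4 * angle_form \<theta> x v - 2 * c * \<eta>N ?q u"
      have "v = ?L u + v fst *\<^sub>R e1 + b *\<^sub>R e2"
      proof (rule K_tangent_eqI[OF v])
        show "?L u + v fst *\<^sub>R e1 + b *\<^sub>R e2 \<in> ?V"
          by (intro subspace_add[OF V] subspace_scale[OF V] L(1)[OF u] e1(1) e2(1))
        show "v fst = (?L u + v fst *\<^sub>R e1 + b *\<^sub>R e2) fst"
          using L(2)[OF u] e1(2) e2(2) by (simp add: scaleR_fun_def)
        show "angle_form \<theta> x v = angle_form \<theta> x (?L u + v fst *\<^sub>R e1 + b *\<^sub>R e2)"
        proof -
          have "angle_form \<theta> x (?L u + v fst *\<^sub>R e1 + b *\<^sub>R e2) =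
              angle_form \<theta> x (?L u) + v fst * angle_form \<theta> x e1 + b * angle_form \<theta> x e2"
            by (simp add: angle_form_def scaleR_fun_def)
          then show ?thesis unfolding L(3)[OF u] e1(3) e2(3) by (simp add: b_def field_simps)
        qed
        show "pushforward N base_proj x v = pushforward N base_proj x (?L u + v fst *\<^sub>R e1 + b *\<^sub>R e2)"
          using L(4)[OF u] e1(4) e2(4) by (simp add: pushforward_add pushforward_scaleR u_def)
      qed
      then show ?thesis using u by blast
    qed
    have sigN: "has_signature ?W (gN ?q) m n"
      using sig xN by (simp add: metric_signature_def)
    note extend = has_signature_extend[where V = ?V and b = "g' x" and W = ?W and d = "gN ?q" and L = ?L
        and ?e1.0 = e1 and ?e2.0 = e2, OF V tensor_bilinear[OF tensor_g' x] _ W sigN linL _ s _ e1(1) e2(1) g12]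
    have "r < 0 \<longrightarrow> has_signature ?V (g' x) (m + 2) n"
    proof
      assume "r < 0"
      then have "g' x e1 e1 > 0" "g' x e2 e2 > 0"
        unfolding g11 g22 using pos by (simp_all only: mult_pos_pos neg_0_less_iff_less)
      then show "has_signature ?V (g' x) (m + 2) n" 
        by (intro extend(1)) (erule (1) g'_symmetric, erule L(1), erule (1) gL, erule g1L, erule g2L, erule split)
    qed
    moreover have "r > 0 \<longrightarrow> has_signature ?V (g' x) m (n + 2)"
    proof
      assume "r > 0"
      then have "g' x e1 e1 < 0" "g' x e2 e2 < 0"
        unfolding g11 g22 using pos by (simp_all only: mult_neg_pos neg_less_0_iff_less)
      then show "has_signature ?V (g' x) m (n + 2)" 
        by (intro extend(2)) (erule (1) g'_symmetric, erule L(1), erule (1) gL, erule g1L, erule g2L, erule split)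
    qed
    ultimately show ?thesis unfolding r_def by blast
  qed
  show "metric_signature K g' (m + 2) n" if "\<And>\<rho>. \<rho> \<in> I \<Longrightarrow> (\<rho> + 2 * c) / (\<rho> * (\<rho> + c)) < 0"
    unfolding metric_signature_def using main that[OF rho_in_I] by blast
  show "metric_signature K g' m (n + 2)" if "\<And>\<rho>. \<rho> \<in> I \<Longrightarrow> (\<rho> + 2 * c) / (\<rho> * (\<rho> + c)) > 0"
    unfolding metric_signature_def using main that[OF rho_in_I] by blast
qed

lemma pseudo_riemannian_g':
  assumes "metric_signature K g' m n" shows "pseudo_riemannian K g'"
  unfolding pseudo_riemannian_def
proof (intro conjI manifold_K tensor_g' ballI impI)
  fix x v assume x: "x \<in> points K" and v: "v \<in> tangent_space K x"
  show "g' x v w = g' x w v" if "w \<in> tangent_space K x" for w by (rule g'_symmetric[OF v that])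
  assume "\<forall>w\<in>tangent_space K x. g' x v w = 0"
  then show "v = 0"
    using has_signature_nondegenerate[OF subspace_tangent[OF manifold_K x] _ v] assms x
    unfolding metric_signature_def by blast
qed

end

abbreviation "h0 \<equiv> \<lambda>x v w. - lam * g_CH1 x v w + pullback2 N base_proj gN x v w"

lemma g'_undeformed:
  assumes c: "c = 0" and v: "v \<in> tangent_space K x" and w: "w \<in> tangent_space K x"
  shows "2 * g' x v w = h0 x v w"
proof -
  define \<rho> where "\<rho> = fst x"
  have pos: "lam * \<rho> > 0" "\<rho> \<noteq> 0"
    using I_radius[OF rho_in_I[OF tangent_points[OF v]]] c by (auto simp: \<rho>_def)
  have abs: "\<bar>\<rho>\<bar> = lam * \<rho>" using pos(1) lam_cases by auto
  have e: "g' x v w = explicit_metric lam c N \<eta>N gN x v w"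
    by (rule g'_explicit[OF v w]) (use pos(2) c in \<open>simp_all add: \<rho>_def\<close>)
  have alg: "2 * (1 / (2 * (lam * \<rho>)) * (lam * \<rho> * G - 1 / (4 * \<rho>) * (\<rho> / \<rho>) * a - 1 / (4 * \<rho>) * (\<rho> / \<rho>) * b)) =
      - lam * (1 / (4 * \<rho>\<^sup>2) * (a + b)) + G" for G a b
    using lam_cases pos(2) by (auto simp: field_simps power2_eq_square)
  show ?thesis
    unfolding e by (simp only: explicit_metric_def g_CH1_def Let_def \<rho>_def[symmetric] c abs
        mult_zero_right mult_zero_left add_0_right diff_zero alg)
qed

end

context kaehler_cone_hypersurface
begin

lemma I_signs:
  shows "\<rho> \<in> Iplus lam c \<Longrightarrow> lam * (\<rho> + c) > 0 \<and> \<rho> \<noteq> 0 \<and> \<rho> + 2 * c \<noteq> 0 \<and> (\<rho> + 2 * c) / (\<rho> * (\<rho> + c)) > 0"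
    and "\<rho> \<in> Iminus lam c \<Longrightarrow> lam * (\<rho> + c) > 0 \<and> \<rho> \<noteq> 0 \<and> \<rho> + 2 * c \<noteq> 0 \<and> (\<rho> + 2 * c) / (\<rho> * (\<rho> + c)) < 0"
  using lam_cases
  by (auto simp: Iplus_def Iminus_def zero_less_divide_iff divide_less_0_iff zero_less_mult_iff mult_less_0_iff
      split: if_splits)

lemma I_union: "lam * (\<rho> + c) > 0 \<Longrightarrow> \<rho> \<noteq> 0 \<Longrightarrow> \<rho> + 2 * c \<noteq> 0 \<Longrightarrow> \<rho> \<in> Iplus lam c \<union> Iminus lam c"
  using lam_cases by (auto simp: Iplus_def Iminus_def)

lemma regular_rho:
  assumes "lam * (\<rho> + c) > 0"
  shows "(\<rho> \<noteq> 0 \<and> - (\<rho> + 2 * c) \<noteq> 0) \<longleftrightarrow> \<rho> \<in> Iplus lam c \<union> Iminus lam c"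
proof
  assume "\<rho> \<noteq> 0 \<and> - (\<rho> + 2 * c) \<noteq> 0"
  then show "\<rho> \<in> Iplus lam c \<union> Iminus lam c" using I_union[OF assms] by simp
next
  assume "\<rho> \<in> Iplus lam c \<union> Iminus lam c"
  then have "\<rho> \<noteq> 0 \<and> \<rho> + 2 * c \<noteq> 0" using I_signs[of \<rho>] by blast
  then show "\<rho> \<noteq> 0 \<and> - (\<rho> + 2 * c) \<noteq> 0" by simp
qed

lemma I_disjoint: "Iplus lam c \<inter> Iminus lam c = {}"
  by (auto simp: Iplus_def Iminus_def)

lemma kk_chart_I: "I \<in> {Iplus lam c, Iminus lam c} \<Longrightarrow> kk_chart lam S gS J D N c I"
proof
  assume I: "I \<in> {Iplus lam c, Iminus lam c}"
  show "manifold N" by (rule manifold_N)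
  show "open I" using I by (auto simp: Iplus_def Iminus_def)
  show "\<And>\<rho>. \<rho> \<in> I \<Longrightarrow> 0 < lam * (\<rho> + c)" using I I_signs by blast
qed

lemma regular_points:
  "{y \<in> points N'. ham (fst y) \<noteq> 0 \<and> kk_f1 g Z ham (fst y) \<noteq> 0} =
    \<Phi> ` points (KKM (Iplus lam c) N) \<union> \<Phi> ` points (KKM (Iminus lam c) N)"
proof -
  interpret plus: kk_chart lam S gS J D N c "Iplus lam c" by (rule kk_chart_I) simp
  interpret minus: kk_chart lam S gS J D N c "Iminus lam c" by (rule kk_chart_I) simp
  have "(ham (fst y) \<noteq> 0 \<and> kk_f1 g Z ham (fst y) \<noteq> 0) \<longleftrightarrow> lam * (fst (fst y))\<^sup>2 - c \<in> Iplus lam c \<union> Iminus lam c"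
    if y: "y \<in> points N'" for y
  proof -
    have p: "fst y \<in> points M" "fst (fst y) > 0" using y points_N by (auto simp: points_N' points_M)
    let ?\<rho> = "lam * (fst (fst y))\<^sup>2 - c"
    have "lam * (?\<rho> + c) > 0" using p(2) by simp
    from regular_rho[OF this] have "(?\<rho> \<noteq> 0 \<and> - (?\<rho> + 2 * c) \<noteq> 0) \<longleftrightarrow> ?\<rho> \<in> Iplus lam c \<union> Iminus lam c" .
    moreover have "ham (fst y) = ?\<rho>" "kk_f1 g Z ham (fst y) = - (?\<rho> + 2 * c)"
      using hamiltonian[OF p(1)] hamiltonian_f1[OF p(1)] by simp_all
    ultimately show ?thesis by (simp only:)
  qed
  then show ?thesis
    unfolding plus.image_embed minus.image_embed by auto
qed

text \<open>
  For \<open>lam = 1\<close> the map is the identity, for \<open>lam = -1\<close> the reflection of \<open>\<rho>\<close>; the metric depends on \<open>\<rho>\<close> only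
  through \<open>\<rho>\<^sup>2\<close> and \<open>d\<rho>\<^sup>2\<close>.
\<close>

lemma undeformed_diffeomorphism:
  assumes c: "c = 0" and I: "I = {\<rho>. lam * \<rho> > 0}"
  defines "F \<equiv> \<lambda>x::real \<times> complex \<times> 'p. (lam * fst x, snd x)"
    and "h \<equiv> \<lambda>x v w. - lam * g_CH1 x v w + pullback2 N base_proj gN x v w"
  shows "diffeomorphism (KKM I N) (KKM {0<..} N) F"
    and "v \<in> tangent_space (KKM I N) x \<Longrightarrow> w \<in> tangent_space (KKM I N) x \<Longrightarrow>
      pullback2 (KKM {0<..} N) F h x v w = h x v w"
proof -
  have oI: "open I"
    unfolding I by (intro open_Collect_less continuous_intros)
  interpret K: product_chart N I by standard (rule manifold_N oI)+
  interpret K0: product_chart N "{0<..}" by standard (rule manifold_N open_greaterThan)+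
  have m: "smooth_map (KKM A N) (KKM B N) F" if "product_chart N A" "product_chart N B" "\<And>\<rho>. \<rho> \<in> A \<Longrightarrow> lam * \<rho> \<in> B" for A B
  proof -
    interpret A: product_chart N A by fact
    interpret B: product_chart N B by fact
    have "smooth_fn A.K (points A.K) (\<lambda>x. lam * (fst x + 0))" by (rule A.smooth_fn_affine_rho)
    then have "smooth_map A.K (open_atlas B) (\<lambda>x. lam * fst x)"
      using smooth_map_open_iff[OF A.manifold_K B.open_I] that(3) A.rho_in_I by auto
    then have "smooth_map A.K (prod_atlas (open_atlas B) (prod_atlas circle_atlas N)) F"
      unfolding F_def by (intro smooth_map_Pair A.manifold_K B.manifold_I A.manifold_Q A.K_snd)
    then show ?thesis by (simp only: KKM_def)
  qed
  have FI: "smooth_map K.K K0.K F" "smooth_map K0.K K.K F"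
    by (rule m[OF K.product_chart_axioms K0.product_chart_axioms], simp add: I)
      (rule m[OF K0.product_chart_axioms K.product_chart_axioms], simp add: I)
  have FF: "F (F x) = x" for x by (simp add: F_def)
  have inj: "inj_on F (points K.K)" by (rule inj_on_inverseI[where g = F]) (rule FF)
  have im: "F ` points K.K = points K0.K"
  proof
    show "F ` points K.K \<subseteq> points K0.K" using smooth_map_points[OF FI(1)] by blast
    show "points K0.K \<subseteq> F ` points K.K"
      using smooth_map_points[OF FI(2)] FF by (metis image_eqI subsetI)
  qed
  have "smooth_map K0.K K.K (inv_into (points K.K) F)"
  proof (rule smooth_map_cong[OF K0.manifold_K K.manifold_K FI(2)])
    fix y assume "y \<in> points K0.K"
    then have "F y \<in> points K.K" using smooth_map_points[OF FI(2)] by blast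
    then show "inv_into (points K.K) F y = F y" by (rule inv_into_f_eq[OF inj]) (rule FF)
  qed
  then show "diffeomorphism K.K K0.K F"
    unfolding diffeomorphism_def using K.manifold_K K0.manifold_K FI(1) inj im by (simp add: bij_betw_def)
  assume v: "v \<in> tangent_space K.K x" and w: "w \<in> tangent_space K.K x"
  note x = tangent_points[OF v]
  have coord: "drho (F x) (pushforward K0.K F x u) = lam * drho x u"
      "dphi (F x) (pushforward K0.K F x u) = dphi x u"
      "pushforward N base_proj (F x) (pushforward K0.K F x u) = pushforward N base_proj x u"
    if u: "u \<in> tangent_space K.K x" for u
  proof -
    note pc = K0.pushed_coordinates[OF K.manifold_K FI(1) u]
    show "drho (F x) (pushforward K0.K F x u) = lam * drho x u"
      using pc(2) tangent_scale[OF K.manifold_K u smooth_atI[OF K.smooth_fn_rho x], of lam]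
      by (simp add: drho_def F_def)
    show "dphi (F x) (pushforward K0.K F x u) = dphi x u"
      using pc(3) K.dphi_angle[OF u] K0.dphi_angle[OF pc(1)] by (simp add: F_def)
    show "pushforward N base_proj (F x) (pushforward K0.K F x u) = pushforward N base_proj x u"
      using pc(4) by (simp add: F_def base_proj_def[abs_def])
  qed
  have "base_proj (F x) = base_proj x" "(fst (F x))\<^sup>2 = (fst x)\<^sup>2" "lam * drho x v * (lam * drho x w) = drho x v * drho x w"
    using lam_cases by (auto simp: F_def base_proj_def power_mult_distrib)
  then show "pullback2 K0.K F h x v w = h x v w"
    unfolding pullback2_def[of K0.K] h_def g_CH1_def pullback2_def[of N] coord[OF v] coord[OF w] by simp
qed

end

theorem theorem4:
  fixes S :: "('p::topological_space, 'e::real_inner) atlas"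
    and N :: "('p, 'b::real_inner) atlas"
    and gS :: "'p tensor2"
    and J :: "(real \<times> 'p) endo"
    and D :: "(real \<times> 'p) connection"
    and lam c :: real
  defines "M \<equiv> cone_atlas S"
    and "g \<equiv> cone_metric lam S gS"
    and "\<xi> \<equiv> euler S"
  defines "Z \<equiv> (\<lambda>p. 2 *\<^sub>R J p (\<xi> p))"
    and "f \<equiv> (\<lambda>p. lam * (cone_radius g \<xi> p)\<^sup>2 - c)"
  defines "\<eta> \<equiv> kk_eta M g Z"
    and "P \<equiv> circle_bundle M"
    and "N' \<equiv> circle_bundle (cone_atlas N)"
    and "\<Phi> \<equiv> kk_embed lam c"
  defines "\<eta>N \<equiv> pullback1 M (\<lambda>q. (1, q)) (contact_form lam J g \<xi>)"
    and "gN \<equiv> pullback2 M (\<lambda>q. (1, q)) (transverse_metric lam J g \<xi>)"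
    and "g' \<equiv> pullback2 P \<Phi> (kk_tensor M g Z f \<eta>)"
  assumes cone: "pseudo_kaehler_cone lam S gS J D"
    and hypersurface: "hypersurface N S"
    and transversal: "transversal N S (reeb_field S J)"
  shows
   "(holomorphic_field M J Z \<and> kk_data M J g D Z f \<and> kk_connection M J g Z \<eta>) \<and>
    (hypersurface N' P \<and> transversal N' P (kk_ZP M g Z f \<eta>)) \<and>
    (Iplus lam c \<inter> Iminus lam c = {} \<and>
     {y \<in> points N'. f (fst y) \<noteq> 0 \<and> kk_f1 g Z f (fst y) \<noteq> 0} =
       \<Phi> ` points (KKM (Iplus lam c) N) \<union> \<Phi> ` points (KKM (Iminus lam c) N)) \<and>
    (\<forall>I\<in>{Iplus lam c, Iminus lam c}.
       open_in N' (\<Phi> ` points (KKM I N)) \<and>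
       diffeomorphism (KKM I N) (restrict_atlas N' (\<Phi> ` points (KKM I N))) \<Phi> \<and>
       (\<forall>x\<in>points (KKM I N). f (fst (\<Phi> x)) = fst x)) \<and>
    (\<forall>I\<in>{Iplus lam c, Iminus lam c}. \<forall>x\<in>points (KKM I N).
       \<forall>v\<in>tangent_space (KKM I N) x. \<forall>w\<in>tangent_space (KKM I N) x.
         g' x v w = explicit_metric lam c N \<eta>N gN x v w) \<and>
    (\<forall>k l. metric_signature N gN (2 * k) (2 * l) \<longrightarrow>
       pseudo_riemannian (KKM (Iplus lam c) N) g' \<and>
       metric_signature (KKM (Iplus lam c) N) g' (2 * k) (2 * l + 2) \<and>
       pseudo_riemannian (KKM (Iminus lam c) N) g' \<and>
       metric_signature (KKM (Iminus lam c) N) g' (2 * k + 2) (2 * l)) \<and>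
    (c = 0 \<longrightarrow>
       (if lam = 1 then Iplus lam c = {0<..} \<and> Iminus lam c = {}
        else Iplus lam c = {} \<and> Iminus lam c = {..<0}) \<and>
       (let I = (if lam = 1 then Iplus lam c else Iminus lam c);
            h = (\<lambda>x v w. - lam * g_CH1 x v w + pullback2 N base_proj gN x v w)
        in (\<forall>x\<in>points (KKM I N). \<forall>v\<in>tangent_space (KKM I N) x. \<forall>w\<in>tangent_space (KKM I N) x.
              2 * g' x v w = h x v w) \<and>
           (\<exists>F. diffeomorphism (KKM I N) (KKM {0<..} N) F \<and>
              (\<forall>x\<in>points (KKM I N). \<forall>v\<in>tangent_space (KKM I N) x. \<forall>w\<in>tangent_space (KKM I N) x.
                 pullback2 (KKM {0<..} N) F h x v w = 2 * g' x v w))))"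
proof -
  interpret kaehler_cone_hypersurface lam S gS J D N c
    by standard (rule cone hypersurface transversal)+
  note defs = M_def g_def \<xi>_def Z_def f_def \<eta>_def P_def N'_def \<Phi>_def \<eta>N_def gN_def g'_def
  have chart: "open_in N' (\<Phi> ` points (KKM I N)) \<and>
      diffeomorphism (KKM I N) (restrict_atlas N' (\<Phi> ` points (KKM I N))) \<Phi> \<and>
      (\<forall>x\<in>points (KKM I N). f (fst (\<Phi> x)) = fst x)" if "I \<in> {Iplus lam c, Iminus lam c}" for I
  proof -
    interpret kk_chart lam S gS J D N c I by (rule kk_chart_I[OF that])
    show ?thesis
      unfolding defs using image_embed_open diffeomorphism_embed hamiltonian_embed by blast
  qed
  have metric: "\<forall>x\<in>points (KKM I N). \<forall>v\<in>tangent_space (KKM I N) x. \<forall>w\<in>tangent_space (KKM I N) x.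
      g' x v w = explicit_metric lam c N \<eta>N gN x v w" if "I \<in> {Iplus lam c, Iminus lam c}" for I
  proof -
    interpret kk_chart lam S gS J D N c I by (rule kk_chart_I[OF that])
    have "\<rho> \<noteq> 0 \<and> \<rho> + 2 * c \<noteq> 0" if "\<rho> \<in> I" for \<rho>
      using that \<open>I \<in> {Iplus lam c, Iminus lam c}\<close> I_signs by blast
    from g'_eq[OF this] show ?thesis unfolding defs by blast
  qed
  have signature: "pseudo_riemannian (KKM (Iplus lam c) N) g' \<and>
       metric_signature (KKM (Iplus lam c) N) g' (2 * k) (2 * l + 2) \<and>
       pseudo_riemannian (KKM (Iminus lam c) N) g' \<and>
       metric_signature (KKM (Iminus lam c) N) g' (2 * k + 2) (2 * l)"
    if sig: "metric_signature N gN (2 * k) (2 * l)" for k l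
  proof -
    interpret plus: kk_chart lam S gS J D N c "Iplus lam c" by (rule kk_chart_I) simp
    interpret minus: kk_chart lam S gS J D N c "Iminus lam c" by (rule kk_chart_I) simp
    have nzp: "\<rho> \<noteq> 0 \<and> \<rho> + 2 * c \<noteq> 0" "(\<rho> + 2 * c) / (\<rho> * (\<rho> + c)) > 0" if "\<rho> \<in> Iplus lam c" for \<rho>
      using I_signs(1)[OF that] by blast+
    have nzm: "\<rho> \<noteq> 0 \<and> \<rho> + 2 * c \<noteq> 0" "(\<rho> + 2 * c) / (\<rho> * (\<rho> + c)) < 0" if "\<rho> \<in> Iminus lam c" for \<rho>
      using I_signs(2)[OF that] by blast+
    note sig' = sig[unfolded defs]
    note p = plus.signature_g'(2)[OF nzp(1) sig' nzp(2)] and m = minus.signature_g'(1)[OF nzm(1) sig' nzm(2)]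
    show ?thesis
      unfolding defs using p m plus.pseudo_riemannian_g'[OF nzp(1) p] minus.pseudo_riemannian_g'[OF nzm(1) m] by blast
  qed
  have undeformed: "(if lam = 1 then Iplus lam c = {0<..} \<and> Iminus lam c = {}
        else Iplus lam c = {} \<and> Iminus lam c = {..<0}) \<and>
       (let I = (if lam = 1 then Iplus lam c else Iminus lam c);
            h = (\<lambda>x v w. - lam * g_CH1 x v w + pullback2 N base_proj gN x v w)
        in (\<forall>x\<in>points (KKM I N). \<forall>v\<in>tangent_space (KKM I N) x. \<forall>w\<in>tangent_space (KKM I N) x.
              2 * g' x v w = h x v w) \<and>
           (\<exists>F. diffeomorphism (KKM I N) (KKM {0<..} N) F \<and>
              (\<forall>x\<in>points (KKM I N). \<forall>v\<in>tangent_space (KKM I N) x. \<forall>w\<in>tangent_space (KKM I N) x.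
                 pullback2 (KKM {0<..} N) F h x v w = 2 * g' x v w)))"
    if c: "c = 0"
  proof -
    define I where "I = (if lam = 1 then Iplus lam c else Iminus lam c)"
    have I: "I = {\<rho>. lam * \<rho> > 0}"
      using lam_cases c by (auto simp: I_def Iplus_def Iminus_def)
    have "I \<in> {Iplus lam c, Iminus lam c}" by (simp add: I_def)
    then interpret kk_chart lam S gS J D N c I by (rule kk_chart_I)
    note metric0 = g'_undeformed[OF c]
    note diffeo = undeformed_diffeomorphism[OF c I]
    have "if lam = 1 then Iplus lam c = {0<..} \<and> Iminus lam c = {}
        else Iplus lam c = {} \<and> Iminus lam c = {..<0}"
      using lam_cases c by (auto simp: Iplus_def Iminus_def)
    moreover have "\<exists>F. diffeomorphism (KKM I N) (KKM {0<..} N) F \<and>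
        (\<forall>x\<in>points (KKM I N). \<forall>v\<in>tangent_space (KKM I N) x. \<forall>w\<in>tangent_space (KKM I N) x.
          pullback2 (KKM {0<..} N) F (\<lambda>x v w. - lam * g_CH1 x v w + pullback2 N base_proj gN x v w) x v w = 2 * g' x v w)"
      unfolding defs by (intro exI conjI ballI, rule diffeo(1), simp only: diffeo(2) metric0)
    ultimately show ?thesis
      unfolding Let_def I_def[symmetric] using metric0 unfolding defs by blast
  qed
  have data: "holomorphic_field M J Z \<and> kk_data M J g D Z f \<and> kk_connection M J g Z \<eta>"
    unfolding defs by (intro conjI holomorphic_Z kk_data_cone kk_connection_cone)
  have hyper': "hypersurface N' P \<and> transversal N' P (kk_ZP M g Z f \<eta>)"
    unfolding defs by (intro conjI hypersurface_N' transversal_N')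
  have regular: "Iplus lam c \<inter> Iminus lam c = {} \<and>
     {y \<in> points N'. f (fst y) \<noteq> 0 \<and> kk_f1 g Z f (fst y) \<noteq> 0} =
       \<Phi> ` points (KKM (Iplus lam c) N) \<union> \<Phi> ` points (KKM (Iminus lam c) N)"
    unfolding defs by (intro conjI I_disjoint regular_points)
  note conj = conjI[OF ballI conjI[OF ballI conjI[OF allI[OF allI[OF impI]] impI]]]
  show ?thesis
    by (rule conjI[OF data conjI[OF hyper' conjI[OF regular conj]]]; (rule chart metric signature undeformed); assumption)
qed

end
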